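(* Let $k\in\mathbb{N}$, $\alpha>0$ and $p\in[1,\infty]$. Let $(X, \mathcal{F}, \mu, T)$ be a Kolmogorov system and let $(Y, \mathcal{G}, \nu, S)$ be a $k$-th order Wiener-Wintner system of power type $\alpha$ in $L^p$. Then $(X \times Y, \mathcal{F} \otimes \mathcal{G}, \mu \times \nu, T \times S)$ is a $k$-th order Wiener-Wintner system of power type $\min\{1/6, \alpha\}$ in $L^{\min\{2,p\}}(\mu \times \nu)$.
   Context: A system $(X,\mathcal{F},\mu,T)$ is a probability space with a measure-preserving map $T$. Notation: $[M]=\{1,\dots,M\}$; $V_k=\{0,1\}^k$; for $\eta\in V_k$, $|\eta|=\sum_j\eta_j$ and $h\cdot\eta=\sum_j h_j\eta_j$; $c$ is complex conjugation, so $c^{|\eta|}g$ equals $g$ if $|\eta|$ is even and $\overline g$ if $|\eta|$ is odd. Kolmogorov system (K system): an invertible ergodic system whose Pinsker $\sigma$-algebra is trivial; that is, there is a sub-$\sigma$-algebra $\mathcal{A}\subset\mathcal{F}$ with $T^{-1}\mathcal{A}\subset\mathcal{A}$, $\bigcap_{n\in\mathbb{N}}T^{-n}\mathcal{A}$ trivial mod $\mu$, and $\bigvee_{n\in\mathbb{N}}T^n\mathcal{A}$ dense in $\mathcal{F}$ (equal to $\mathcal{F}$ mod $\mu$). Wiener-Wintner (WW) functions. Let $p\in[1,\infty]$, $\alpha>0$. A function $f\in L^\infty(\mu)$ is a first-order WW function of power type $\alpha$ in $L^p$ if there is $C_f>0$ with $\left\|\sup_{t\in\mathbb{R}}\left|\frac1N\sum_{n=1}^N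 e^{2\pi i n t}f\circ T^n\right|\right\|_p\le C_f N^{-\alpha}$ for all $N\in\mathbb{N}$. For $k\ge2$, $f\in L^\infty(\mu)$ is a $k$-th order WW function of power type $\alpha$ in $L^p$ if there is $C_f>0$ such that for all $N\in\mathbb{N}$ $$\frac{1}{\lfloor \sqrt{N} \rfloor^{k-1}} \sum_{h \in [\lfloor \sqrt{N} \rfloor]^{k-1}}\left\| \sup_{t\in\mathbb{R}} \left| \frac{1}{N} \sum_{n=1}^N e^{2\pi i n t} \left[\prod_{\eta\in V_{k-1}} c^{|\eta|} f \circ T^{h \cdot \eta} \right]\circ T^n \right| \right\|_p^{2/3} \leq \frac{C_f}{N^\alpha}.$$ Host-Kra-Ziegler factors. For an ergodic system and $f\in L^\infty(\mu)$ put $|||f|||_2^4=\lim_H\frac1H\sum_{h=1}^H\left|\int f\cdot\overline{f\circ T^h}\,d\mu\right|^2$ and, for $k\ge3$, $|||f|||_k^{2^k}=\lim_H\frac1H\sum_{h=1}^H|||f\cdot\overline{f\circ T^h}|||_{k-1}^{2^{k-1}}$. For $k\ge1$, $\mathcal{Z}_k$ is the $k$-th Host-Kra-Ziegler factor: the invariant sub-$\sigma$-algebra characterized by $\mathbb{E}(f|\mathcal{Z}_k)=0\iff|||f|||_{k+1}=0$ for $f\in L^\infty(\mu)$ ($\mathcal{Z}_1$ is the Kronecker factor). $L^2(\mathcal{Z}_k)^\perp=\{f\in L^2(\mu):\mathbb{E}(f|\mathcal{Z}_k)=0\}$. WW systems. An ergodic system is a $k$-th order WW system of power type $\alpha$ in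 $L^p$ if there is a set of $k$-th order WW functions of power type $\alpha$ in $L^p$ that is $L^2$-dense in $L^2(\mathcal{Z}_k)^\perp$. *)

theory Defs
  imports "HOL-Probability.Probability"
begin

section \<open>Systems\<close>

definition mp_system :: "'a measure \<Rightarrow> ('a \<Rightarrow> 'a) \<Rightarrow> bool" where
  "mp_system M T \<longleftrightarrow> prob_space M \<and> T \<in> M \<rightarrow>\<^sub>M M \<and> distr M M T = M"

definition ergodic_system :: "'a measure \<Rightarrow> ('a \<Rightarrow> 'a) \<Rightarrow> bool" where
  "ergodic_system M T \<longleftrightarrow> mp_system M T \<and>
     (\<forall>A\<in>sets M. T -` A \<inter> space M = A \<longrightarrow> measure M A = 0 \<or> measure M A = 1)"

definition invertible_system :: "'a measure \<Rightarrow> ('a \<Rightarrow> 'a) \<Rightarrow> bool" where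
  "invertible_system M T \<longleftrightarrow> mp_system M T \<and> bij_betw T (space M) (space M) \<and>
     the_inv_into (space M) T \<in> M \<rightarrow>\<^sub>M M"

text \<open>The measure carried by \<open>A\<close> plays no role: as in the library's \<^const>\<open>subalgebra\<close>,
  only its underlying sigma-algebra is used. Indices \<open>n\<close> start at 0, which changes neither the
  intersection nor the join, because the sigma-algebras involved are monotone in \<open>n\<close>.\<close>

definition kolmogorov_system :: "'a measure \<Rightarrow> ('a \<Rightarrow> 'a) \<Rightarrow> bool" where
  "kolmogorov_system M T \<longleftrightarrow> invertible_system M T \<and> ergodic_system M T \<and>
     (\<exists>A. subalgebra M A \<and>
        {T -` B \<inter> space M | B. B \<in> sets A} \<subseteq> sets A \<and>
        (\<forall>E \<in> (\<Inter>n. {(T ^^ n) -` B \<inter> space M | B. B \<in> sets A}).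
            measure M E = 0 \<or> measure M E = 1) \<and>
        (\<forall>E\<in>sets M. \<exists>E' \<in> sigma_sets (space M) (\<Union>n. {(T ^^ n) ` B | B. B \<in> sets A}).
            AE x in M. x \<in> E \<longleftrightarrow> x \<in> E'))"

section \<open>Function spaces\<close>

text \<open>Only meaningful for \<open>1 \<le> p\<close> and functions in \<open>L\<^sup>p\<close>; below it is applied exclusively to
  such functions.\<close>

definition Lp_norm :: "'a measure \<Rightarrow> ereal \<Rightarrow> ('a \<Rightarrow> 'b::real_normed_vector) \<Rightarrow> real" where
  "Lp_norm M p g =
     (if p = \<infinity> then real_of_ereal (esssup M (\<lambda>x. ereal (norm (g x))))
      else (\<integral>x. norm (g x) powr real_of_ereal p \<partial>M) powr (1 / real_of_ereal p))"

definition L_infinity :: "'a measure \<Rightarrow> ('a \<Rightarrow> complex) set" where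
  "L_infinity M = {f. f \<in> borel_measurable M \<and> (\<exists>B. AE x in M. norm (f x) \<le> B)}"

definition L_two :: "'a measure \<Rightarrow> ('a \<Rightarrow> complex) set" where
  "L_two M = {f. f \<in> borel_measurable M \<and> integrable M (\<lambda>x. (norm (f x))\<^sup>2)}"

text \<open>The library's conditional expectation is real-valued.\<close>

definition complex_cond_exp :: "'a measure \<Rightarrow> 'a measure \<Rightarrow> ('a \<Rightarrow> complex) \<Rightarrow> 'a \<Rightarrow> complex" where
  "complex_cond_exp M F f x =
     Complex (real_cond_exp M F (\<lambda>y. Re (f y)) x) (real_cond_exp M F (\<lambda>y. Im (f y)) x)"

definition L_two_perp :: "'a measure \<Rightarrow> 'a measure \<Rightarrow> ('a \<Rightarrow> complex) set" where
  "L_two_perp M Z = {f \<in> L_two M. AE x in M. complex_cond_exp M Z f x = 0}"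

section \<open>Host-Kra-Ziegler factors\<close>

text \<open>\<open>hk_power M T j f\<close> is \<open>|||f|||\<^sub>k\<close> raised to the power \<open>2 ^ k\<close>, where \<open>k = j + 2\<close>.\<close>

primrec hk_power :: "'a measure \<Rightarrow> ('a \<Rightarrow> 'a) \<Rightarrow> nat \<Rightarrow> ('a \<Rightarrow> complex) \<Rightarrow> real" where
  "hk_power M T 0 f =
     lim (\<lambda>H. (1 / real H) * (\<Sum>h=1..H. (norm (\<integral>x. f x * cnj (f ((T ^^ h) x)) \<partial>M))\<^sup>2))"
| "hk_power M T (Suc j) f =
     lim (\<lambda>H. (1 / real H) * (\<Sum>h=1..H. hk_power M T j (\<lambda>x. f x * cnj (f ((T ^^ h) x)))))"

text \<open>Meaningful for \<open>k \<ge> 2\<close>.\<close>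

definition hk_seminorm :: "'a measure \<Rightarrow> ('a \<Rightarrow> 'a) \<Rightarrow> nat \<Rightarrow> ('a \<Rightarrow> complex) \<Rightarrow> real" where
  "hk_seminorm M T k f = root (2 ^ k) (hk_power M T (k - 2) f)"

text \<open>\<open>Z\<close> is a version of the \<open>k\<close>-th factor; the characterization determines it up to null
  sets.\<close>

definition hkz_factor :: "'a measure \<Rightarrow> ('a \<Rightarrow> 'a) \<Rightarrow> nat \<Rightarrow> 'a measure \<Rightarrow> bool" where
  "hkz_factor M T k Z \<longleftrightarrow> subalgebra M Z \<and> T \<in> Z \<rightarrow>\<^sub>M Z \<and>
     (\<forall>f\<in>L_infinity M. (AE x in M. complex_cond_exp M Z f x = 0) \<longleftrightarrow> hk_seminorm M T (k + 1) f = 0)"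

section \<open>Wiener-Wintner functions and systems\<close>

text \<open>The supremum is over a bounded set of reals, for every \<open>x\<close>.\<close>

definition ww_sup :: "('a \<Rightarrow> 'a) \<Rightarrow> nat \<Rightarrow> ('a \<Rightarrow> complex) \<Rightarrow> 'a \<Rightarrow> real" where
  "ww_sup T N F x =
     (SUP t::real. norm ((1 / of_nat N) * (\<Sum>n=1..N. cis (2 * pi * real n * t) * F ((T ^^ n) x))))"

definition cube :: "nat \<Rightarrow> (nat \<Rightarrow> nat) set" where
  "cube k = {1..k} \<rightarrow>\<^sub>E {0, 1}"

definition cube_product ::
    "('a \<Rightarrow> 'a) \<Rightarrow> nat \<Rightarrow> (nat \<Rightarrow> nat) \<Rightarrow> ('a \<Rightarrow> complex) \<Rightarrow> 'a \<Rightarrow> complex" where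
  "cube_product T k h f x =
     (\<Prod>\<eta>\<in>cube k. (cnj ^^ (\<Sum>j=1..k. \<eta> j)) (f ((T ^^ (\<Sum>j=1..k. h j * \<eta> j)) x)))"

definition ww_function ::
    "nat \<Rightarrow> real \<Rightarrow> ereal \<Rightarrow> 'a measure \<Rightarrow> ('a \<Rightarrow> 'a) \<Rightarrow> ('a \<Rightarrow> complex) \<Rightarrow> bool" where
  "ww_function k \<alpha> p M T f \<longleftrightarrow> f \<in> L_infinity M \<and>
     (\<exists>C>0. \<forall>N\<ge>1.
        (if k = 1 then Lp_norm M p (ww_sup T N f) \<le> C * real N powr (- \<alpha>)
         else (let R = nat \<lfloor>sqrt (real N)\<rfloor> in
           (1 / real R ^ (k - 1)) *
             (\<Sum>h \<in> {1..k - 1} \<rightarrow>\<^sub>E {1..R}.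
                Lp_norm M p (ww_sup T N (cube_product T (k - 1) h f)) powr (2 / 3))
           \<le> C / real N powr \<alpha>)))"

definition L_two_dense_in :: "'a measure \<Rightarrow> ('a \<Rightarrow> complex) set \<Rightarrow> ('a \<Rightarrow> complex) set \<Rightarrow> bool" where
  "L_two_dense_in M D V \<longleftrightarrow> D \<subseteq> V \<and>
     (\<forall>g\<in>V. \<forall>\<epsilon>>0. \<exists>f\<in>D. Lp_norm M 2 (\<lambda>x. f x - g x) < \<epsilon>)"

definition ww_system :: "nat \<Rightarrow> real \<Rightarrow> ereal \<Rightarrow> 'a measure \<Rightarrow> ('a \<Rightarrow> 'a) \<Rightarrow> bool" where
  "ww_system k \<alpha> p M T \<longleftrightarrow> ergodic_system M T \<and>
     (\<exists>Z. hkz_factor M T k Z \<and>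
       (\<exists>D. (\<forall>f\<in>D. ww_function k \<alpha> p M T f) \<and> L_two_dense_in M D (L_two_perp M Z)))"

end

theory Submission
  imports Defs
begin

text \<open>
  Write \<open>X\<close> for the Kolmogorov system, \<open>Y\<close> for the Wiener-Wintner system, \<open>R\<close> for the product map and \<open>E\<close>
  for integration over \<open>X\<close>, and let \<open>A\<close> be the sigma-algebra witnessing the Kolmogorov property. A bounded
  function on \<open>X\<close> is, up to its mean, close in \<open>L\<^sup>2\<close> to a function that is measurable for \<open>T\<^sup>m A\<close> and orthogonal
  to all bounded functions measurable for \<open>T\<^sup>-\<^sup>n A\<close>, for some \<open>m\<close> and \<open>n\<close>. Fibrewise, \<open>F - E F\<close> is
  close to a bounded function \<open>V\<close> of this kind whenever \<open>F \<in> L\<^sup>2(X \<times> Y)\<close>. The correlations of \<open>V\<close> vanish at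
  distances at least \<open>m + n\<close>. Hence the seminorms of \<open>F\<close> on \<open>X \<times> Y\<close> are those of \<open>E F\<close> on \<open>Y\<close>, the factors of
  \<open>X \<times> Y\<close> are those of \<open>Y\<close>, and it remains to see that \<open>g + V\<close> is a Wiener-Wintner function if \<open>g\<close> is one on \<open>Y\<close>.

  Expanding the square of \<open>|\<Sum>\<^sub>n e(nt) V(R\<^sup>n z)|\<close> into autocorrelations, which are \<open>O(\<surd>N)\<close> in \<open>L\<^sup>2\<close>, shows that the
  Wiener-Wintner averages of \<open>V\<close> are \<open>O(N^(-1/4))\<close> in \<open>L\<^sup>2\<close>; the exponent \<open>1/6\<close> is \<open>1/4 \<cdot> 2/3\<close>. For higher
  orders, if the times \<open>h \<cdot> \<eta>\<close> are far apart, then the product of \<open>g + V\<close> over the cube differs from that of \<open>g\<close> by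
  a sum of functions of the same kind as \<open>V\<close>; the exceptional \<open>h\<close> have density \<open>O(N^(-1/2))\<close>.
\<close>

section \<open>Cesaro means of positive definite sequences\<close>

text \<open>The seminorms are iterated values of \<open>lim\<close>, so their limits must be known
  to exist at every level. The route is positivity: each level is positive definite on products
  \<open>F i * cnj (F k)\<close>, and Cesaro means of positive definite sequences converge by an
  argument with quadratic forms alone. The passage from X x Y to Y is one induction: fibre means of
  correlations approach correlations of fibre means only in L^1, so a Lipschitz bound in L^1 is
  carried along. Orthogonality to the future acts in one direction: a factor at time t is orthogonal
  to what is measurable from t + L on, but not necessarily to the past. This forces an ordering of
  the cube by time and the removal of those h for which two vertices have nearly equal times. The
  exponent \<open>min 2 p\<close> arises because V is controlled in L^2 and g in L^p, and on a
  probability space the smaller exponent is dominated by both. For k = 1 the function V would even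
  allow the rate 1/4; the power 2/3 in the definition for k \<ge> 2 lowers it to 1/6, and the
  exceptional h are too rare to lower it further.\<close>

lemma sum_shift_bound:
  fixes f :: "int \<Rightarrow> real"
  assumes "\<And>x. \<bar>f x\<bar> \<le> B"
  shows "\<bar>(\<Sum>m<L. f (int m + a + int i)) - (\<Sum>m<L. f (int m + a))\<bar> \<le> 2 * real i * B"
proof (induction i)
  case (Suc i)
  \<comment> \<open>Moving the window by one place drops one end term and gains another, each at
    most \<open>B\<close> in absolute value.\<close>
  have "(\<Sum>m<L. f (int m + a + int (Suc i))) - (\<Sum>m<L. f (int m + a + int i))
      = (\<Sum>m<L. f (int (Suc m) + a + int i) - f (int m + a + int i))"
    by (simp add: sum_subtractf algebra_simps)
  also have "\<dots> = f (int L + a + int i) - f (0 + a + int i)"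
    by (subst sum_lessThan_telescope) simp
  finally have "\<bar>(\<Sum>m<L. f (int m + a + int (Suc i))) - (\<Sum>m<L. f (int m + a + int i))\<bar> \<le> 2 * B"
    using assms[of "int L + a + int i"] assms[of "0 + a + int i"] by linarith
  then show ?case using Suc by (simp add: algebra_simps)
qed simp

text \<open>Such a sequence is the autocorrelation of a vector under a unitary operator. No Hilbert
  space is constructed: a family of weights stands for a combination of shifts of that vector, and
  the quadratic form for its squared norm.\<close>

locale pos_def_sequence =
  fixes \<gamma> :: "int \<Rightarrow> real"
  assumes even: "\<gamma> (- n) = \<gamma> n"
    and psd: "\<And>(I :: nat set) w. finite I \<Longrightarrow> 0 \<le> (\<Sum>i\<in>I. \<Sum>j\<in>I. w i * w j * \<gamma> (int i - int j))"
begin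

text \<open>Weights at the same time add up, which reduces a family to a set of times. Coinciding
  times do occur below, where overlapping time ranges enter one form with different weights.\<close>

lemma psd_family:
  assumes "finite (I :: 'i set)"
  shows "0 \<le> (\<Sum>i\<in>I. \<Sum>j\<in>I. w i * w j * \<gamma> (int (\<tau> i) - int (\<tau> j)))"
proof -
  define J where "J = \<tau> ` I"
  define v where "v x = (\<Sum>i\<in>{i\<in>I. \<tau> i = x}. w i)" for x
  have J: "finite J" using assms by (simp add: J_def)
  have 1: "(\<Sum>i\<in>I. w i * g (\<tau> i)) = (\<Sum>x\<in>J. v x * g x)" for g :: "nat \<Rightarrow> real"
  proof -
    have "(\<Sum>i\<in>I. w i * g (\<tau> i)) = (\<Sum>x\<in>J. \<Sum>i\<in>{i\<in>I. \<tau> i = x}. w i * g (\<tau> i))"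
      unfolding J_def by (rule sum.image_gen[OF assms])
    also have "\<dots> = (\<Sum>x\<in>J. v x * g x)"
      unfolding v_def by (auto simp: sum_distrib_right intro!: sum.cong)
    finally show ?thesis .
  qed
  have "(\<Sum>i\<in>I. \<Sum>j\<in>I. w i * w j * \<gamma> (int (\<tau> i) - int (\<tau> j)))
      = (\<Sum>i\<in>I. w i * (\<Sum>j\<in>I. w j * \<gamma> (int (\<tau> i) - int (\<tau> j))))"
    by (simp add: sum_distrib_left mult.assoc)
  also have "\<dots> = (\<Sum>x\<in>J. v x * (\<Sum>j\<in>I. w j * \<gamma> (int x - int (\<tau> j))))"
    by (rule 1)
  also have "\<dots> = (\<Sum>x\<in>J. v x * (\<Sum>y\<in>J. v y * \<gamma> (int x - int y)))"
    by (subst 1) simp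
  also have "\<dots> = (\<Sum>x\<in>J. \<Sum>y\<in>J. v x * v y * \<gamma> (int x - int y))"
    by (simp add: sum_distrib_left mult.assoc)
  finally show ?thesis using psd[OF J, of v] by simp
qed

text \<open>The form is tested on the two points 0 and |n|, with weights (1, 1) and (1, -1).\<close>

lemma bound: "\<bar>\<gamma> n\<bar> \<le> \<gamma> 0"
proof (cases "n = 0")
  case True
  then show ?thesis using psd[of "{0}" "\<lambda>_. 1"] by simp
next
  case False
  define m where "m = nat \<bar>n\<bar>"
  have m: "m > 0" "\<gamma> (int m) = \<gamma> n" "\<gamma> (- int m) = \<gamma> n"
    using False even[of n] even[of "int m"] by (auto simp: m_def abs_if)
  show ?thesis
    using psd[of "{0, m}" "\<lambda>_. 1"] psd[of "{0, m}" "\<lambda>i. if i = 0 then 1 else -1"] m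
    by auto
qed

definition mean_square :: "nat \<Rightarrow> real" where
  "mean_square L = (1 / (real L)\<^sup>2) * (\<Sum>m<L. \<Sum>n<L. \<gamma> (int m - int n))"

text \<open>Let x be the combination of shifts given by \<open>w\<close> and \<tau>. Up to boundary
  terms, the mean over \<open>{..<L}\<close> is an average of shifts of x, and the inner product of
  two shifts of x is at most its squared seminorm. The error comes from moving both summation
  windows by at most \<open>N\<close>.\<close>

lemma mean_square_le:
  assumes I: "finite (I :: 'i set)" and w: "\<And>i. i \<in> I \<Longrightarrow> 0 \<le> w i" "sum w I = 1"
    and \<tau>: "\<And>i. i \<in> I \<Longrightarrow> \<tau> i \<le> N" and L: "L > 0"
  shows "mean_square L \<le> (\<Sum>i\<in>I. \<Sum>j\<in>I. w i * w j * \<gamma> (int (\<tau> i) - int (\<tau> j))) + 4 * real N * \<gamma> 0 / real L"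
proof -
  let ?q = "\<Sum>i\<in>I. \<Sum>j\<in>I. w i * w j * \<gamma> (int (\<tau> i) - int (\<tau> j))"
  \<comment> \<open>Cauchy-Schwarz for two shifts of x: the form is nonnegative on their difference.
    The Boolean tag keeps the two copies of \<open>I\<close> apart.\<close>
  have C: "(\<Sum>i\<in>I. \<Sum>j\<in>I. w i * w j * \<gamma> (int (m + \<tau> i) - int (n + \<tau> j))) \<le> ?q" for m n
  proof -
    define W where "W = (\<lambda>(b, i). if b then w i else - w i)"
    define P where "P = (\<lambda>(b, i). (if b then m else n) + \<tau> i)"
    have fin: "finite ((UNIV :: bool set) \<times> I)" using I by simp
    have "0 \<le> (\<Sum>x\<in>UNIV \<times> I. \<Sum>y\<in>UNIV \<times> I. W x * W y * \<gamma> (int (P x) - int (P y)))"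
      by (rule psd_family[OF fin])
    also have "\<dots> = (\<Sum>a\<in>UNIV. \<Sum>i\<in>I. \<Sum>b\<in>UNIV. \<Sum>j\<in>I. W (a,i) * W (b,j) * \<gamma> (int (P (a,i)) - int (P (b,j))))"
      by (simp only: sum.cartesian_product')
    also have "\<dots> = 2 * ?q - (\<Sum>i\<in>I. \<Sum>j\<in>I. w i * w j * \<gamma> (int (m + \<tau> i) - int (n + \<tau> j)))
        - (\<Sum>i\<in>I. \<Sum>j\<in>I. w i * w j * \<gamma> (int (n + \<tau> i) - int (m + \<tau> j)))"
      by (simp add: UNIV_bool W_def P_def sum.distrib sum_negf sum_subtractf algebra_simps)
    also have "(\<Sum>i\<in>I. \<Sum>j\<in>I. w i * w j * \<gamma> (int (n + \<tau> i) - int (m + \<tau> j)))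
      = (\<Sum>i\<in>I. \<Sum>j\<in>I. w i * w j * \<gamma> (int (m + \<tau> i) - int (n + \<tau> j)))"
    proof -
      have "w i * w j * \<gamma> (int (n + \<tau> i) - int (m + \<tau> j)) = w j * w i * \<gamma> (int (m + \<tau> j) - int (n + \<tau> i))" for i j
        using even[of "int (n + \<tau> i) - int (m + \<tau> j)"] by (simp add: mult.commute)
      then show ?thesis by (subst sum.swap) (simp only:)
    qed
    finally show ?thesis by simp
  qed
  \<comment> \<open>Each of the two windows is moved once. This changes every one of the
    \<open>L\<close> rows or columns by at most 2 N \<gamma>(0), so the total error is of order L,
    against the normalisation L^2.\<close>
  have D: "mean_square L \<le> (1 / (real L)\<^sup>2) * (\<Sum>m<L. \<Sum>n<L. \<gamma> (int (m + a) - int (n + b))) + 4 * real N * \<gamma> 0 / real L"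
    if ab: "a \<le> N" "b \<le> N" for a b
  proof -
    have g0: "0 \<le> \<gamma> 0" using bound[of 0] by simp
    have s1: "\<bar>(\<Sum>m<L. \<gamma> (int (m + a) - int (n + b))) - (\<Sum>m<L. \<gamma> (int m - int (n + b)))\<bar> \<le> 2 * real a * \<gamma> 0" for n
      using sum_shift_bound[where f=\<gamma> and B="\<gamma> 0" and L=L and a="- int (n + b)" and i=a, OF bound] by (simp add: algebra_simps)
    have s2: "\<bar>(\<Sum>n<L. \<gamma> (int m - int (n + b))) - (\<Sum>n<L. \<gamma> (int m - int n))\<bar> \<le> 2 * real b * \<gamma> 0" for m
      using sum_shift_bound[where f="\<lambda>x. \<gamma> (- x)" and B="\<gamma> 0" and L=L and a="- int m" and i=b] bound by (simp add: algebra_simps)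
    have ab': "2 * real a * \<gamma> 0 \<le> 2 * real N * \<gamma> 0" "2 * real b * \<gamma> 0 \<le> 2 * real N * \<gamma> 0"
      using ab g0 by (auto intro!: mult_right_mono)
    have "(\<Sum>m<L. \<Sum>n<L. \<gamma> (int m - int n)) \<le> (\<Sum>m<L. (\<Sum>n<L. \<gamma> (int m - int (n + b))) + 2 * real N * \<gamma> 0)"
      using s2 ab' by (intro sum_mono) (smt (verit))
    also have "\<dots> = (\<Sum>n<L. \<Sum>m<L. \<gamma> (int m - int (n + b))) + real L * (2 * real N * \<gamma> 0)"
      by (simp add: sum.distrib) (rule sum.swap)
    also have "\<dots> \<le> (\<Sum>n<L. (\<Sum>m<L. \<gamma> (int (m + a) - int (n + b))) + 2 * real N * \<gamma> 0) + real L * (2 * real N * \<gamma> 0)"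
      using s1 ab' by (intro add_mono order_refl sum_mono) (smt (verit))
    also have "\<dots> = (\<Sum>m<L. \<Sum>n<L. \<gamma> (int (m + a) - int (n + b))) + real L * (4 * real N * \<gamma> 0)"
      by (simp add: sum.distrib) (rule sum.swap)
    finally have "mean_square L \<le> (1 / (real L)\<^sup>2) * ((\<Sum>m<L. \<Sum>n<L. \<gamma> (int (m + a) - int (n + b))) + real L * (4 * real N * \<gamma> 0))"
      unfolding mean_square_def by (intro mult_left_mono) auto
    then show ?thesis using L by (simp add: field_simps power2_eq_square)
  qed
  let ?K = "4 * real N * \<gamma> 0 / real L"
  let ?G = "\<lambda>a b. (1 / (real L)\<^sup>2) * (\<Sum>m<L. \<Sum>n<L. \<gamma> (int (m + a) - int (n + b)))"
  have ww: "(\<Sum>i\<in>I. \<Sum>j\<in>I. w i * w j * c) = c" for c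
    using w(2) by (simp add: sum_distrib_right[symmetric] sum_distrib_left[symmetric])
  have "mean_square L = (\<Sum>i\<in>I. \<Sum>j\<in>I. w i * w j * mean_square L)" by (simp only: ww)
  also have "\<dots> \<le> (\<Sum>i\<in>I. \<Sum>j\<in>I. w i * w j * (?G (\<tau> i) (\<tau> j) + ?K))"
    using w \<tau> D by (intro sum_mono mult_left_mono) auto
  also have "\<dots> = (\<Sum>i\<in>I. \<Sum>j\<in>I. w i * w j * ?G (\<tau> i) (\<tau> j)) + ?K"
    by (simp only: distrib_left sum.distrib ww)
  also have "(\<Sum>i\<in>I. \<Sum>j\<in>I. w i * w j * ?G (\<tau> i) (\<tau> j))
     = (1 / (real L)\<^sup>2) * (\<Sum>m<L. \<Sum>n<L. \<Sum>i\<in>I. \<Sum>j\<in>I. w i * w j * \<gamma> (int (m + \<tau> i) - int (n + \<tau> j)))"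
  proof -
    have "(\<Sum>i\<in>I. \<Sum>j\<in>I. w i * w j * ?G (\<tau> i) (\<tau> j))
       = (\<Sum>i\<in>I. \<Sum>j\<in>I. \<Sum>m<L. \<Sum>n<L. (1 / (real L)\<^sup>2) * (w i * w j * \<gamma> (int (m + \<tau> i) - int (n + \<tau> j))))"
      by (simp add: sum_distrib_left mult_ac)
    also have "\<dots> = (\<Sum>i\<in>I. \<Sum>m<L. \<Sum>n<L. \<Sum>j\<in>I. (1 / (real L)\<^sup>2) * (w i * w j * \<gamma> (int (m + \<tau> i) - int (n + \<tau> j))))"
      by (subst sum.swap, subst (2) sum.swap) simp
    also have "\<dots> = (\<Sum>m<L. \<Sum>n<L. \<Sum>i\<in>I. \<Sum>j\<in>I. (1 / (real L)\<^sup>2) * (w i * w j * \<gamma> (int (m + \<tau> i) - int (n + \<tau> j))))"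
      by (subst sum.swap, subst (2) sum.swap) simp
    finally show ?thesis by (simp only: sum_distrib_left)
  qed
  also have "\<dots> \<le> (1 / (real L)\<^sup>2) * (\<Sum>m<L. \<Sum>n<L. ?q)"
    by (intro mult_left_mono) (rule sum_mono, rule sum_mono, rule C, simp)
  also have "\<dots> = ?q" using L by (simp add: power2_eq_square)
  finally show ?thesis by simp
qed

text \<open>
  The mean ergodic theorem for the shift in the seminorm defined by \<open>\<gamma>\<close>: if \<open>a\<^sub>H\<close> denotes the uniform weights on
  \<open>{0..<H}\<close>, then the squared seminorms \<open>mean_square H\<close> of \<open>a\<^sub>H\<close> tend to their infimum \<open>d\<close>, which also bounds that
  of \<open>(a\<^sub>H + a\<^sub>K) / 2\<close> from below. So the inner product of \<open>a\<^sub>H\<close> and \<open>a\<^sub>K\<close> is close to \<open>d\<close>, and it is close to the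
  Cesaro mean of length \<open>K\<close> when \<open>K\<close> is much larger than \<open>H\<close>.
\<close>

lemma cesaro_convergent: "convergent (\<lambda>H. (1 / real H) * (\<Sum>h=1..H. \<gamma> (int h)))"
proof -
  let ?S = "\<lambda>K. (1 / real K) * (\<Sum>h=1..K. \<gamma> (int h))"
  define d where "d = (INF H\<in>{1..}. mean_square H)"
  have g0: "0 \<le> \<gamma> 0" using bound[of 0] by simp
  have s0: "0 \<le> mean_square H" for H
    using psd_family[of "{..<H}" "\<lambda>_. 1" id] unfolding mean_square_def by (intro mult_nonneg_nonneg) auto
  have bdd: "bdd_below (mean_square ` {1..})" using s0 by (auto intro!: bdd_belowI[of _ 0])
  have dle: "d \<le> mean_square H" if "H \<ge> 1" for H
    unfolding d_def using bdd that by (auto intro!: cINF_lower)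
  \<comment> \<open>\<open>mid\<close> uses the form at the midpoint of the two uniform weights,
    \<open>psdHK\<close> at their difference; they bound the inner product of the two from below and
    from above.\<close>
  have mid: "d \<le> (mean_square H + 2 * ((1 / (real H * real K)) * (\<Sum>m<H. \<Sum>n<K. \<gamma> (int m - int n))) + mean_square K) / 4"
    (is "_ \<le> (_ + 2 * ?B + _) / 4")
    and psdHK: "2 * ((1 / (real H * real K)) * (\<Sum>m<H. \<Sum>n<K. \<gamma> (int m - int n))) \<le> mean_square H + mean_square K"
    if HK: "H \<ge> 1" "K \<ge> 1" for H K
  proof -
    let ?B = "(1 / (real H * real K)) * (\<Sum>m<H. \<Sum>n<K. \<gamma> (int m - int n))"
    have sw: "(\<Sum>n<K. \<Sum>m<H. \<gamma> (int n - int m)) = (\<Sum>m<H. \<Sum>n<K. \<gamma> (int m - int n))"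
      using even by (subst sum.swap) (metis (no_types, lifting) minus_diff_eq sum.cong)
    \<comment> \<open>The value of the form with weight x on the first block and y on the second.
      The disjoint sum keeps the blocks apart although their times overlap.\<close>
    have Q: "(\<Sum>i\<in>{..<H} <+> {..<K}. \<Sum>j\<in>{..<H} <+> {..<K}. w i * w j * \<gamma> (int (case_sum id id i) - int (case_sum id id j)))
        = (real H * x)\<^sup>2 * mean_square H + 2 * (real H * x) * (real K * y) * ?B + (real K * y)\<^sup>2 * mean_square K"
      if w: "w = case_sum (\<lambda>_. x) (\<lambda>_. y)" for x y w
    proof -
      have "(\<Sum>i\<in>{..<H} <+> {..<K}. \<Sum>j\<in>{..<H} <+> {..<K}. w i * w j * \<gamma> (int (case_sum id id i) - int (case_sum id id j)))
        = x * x * (\<Sum>m<H. \<Sum>n<H. \<gamma> (int m - int n)) + 2 * x * y * (\<Sum>m<H. \<Sum>n<K. \<gamma> (int m - int n))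
          + y * y * (\<Sum>m<K. \<Sum>n<K. \<gamma> (int m - int n))"
        using sw by (simp add: sum.Plus w o_def sum.distrib sum_distrib_left[symmetric])
      moreover have "(real H * x)\<^sup>2 * mean_square H = x * x * (\<Sum>m<H. \<Sum>n<H. \<gamma> (int m - int n))"
        "(real K * y)\<^sup>2 * mean_square K = y * y * (\<Sum>m<K. \<Sum>n<K. \<gamma> (int m - int n))"
        "(real H * x) * (real K * y) * ?B = x * y * (\<Sum>m<H. \<Sum>n<K. \<gamma> (int m - int n))"
        using HK by (simp_all add: mean_square_def power2_eq_square)
      ultimately show ?thesis by (simp only: mult.assoc)
    qed
    have fin: "finite ({..<H} <+> {..<K})" by simp
    show "2 * ?B \<le> mean_square H + mean_square K"
      using psd_family[OF fin, of "case_sum (\<lambda>_. 1 / real H) (\<lambda>_. - 1 / real K)" "case_sum id id"]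
        Q[OF refl, of "1 / real H" "- 1 / real K"] HK by simp
    define w where "w = case_sum (\<lambda>_::nat. 1 / (2 * real H)) (\<lambda>_::nat. 1 / (2 * real K))"
    have sum1: "sum w ({..<H} <+> {..<K}) = 1"
      using HK by (simp add: sum.Plus w_def o_def)
    have sL: "mean_square L \<le> (\<Sum>i\<in>{..<H} <+> {..<K}. \<Sum>j\<in>{..<H} <+> {..<K}. w i * w j * \<gamma> (int (case_sum id id i) - int (case_sum id id j)))
       + 4 * real (H + K) * \<gamma> 0 / real L" if "L > 0" for L
      by (rule mean_square_le) (use that sum1 in \<open>auto simp: w_def\<close>)
    have le: "d \<le> (mean_square H + 2 * ?B + mean_square K) / 4 + 4 * real (H + K) * \<gamma> 0 / real L" if "L > 0" for L
    proof -
      have q: "(\<Sum>i\<in>{..<H} <+> {..<K}. \<Sum>j\<in>{..<H} <+> {..<K}. w i * w j * \<gamma> (int (case_sum id id i) - int (case_sum id id j)))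
        = (mean_square H + 2 * ?B + mean_square K) / 4"
        unfolding Q[OF w_def] using HK by (simp add: power2_eq_square add_divide_distrib)
      show ?thesis using sL[OF that] dle[of L] that unfolding q by linarith
    qed
    \<comment> \<open>With H and K fixed, the boundary error disappears as L grows.\<close>
    have "(\<lambda>L. (mean_square H + 2 * ?B + mean_square K) / 4 + 4 * real (H + K) * \<gamma> 0 / real L) \<longlonglongrightarrow> (mean_square H + 2 * ?B + mean_square K) / 4 + 0"
      by (intro tendsto_intros lim_const_over_n)
    then show "d \<le> (mean_square H + 2 * ?B + mean_square K) / 4"
      using le by (intro LIMSEQ_le_const[where X="\<lambda>L. (mean_square H + 2 * ?B + mean_square K) / 4 + 4 * real (H + K) * \<gamma> 0 / real L"])
        (auto intro!: exI[of _ 1])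
  qed
  have "?S \<longlonglongrightarrow> d"
  proof (rule LIMSEQ_I)
    fix e :: real assume e: "e > 0"
    obtain H where H: "H \<ge> 1" "mean_square H < d + e / 4"
    proof -
      have "d < d + e / 4" using e by simp
      then have "\<exists>H\<in>{1..}. mean_square H < d + e / 4"
        unfolding d_def using bdd by (subst (asm) cINF_less_iff) auto
      then show ?thesis using that by auto
    qed
    \<comment> \<open>Beyond this threshold the boundary error 4 (H + 1) \<gamma>(0) / K is below e
      / 4; the summand 1 forces K \<ge> 1.\<close>
    define c where "c = 16 * real (H + 1) * \<gamma> 0 / e + 1"
    obtain K0 where K0: "real K0 > c" using reals_Archimedean2 by blast
    show "\<exists>no. \<forall>n\<ge>no. norm (?S n - d) < e"
    proof (intro exI allI impI)
      fix K assume "K \<ge> K0"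
      then have Kc: "real K > c" using K0 by linarith
      have c1: "c \<ge> 1" unfolding c_def using e g0 by simp
      have K1: "K \<ge> 1" using Kc c1 by linarith
      have small: "4 * real (H + 1) * \<gamma> 0 / real K < e / 4"
      proof -
        have "16 * real (H + 1) * \<gamma> 0 / e < real K" using Kc by (simp add: c_def)
        then show ?thesis using e K1 by (simp add: field_simps)
      qed
      let ?B = "(1 / (real H * real K)) * (\<Sum>m<H. \<Sum>n<K. \<gamma> (int m - int n))"
      have sK: "mean_square K < d + e / 4 + e / 4"
      proof -
        have "mean_square K \<le> (\<Sum>i<H. \<Sum>j<H. (1 / real H) * (1 / real H) * \<gamma> (int (id i) - int (id j))) + 4 * real H * \<gamma> 0 / real K"
          by (rule mean_square_le) (use H K1 in auto)
        also have "(\<Sum>i<H. \<Sum>j<H. (1 / real H) * (1 / real H) * \<gamma> (int (id i) - int (id j))) = mean_square H"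
          by (simp add: mean_square_def sum_distrib_left[symmetric] power2_eq_square sum_divide_distrib)
        also have "4 * real H * \<gamma> 0 / real K \<le> 4 * real (H + 1) * \<gamma> 0 / real K"
          using g0 by (intro divide_right_mono mult_right_mono) auto
        finally show ?thesis using small H by linarith
      qed
      \<comment> \<open>The excess of \<open>mean_square\<close> over d is below e / 4 for H and
        below e / 2 for K, which leaves a margin of 3 e / 4 in both directions.\<close>
      have B: "\<bar>?B - d\<bar> < e * 3 / 4"
      proof -
        have "\<bar>x - d\<bar> < e * 3 / 4" if "d \<le> (mean_square H + 2 * x + mean_square K) / 4" "2 * x \<le> mean_square H + mean_square K" for x
        proof -
          have "4 * d \<le> mean_square H + 2 * x + mean_square K" using that(1) by simp
          then have "2 * d < 2 * x + e * 3 / 4" using sK H(2) e by linarith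
          moreover have "x - d < e * 3 / 4" using that(2) sK H(2) e by linarith
          ultimately show ?thesis using e by (simp add: abs_if)
        qed
        then show ?thesis using mid[OF H(1) K1] psdHK[OF H(1) K1] .
      qed
      have "\<bar>?B - ?S K\<bar> \<le> 2 * real (H + 1) * \<gamma> 0 / real K"
      proof -
        \<comment> \<open>Row m runs over the times -m, ..., K - 1 - m and the Cesaro sum over 1,
          ..., K, so the two differ by a shift of m + 1.\<close>
        have 1: "\<bar>(\<Sum>n<K. \<gamma> (int m - int n)) - (\<Sum>h=1..K. \<gamma> (int h))\<bar> \<le> 2 * real (H + 1) * \<gamma> 0" if "m < H" for m
        proof -
          have "(\<Sum>n<K. \<gamma> (int m - int n)) = (\<Sum>n<K. \<gamma> (int n + - int m))"
            using even by (metis (no_types, lifting) minus_diff_eq sum.cong uminus_add_conv_diff add.commute)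
          moreover have "(\<Sum>h=1..K. \<gamma> (int h)) = (\<Sum>n<K. \<gamma> (int n + - int m + int (m + 1)))"
            by (rule sum.reindex_bij_witness[of _ Suc "\<lambda>h. h - 1"]) auto
          moreover have "2 * real (m + 1) * \<gamma> 0 \<le> 2 * real (H + 1) * \<gamma> 0"
            using that g0 by (intro mult_right_mono) auto
          ultimately show ?thesis
            using sum_shift_bound[where f=\<gamma> and B="\<gamma> 0" and L=K and a="- int m" and i="m + 1", OF bound] by linarith
        qed
        have "?B - ?S K = (1 / (real H * real K)) * (\<Sum>m<H. (\<Sum>n<K. \<gamma> (int m - int n)) - (\<Sum>h=1..K. \<gamma> (int h)))"
          using H K1 by (simp add: sum_subtractf field_simps)
        also have "\<bar>\<dots>\<bar> \<le> (1 / (real H * real K)) * (\<Sum>m<H. 2 * real (H + 1) * \<gamma> 0)"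
          unfolding abs_mult using 1 by (intro mult_mono order_trans[OF sum_abs] sum_mono) auto
        also have "\<dots> = 2 * real (H + 1) * \<gamma> 0 / real K" using H by simp
        finally show ?thesis .
      qed
      also have "\<dots> \<le> 4 * real (H + 1) * \<gamma> 0 / real K"
        using g0 by (intro divide_right_mono mult_right_mono) auto
      finally show "norm (?S K - d) < e" unfolding real_norm_def using small B by linarith
    qed
  qed
  then show ?thesis by (rule convergentI)
qed

end

section \<open>Host-Kra seminorms of bounded functions\<close>

lemma cesaro_null:
  fixes a :: "nat \<Rightarrow> real"
  assumes "a \<longlonglongrightarrow> 0"
  shows "(\<lambda>H. (1 / real H) * (\<Sum>h=1..H. a h)) \<longlonglongrightarrow> 0"
proof (rule LIMSEQ_I)
  fix e :: real assume e: "e > 0"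
  obtain n where n: "\<And>h. h \<ge> n \<Longrightarrow> \<bar>a h\<bar> < e / 2"
    using LIMSEQ_D[OF assms, of "e / 2"] e by auto
  define C where "C = (\<Sum>h=1..n. \<bar>a h\<bar>)"
  obtain m where m: "real m > 2 * C / e" using reals_Archimedean2 by blast
  show "\<exists>no. \<forall>H\<ge>no. norm ((1 / real H) * (\<Sum>h=1..H. a h) - 0) < e"
  proof (intro exI[of _ "Suc (m + n)"] allI impI)
    fix H assume H: "H \<ge> Suc (m + n)"
    have "\<bar>\<Sum>h=1..H. a h\<bar> \<le> (\<Sum>h=1..H. \<bar>a h\<bar>)" by (rule sum_abs)
    also have "(\<Sum>h=1..H. \<bar>a h\<bar>) = (\<Sum>h\<in>{1..n} \<union> {n+1..H}. \<bar>a h\<bar>)"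
      using H by (intro sum.cong) auto
    also have "(\<Sum>h\<in>{1..n} \<union> {n+1..H}. \<bar>a h\<bar>) = C + (\<Sum>h=n+1..H. \<bar>a h\<bar>)"
      unfolding C_def by (rule sum.union_disjoint) auto
    also have "(\<Sum>h=n+1..H. \<bar>a h\<bar>) \<le> (\<Sum>h=n+1..H. e / 2)"
      using n by (intro sum_mono) (auto intro: less_imp_le)
    also have "\<dots> \<le> real H * (e / 2)" using e H by simp
    finally have "\<bar>\<Sum>h=1..H. a h\<bar> \<le> C + real H * (e / 2)" by (simp only: add_left_mono)
    moreover have "C < real H * (e / 2)"
    proof -
      have "2 * C / e < real H" using m H by linarith
      then show ?thesis using e by (simp add: field_simps)
    qed
    ultimately have "\<bar>\<Sum>h=1..H. a h\<bar> < real H * e" by linarith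
    then show "norm ((1 / real H) * (\<Sum>h=1..H. a h) - 0) < e" using H by (simp add: abs_mult field_simps)
  qed
qed

lemma borel_measurable_cnj[measurable (raw)]:
  "f \<in> borel_measurable M \<Longrightarrow> (\<lambda>x. cnj (f x)) \<in> borel_measurable M"
  by (rule measurable_compose[OF _ borel_measurable_continuous_onI]) (auto intro!: continuous_intros)

text \<open>The bound holds at every point, even outside the space, so the class is stable under
  products and compositions without exceptional sets. Functions in L^infinity enter it by
  truncation.\<close>

definition bdd_borel :: "'a measure \<Rightarrow> ('a \<Rightarrow> complex) set" where
  "bdd_borel M = {f \<in> borel_measurable M. \<exists>B. \<forall>x. norm (f x) \<le> B}"

lemma bdd_borel_measurable[measurable_dest]: "f \<in> bdd_borel M \<Longrightarrow> f \<in> borel_measurable M"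
  by (simp add: bdd_borel_def)

lemma bdd_borelI: "f \<in> borel_measurable M \<Longrightarrow> (\<And>x. norm (f x) \<le> B) \<Longrightarrow> f \<in> bdd_borel M"
  by (auto simp: bdd_borel_def)

lemma bdd_borel_bound:
  assumes "f \<in> bdd_borel M" obtains B where "B > 0" "\<And>x. norm (f x) \<le> B"
proof -
  obtain B where "\<forall>x. norm (f x) \<le> B" using assms by (auto simp: bdd_borel_def)
  then have "norm (f x) \<le> max B 1" for x by (simp add: le_max_iff_disj)
  then show ?thesis using that[of "max B 1"] by simp
qed

lemma bdd_borel_const: "(\<lambda>_. c) \<in> bdd_borel M"
  by (rule bdd_borelI[of _ _ "norm c"]) auto

lemma bdd_borel_mult: assumes "f \<in> bdd_borel M" "g \<in> bdd_borel M" shows "(\<lambda>x. f x * g x) \<in> bdd_borel M"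
proof -
  obtain B C where "\<And>x. norm (f x) \<le> B" "\<And>x. norm (g x) \<le> C" "B > 0" "C > 0"
    using assms by (metis bdd_borel_bound)
  then show ?thesis using assms
    by (intro bdd_borelI[of _ _ "B * C"]) (auto simp: norm_mult intro!: mult_mono)
qed

lemma bdd_borel_add: assumes "f \<in> bdd_borel M" "g \<in> bdd_borel M" shows "(\<lambda>x. f x + g x) \<in> bdd_borel M"
proof -
  obtain B C where "\<And>x. norm (f x) \<le> B" "\<And>x. norm (g x) \<le> C" "B > 0" "C > 0"
    using assms by (metis bdd_borel_bound)
  then show ?thesis using assms
    by (intro bdd_borelI[of _ _ "B + C"]) (auto intro!: norm_triangle_le add_mono)
qed

lemma bdd_borel_cnj: "f \<in> bdd_borel M \<Longrightarrow> (\<lambda>x. cnj (f x)) \<in> bdd_borel M"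
  by (auto simp: bdd_borel_def)

lemma bdd_borel_cmult: "f \<in> bdd_borel M \<Longrightarrow> (\<lambda>x. c * f x) \<in> bdd_borel M"
  by (rule bdd_borel_mult[OF bdd_borel_const])

lemma bdd_borel_diff: assumes "f \<in> bdd_borel M" "g \<in> bdd_borel M" shows "(\<lambda>x. f x - g x) \<in> bdd_borel M"
  using bdd_borel_add[OF assms(1) bdd_borel_cmult[OF assms(2), of "-1"]] by simp

lemma bdd_borel_sum: "(\<And>i. i \<in> I \<Longrightarrow> f i \<in> bdd_borel M) \<Longrightarrow> (\<lambda>x. \<Sum>i\<in>I. f i x) \<in> bdd_borel M"
  by (induction I rule: infinite_finite_induct) (auto intro: bdd_borel_const bdd_borel_add)

lemma bdd_borel_prod: "(\<And>i. i \<in> I \<Longrightarrow> f i \<in> bdd_borel M) \<Longrightarrow> (\<lambda>x. \<Prod>i\<in>I. f i x) \<in> bdd_borel M"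
  by (induction I rule: infinite_finite_induct) (auto intro: bdd_borel_const bdd_borel_mult)

lemma bdd_borel_comp: "f \<in> bdd_borel N \<Longrightarrow> g \<in> M \<rightarrow>\<^sub>M N \<Longrightarrow> (\<lambda>x. f (g x)) \<in> bdd_borel M"
  by (auto simp: bdd_borel_def)

lemma (in finite_measure) bdd_borel_integrable: "f \<in> bdd_borel M \<Longrightarrow> integrable M f"
  by (auto simp: bdd_borel_def intro: integrable_const_bound)

lemma (in finite_measure) bdd_borel_norm_integrable: "f \<in> bdd_borel M \<Longrightarrow> integrable M (\<lambda>x. norm (f x))"
  by (rule integrable_norm[OF bdd_borel_integrable])

lemma (in finite_measure) bdd_borel_integral_sum2:
  assumes "\<And>i k. i \<in> I \<Longrightarrow> k \<in> I \<Longrightarrow> f i k \<in> bdd_borel M"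
  shows "(\<integral>x. (\<Sum>i\<in>I. \<Sum>k\<in>I. f i k x) \<partial>M) = (\<Sum>i\<in>I. \<Sum>k\<in>I. \<integral>x. f i k x \<partial>M)"
proof -
  have "(\<integral>x. (\<Sum>i\<in>I. \<Sum>k\<in>I. f i k x) \<partial>M) = (\<Sum>i\<in>I. \<integral>x. (\<Sum>k\<in>I. f i k x) \<partial>M)"
    using assms by (intro Bochner_Integration.integral_sum bdd_borel_integrable bdd_borel_sum)
  also have "\<dots> = (\<Sum>i\<in>I. \<Sum>k\<in>I. \<integral>x. f i k x \<partial>M)"
    using assms by (intro sum.cong refl Bochner_Integration.integral_sum bdd_borel_integrable)
  finally show ?thesis .
qed

lemma (in prob_space) norm_integral_le_bound:
  fixes f :: "'a \<Rightarrow> complex"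
  assumes "\<And>x. norm (f x) \<le> B"
  shows "norm (\<integral>x. f x \<partial>M) \<le> B"
proof -
  have "norm (\<integral>x. f x \<partial>M) \<le> (\<integral>x. norm (f x) \<partial>M)" by (rule integral_norm_bound)
  also have "\<dots> \<le> (\<integral>x. B \<partial>M)"
    using assms order_trans[OF norm_ge_zero assms] by (intro integral_mono') auto
  finally show ?thesis by (simp add: prob_space)
qed

locale measure_preserving =
  fixes M :: "'a measure" and T :: "'a \<Rightarrow> 'a"
  assumes mp: "mp_system M T"
begin

sublocale prob_space M using mp by (simp add: mp_system_def)

lemma T_meas[measurable]: "T \<in> M \<rightarrow>\<^sub>M M" using mp by (simp add: mp_system_def)

lemma Tn_meas[measurable]: "T ^^ n \<in> M \<rightarrow>\<^sub>M M"
  by (induction n) (auto intro: measurable_comp simp: id_def[symmetric])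

lemma distr_Tn: "distr M M (T ^^ n) = M"
proof (induction n)
  case (Suc n)
  have "distr M M (T ^^ Suc n) = distr (distr M M (T ^^ n)) M T"
    by (subst distr_distr) auto
  then show ?case using Suc mp by (simp add: mp_system_def o_def)
qed (simp add: id_def)

lemma integral_Tn:
  fixes f :: "'a \<Rightarrow> 'b::{banach, second_countable_topology}"
  assumes "f \<in> borel_measurable M"
  shows "(\<integral>x. f ((T ^^ n) x) \<partial>M) = (\<integral>x. f x \<partial>M)"
  using integral_distr[OF Tn_meas assms, of n] by (simp add: distr_Tn)

lemma AE_Tn:
  assumes "AE x in M. P x" shows "AE x in M. P ((T ^^ n) x)"
  by (rule AE_distrD[OF Tn_meas[of n], unfolded distr_Tn, OF assms])

lemma bdd_borel_Tn: "f \<in> bdd_borel M \<Longrightarrow> (\<lambda>x. f ((T ^^ n) x)) \<in> bdd_borel M"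
  by (rule bdd_borel_comp) measurable

lemma bdd_borel_corr: "f \<in> bdd_borel M \<Longrightarrow> (\<lambda>x. f x * cnj (f ((T ^^ n) x))) \<in> bdd_borel M"
  by (intro bdd_borel_mult bdd_borel_cnj bdd_borel_Tn)

end

lemma funpow_funpow_commute: "(T ^^ m) ((T ^^ n) x) = (T ^^ n) ((T ^^ m) x)"
  by (metis add.commute comp_apply funpow_add)

text \<open>
  \<open>hkp M T j f\<close> is \<open>|||f|||\<^sub>k\<close> raised to the power \<open>2 ^ k\<close>, where \<open>k = j + 1\<close>: starting one level below
  \<^const>\<open>hk_power\<close> turns the base case of the latter into an instance of the recursion.
\<close>

primrec hkp :: "'a measure \<Rightarrow> ('a \<Rightarrow> 'a) \<Rightarrow> nat \<Rightarrow> ('a \<Rightarrow> complex) \<Rightarrow> real" where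
  "hkp M T 0 f = (norm (\<integral>x. f x \<partial>M))\<^sup>2"
| "hkp M T (Suc j) f = lim (\<lambda>H. (1 / real H) * (\<Sum>h=1..H. hkp M T j (\<lambda>x. f x * cnj (f ((T ^^ h) x)))))"

lemma hk_power_eq_hkp: "hk_power M T j f = hkp M T (Suc j) f"
  by (induction j arbitrary: f) auto

context measure_preserving begin

text \<open>Level 0 is measure preservation. At higher levels the correlations of a shift are shifts
  of the correlations, so the sequences under \<open>lim\<close> agree term by term, before
  convergence is known.\<close>

lemma hkp_shift: "f \<in> bdd_borel M \<Longrightarrow> hkp M T j (\<lambda>x. f ((T ^^ n) x)) = hkp M T j f"
proof (induction j arbitrary: f)
  case 0
  then show ?case using integral_Tn[of f n] by (simp add: bdd_borel_measurable)
next
  case (Suc j)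
  have "hkp M T j (\<lambda>x. f ((T ^^ n) x) * cnj (f ((T ^^ n) ((T ^^ h) x)))) = hkp M T j (\<lambda>x. f x * cnj (f ((T ^^ h) x)))" for h
    using Suc.IH[OF bdd_borel_corr[OF Suc.prems, of h]] by (simp add: funpow_funpow_commute[where m=h and n=n])
  then show ?case by simp
qed

lemma hkp_cnj: "hkp M T j (\<lambda>x. cnj (f x)) = hkp M T j f"
proof (induction j arbitrary: f)
  case (Suc j)
  have "hkp M T j (\<lambda>x. cnj (f x) * f ((T ^^ h) x)) = hkp M T j (\<lambda>x. f x * cnj (f ((T ^^ h) x)))" for h
    using Suc.IH[of "\<lambda>x. f x * cnj (f ((T ^^ h) x))"] by simp
  then show ?case by simp
qed simp

lemma hkp_cong_AE:
  "f \<in> borel_measurable M \<Longrightarrow> g \<in> borel_measurable M \<Longrightarrow> AE x in M. f x = g x \<Longrightarrow> hkp M T j f = hkp M T j g"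
proof (induction j arbitrary: f g)
  case 0
  then show ?case using integral_cong_AE[of f M g] by simp
next
  case (Suc j)
  note [measurable] = Suc.prems(1,2)
  have "hkp M T j (\<lambda>x. f x * cnj (f ((T ^^ h) x))) = hkp M T j (\<lambda>x. g x * cnj (g ((T ^^ h) x)))" for h
  proof (rule Suc.IH)
    show "AE x in M. f x * cnj (f ((T ^^ h) x)) = g x * cnj (g ((T ^^ h) x))"
      using Suc.prems(3) AE_Tn[OF Suc.prems(3), of h] by eventually_elim simp
  qed measurable
  then show ?case by simp
qed

text \<open>
  Positivity of these matrices makes \<open>h \<mapsto> hkp M T j (f * cnj (f \<circ> T\<^sup>h))\<close> positive definite, so that the limit
  defining the next level exists; otherwise \<^const>\<open>lim\<close> would be a junk value.
\<close>

definition hkp_psd :: "nat \<Rightarrow> bool" where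
  "hkp_psd j \<longleftrightarrow> (\<forall>(I :: nat set) F w. finite I \<longrightarrow> (\<forall>i\<in>I. F i \<in> bdd_borel M) \<longrightarrow>
     0 \<le> (\<Sum>i\<in>I. \<Sum>k\<in>I. w i * w k * hkp M T j (\<lambda>x. F i x * cnj (F k x))))"

lemma hkp_psdD:
  "hkp_psd j \<Longrightarrow> finite (I :: nat set) \<Longrightarrow> (\<And>i. i \<in> I \<Longrightarrow> F i \<in> bdd_borel M) \<Longrightarrow>
   0 \<le> (\<Sum>i\<in>I. \<Sum>k\<in>I. w i * w k * hkp M T j (\<lambda>x. F i x * cnj (F k x)))"
  unfolding hkp_psd_def by blast

text \<open>Invariance under shifts and conjugation makes the value at the product of
  \<open>f \<circ> T^i\<close> and the conjugate of \<open>f \<circ> T^k\<close> depend on |i - k|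
  only. Positivity then says that this is a positive definite sequence.\<close>

lemma hkp_psd_imp_convergent:
  assumes psd: "hkp_psd j" and f: "f \<in> bdd_borel M"
  shows "convergent (\<lambda>H. (1 / real H) * (\<Sum>h=1..H. hkp M T j (\<lambda>x. f x * cnj (f ((T ^^ h) x)))))"
proof -
  define \<gamma> where "\<gamma> n = hkp M T j (\<lambda>x. f x * cnj (f ((T ^^ nat \<bar>n\<bar>) x)))" for n
  have \<gamma>_le: "hkp M T j (\<lambda>x. f ((T ^^ i) x) * cnj (f ((T ^^ k) x))) = \<gamma> (int i - int k)" if "i \<le> k" for i k
  proof -
    have "(T ^^ k) x = (T ^^ (k - i)) ((T ^^ i) x)" for x
      using that by (metis comp_apply funpow_add le_add_diff_inverse2)
    moreover have "\<gamma> (int i - int k) = hkp M T j (\<lambda>x. f x * cnj (f ((T ^^ (k - i)) x)))"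
      using that by (simp add: \<gamma>_def nat_diff_distrib)
    ultimately show ?thesis
      using hkp_shift[OF bdd_borel_corr[OF f, of "k - i"], of j i] by simp
  qed
  have \<gamma>: "hkp M T j (\<lambda>x. f ((T ^^ i) x) * cnj (f ((T ^^ k) x))) = \<gamma> (int i - int k)" for i k
  proof (cases "i \<le> k")
    case False
    have "hkp M T j (\<lambda>x. f ((T ^^ i) x) * cnj (f ((T ^^ k) x))) = \<gamma> (int k - int i)"
      using hkp_cnj[of j "\<lambda>x. f ((T ^^ k) x) * cnj (f ((T ^^ i) x))"] \<gamma>_le[of k i] False by (simp add: mult.commute)
    then show ?thesis by (simp add: \<gamma>_def abs_minus_commute)
  qed (rule \<gamma>_le)
  interpret pos_def_sequence \<gamma>
  proof
    show "\<gamma> (- n) = \<gamma> n" for n by (simp add: \<gamma>_def)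
    show "0 \<le> (\<Sum>i\<in>I. \<Sum>j\<in>I. w i * w j * \<gamma> (int i - int j))" if "finite I" for I :: "nat set" and w
      using hkp_psdD[OF psd that, of "\<lambda>i x. f ((T ^^ i) x)" w] bdd_borel_Tn[OF f] by (simp add: \<gamma>)
  qed
  show ?thesis using cesaro_convergent by (simp add: \<gamma>_def)
qed

text \<open>At level 0 the entries are |g i k|^2 for a Gram matrix g, a case of the Schur product
  theorem. In the induction step the correlation of \<open>F i * cnj (F k)\<close> at h is again a
  product of this type, so the sum is a limit of averages of nonnegative sums.\<close>

lemma hkp_psd: "hkp_psd j"
proof (induction j)
  case 0
  show ?case unfolding hkp_psd_def
  proof (intro allI impI)
    fix I :: "nat set" and F w
    assume I: "finite I" and F: "\<forall>i\<in>I. F i \<in> bdd_borel M"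
    define g where "g i k = (\<integral>x. F i x * cnj (F k x) \<partial>M)" for i k
    \<comment> \<open>The factor \<open>cnj (g i k)\<close> is unfolded as an integral over a second
      variable y; for fixed y the integrand in x is then the squared modulus of a single
      sum.\<close>
    define H where "H y = (\<Sum>i\<in>I. \<Sum>k\<in>I. of_real (w i * w k) * g i k * (cnj (F i y) * F k y))" for y
    have g_cnj: "(\<integral>y. cnj (F i y) * F k y \<partial>M) = cnj (g i k)" for i k
      unfolding g_def using Bochner_Integration.integral_cnj[of M "\<lambda>x. F i x * cnj (F k x)"] by simp
    have H_nonneg: "0 \<le> Re (H y)" for y
    proof -
      have "H y = (\<Sum>i\<in>I. \<Sum>k\<in>I. \<integral>x. of_real (w i * w k) * (F i x * cnj (F k x)) * (cnj (F i y) * F k y) \<partial>M)"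
        unfolding H_def g_def by simp
      also have "\<dots> = (\<integral>x. (\<Sum>i\<in>I. \<Sum>k\<in>I. of_real (w i * w k) * (F i x * cnj (F k x)) * (cnj (F i y) * F k y)) \<partial>M)"
        using F by (intro bdd_borel_integral_sum2[symmetric] bdd_borel_mult bdd_borel_const bdd_borel_cnj) auto
      also have "\<dots> = (\<integral>x. of_real ((norm (\<Sum>i\<in>I. of_real (w i) * (F i x * cnj (F i y))))\<^sup>2) \<partial>M)"
        unfolding complex_norm_square by (simp add: cnj_sum sum_product algebra_simps)
      also have "\<dots> = of_real (\<integral>x. (norm (\<Sum>i\<in>I. of_real (w i) * (F i x * cnj (F i y))))\<^sup>2 \<partial>M)"
        by (rule integral_complex_of_real)
      finally show ?thesis by (simp only: Re_complex_of_real) (rule Bochner_Integration.integral_nonneg, simp)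
    qed
    have "0 \<le> (\<integral>y. Re (H y) \<partial>M)" using H_nonneg by simp
    also have "\<dots> = Re (\<integral>y. H y \<partial>M)"
      using F unfolding H_def
      by (intro integral_Re bdd_borel_integrable bdd_borel_sum bdd_borel_mult bdd_borel_const bdd_borel_cnj) auto
    also have "(\<integral>y. H y \<partial>M) = (\<Sum>i\<in>I. \<Sum>k\<in>I. of_real (w i * w k) * g i k * cnj (g i k))"
      unfolding H_def g_cnj[symmetric] using F
      by (subst bdd_borel_integral_sum2) (auto intro!: bdd_borel_mult bdd_borel_const bdd_borel_cnj)
    also have "\<dots> = of_real (\<Sum>i\<in>I. \<Sum>k\<in>I. w i * w k * (norm (g i k))\<^sup>2)"
      by (simp only: of_real_sum of_real_mult complex_norm_square mult.assoc)
    finally show "0 \<le> (\<Sum>i\<in>I. \<Sum>k\<in>I. w i * w k * hkp M T 0 (\<lambda>x. F i x * cnj (F k x)))"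
      by (simp add: g_def)
  qed
next
  case (Suc j)
  show ?case unfolding hkp_psd_def
  proof (intro allI impI)
    fix I :: "nat set" and F w
    assume I: "finite I" and F: "\<forall>i\<in>I. F i \<in> bdd_borel M"
    let ?f = "\<lambda>i k x. F i x * cnj (F k x)"
    let ?A = "\<lambda>i k H. (1 / real H) * (\<Sum>h=1..H. hkp M T j (\<lambda>x. ?f i k x * cnj (?f i k ((T ^^ h) x))))"
    have lim: "?A i k \<longlonglongrightarrow> hkp M T (Suc j) (?f i k)" if "i \<in> I" "k \<in> I" for i k
      using hkp_psd_imp_convergent[OF Suc, of "?f i k"] that F
      by (simp add: convergent_LIMSEQ_iff bdd_borel_mult bdd_borel_cnj)
    have "(\<lambda>H. \<Sum>i\<in>I. \<Sum>k\<in>I. w i * w k * ?A i k H) \<longlonglongrightarrow> (\<Sum>i\<in>I. \<Sum>k\<in>I. w i * w k * hkp M T (Suc j) (?f i k))"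
      by (intro tendsto_sum tendsto_mult tendsto_const lim)
    moreover have "0 \<le> (\<Sum>i\<in>I. \<Sum>k\<in>I. w i * w k * ?A i k H)" for H
    proof -
      define \<phi> where "\<phi> h i x = F i x * cnj (F i ((T ^^ h) x))" for h i x
      have "?f i k x * cnj (?f i k ((T ^^ h) x)) = \<phi> h i x * cnj (\<phi> h k x)" for i k h x
        by (simp add: \<phi>_def mult_ac)
      then have "(\<Sum>i\<in>I. \<Sum>k\<in>I. w i * w k * ?A i k H)
        = (\<Sum>i\<in>I. \<Sum>k\<in>I. \<Sum>h=1..H. (1 / real H) * (w i * w k * hkp M T j (\<lambda>x. \<phi> h i x * cnj (\<phi> h k x))))"
        by (simp add: sum_distrib_left mult_ac)
      also have "\<dots> = (\<Sum>i\<in>I. \<Sum>h=1..H. \<Sum>k\<in>I. (1 / real H) * (w i * w k * hkp M T j (\<lambda>x. \<phi> h i x * cnj (\<phi> h k x))))"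
        by (rule sum.cong[OF refl]) (rule sum.swap)
      also have "\<dots> = (\<Sum>h=1..H. \<Sum>i\<in>I. \<Sum>k\<in>I. (1 / real H) * (w i * w k * hkp M T j (\<lambda>x. \<phi> h i x * cnj (\<phi> h k x))))"
        by (rule sum.swap)
      also have "\<dots> = (1 / real H) * (\<Sum>h=1..H. \<Sum>i\<in>I. \<Sum>k\<in>I. w i * w k * hkp M T j (\<lambda>x. \<phi> h i x * cnj (\<phi> h k x)))"
        by (simp only: sum_distrib_left)
      also have "0 \<le> \<dots>"
        using F unfolding \<phi>_def
        by (intro mult_nonneg_nonneg sum_nonneg hkp_psdD[OF Suc I]) (auto intro!: bdd_borel_corr)
      finally show ?thesis .
    qed
    ultimately show "0 \<le> (\<Sum>i\<in>I. \<Sum>k\<in>I. w i * w k * hkp M T (Suc j) (?f i k))"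
      by (intro LIMSEQ_le_const) auto
  qed
qed

lemma hkp_tendsto:
  "f \<in> bdd_borel M \<Longrightarrow> (\<lambda>H. (1 / real H) * (\<Sum>h=1..H. hkp M T j (\<lambda>x. f x * cnj (f ((T ^^ h) x))))) \<longlonglongrightarrow> hkp M T (Suc j) f"
  using hkp_psd_imp_convergent[OF hkp_psd] by (simp add: convergent_LIMSEQ_iff)

text \<open>L^1 is the sense in which fibre means of correlations will approach correlations of
  fibre means. Passing to correlations turns the bound B into B^2 and costs a factor 2 B; comparing
  the two limits relies on the convergence just proved.\<close>

lemma hkp_lipschitz:
  assumes "B \<ge> 0"
  shows "\<exists>C\<ge>0. \<forall>f g. f \<in> borel_measurable M \<longrightarrow> g \<in> borel_measurable M \<longrightarrow>
    (\<forall>x. norm (f x) \<le> B) \<longrightarrow> (\<forall>x. norm (g x) \<le> B) \<longrightarrow>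
    \<bar>hkp M T j f - hkp M T j g\<bar> \<le> C * (\<integral>x. norm (f x - g x) \<partial>M)"
  using assms
proof (induction j arbitrary: B)
  case 0
  show ?case
  proof (intro exI[of _ "2 * B"] conjI allI impI)
    fix f g :: "'a \<Rightarrow> complex" assume fg: "f \<in> borel_measurable M" "g \<in> borel_measurable M" "\<forall>x. norm (f x) \<le> B" "\<forall>x. norm (g x) \<le> B"
    have bd: "f \<in> bdd_borel M" "g \<in> bdd_borel M" using fg by (auto intro: bdd_borelI)
    let ?a = "norm (\<integral>x. f x \<partial>M)" and ?b = "norm (\<integral>x. g x \<partial>M)"
    have "\<bar>?a - ?b\<bar> \<le> norm ((\<integral>x. f x \<partial>M) - (\<integral>x. g x \<partial>M))" by (rule norm_triangle_ineq3)
    also have "\<dots> = norm (\<integral>x. f x - g x \<partial>M)" using bd by (simp add: bdd_borel_integrable)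
    also have "\<dots> \<le> (\<integral>x. norm (f x - g x) \<partial>M)" by (rule integral_norm_bound)
    finally have 1: "\<bar>?a - ?b\<bar> \<le> (\<integral>x. norm (f x - g x) \<partial>M)" .
    have 2: "?a + ?b \<le> 2 * B"
      using norm_integral_le_bound[of f B] norm_integral_le_bound[of g B] fg by simp
    have "\<bar>?a\<^sup>2 - ?b\<^sup>2\<bar> = (?a + ?b) * \<bar>?a - ?b\<bar>"
      by (simp add: power2_eq_square square_diff_square_factored abs_mult)
    also have "\<dots> \<le> (2 * B) * (\<integral>x. norm (f x - g x) \<partial>M)"
      using 1 2 0 by (intro mult_mono) auto
    finally show "\<bar>hkp M T 0 f - hkp M T 0 g\<bar> \<le> 2 * B * (\<integral>x. norm (f x - g x) \<partial>M)" by simp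
  qed (use 0 in simp)
next
  case (Suc j)
  have BB: "0 \<le> B * B" using Suc.prems by simp
  obtain C where C: "C \<ge> 0" "\<And>f g. f \<in> borel_measurable M \<Longrightarrow> g \<in> borel_measurable M \<Longrightarrow>
    (\<forall>x. norm (f x) \<le> B * B) \<Longrightarrow> (\<forall>x. norm (g x) \<le> B * B) \<Longrightarrow>
    \<bar>hkp M T j f - hkp M T j g\<bar> \<le> C * (\<integral>x. norm (f x - g x) \<partial>M)"
    using Suc.IH[OF BB] by (elim exE conjE) blast
  show ?case
  proof (intro exI[of _ "C * (2 * B)"] conjI allI impI)
    fix f g :: "'a \<Rightarrow> complex" assume fg[measurable]: "f \<in> borel_measurable M" "g \<in> borel_measurable M" and B: "\<forall>x. norm (f x) \<le> B" "\<forall>x. norm (g x) \<le> B"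
    have bd: "f \<in> bdd_borel M" "g \<in> bdd_borel M" using fg B by (auto intro: bdd_borelI)
    let ?D = "\<integral>x. norm (f x - g x) \<partial>M"
    let ?f = "\<lambda>h x. f x * cnj (f ((T ^^ h) x))" and ?g = "\<lambda>h x. g x * cnj (g ((T ^^ h) x))"
    have step: "\<bar>hkp M T j (?f h) - hkp M T j (?g h)\<bar> \<le> C * (2 * B) * ?D" for h
    proof -
      have le: "norm (?f h x - ?g h x) \<le> B * norm (f x - g x) + B * norm (f ((T ^^ h) x) - g ((T ^^ h) x))" for x
      proof -
        have "?f h x - ?g h x = (f x - g x) * cnj (f ((T ^^ h) x)) + g x * cnj (f ((T ^^ h) x) - g ((T ^^ h) x))"
          by (simp add: algebra_simps)
        also have "norm \<dots> \<le> norm (f x - g x) * norm (f ((T ^^ h) x)) + norm (g x) * norm (f ((T ^^ h) x) - g ((T ^^ h) x))"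
          by (rule order_trans[OF norm_triangle_ineq]) (simp add: norm_mult flip: complex_cnj_diff)
        also have "\<dots> \<le> norm (f x - g x) * B + B * norm (f ((T ^^ h) x) - g ((T ^^ h) x))"
          using B Suc.prems by (intro add_mono mult_mono) auto
        finally show ?thesis by (simp add: mult.commute)
      qed
      have nb: "\<forall>x. norm (?f h x) \<le> B * B" "\<forall>x. norm (?g h x) \<le> B * B"
        using B Suc.prems by (simp_all add: norm_mult mult_mono)
      have i1: "integrable M (\<lambda>x. norm (f x - g x))"
        by (intro bdd_borel_norm_integrable bdd_borel_diff bd)
      have i2: "integrable M (\<lambda>x. norm (f ((T ^^ h) x) - g ((T ^^ h) x)))"
        by (intro bdd_borel_norm_integrable bdd_borel_diff bdd_borel_Tn bd)
      have "(\<integral>x. norm (?f h x - ?g h x) \<partial>M) \<le> (\<integral>x. B * norm (f x - g x) + B * norm (f ((T ^^ h) x) - g ((T ^^ h) x)) \<partial>M)"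
      proof (rule integral_mono[OF _ _ le])
        show "integrable M (\<lambda>x. norm (?f h x - ?g h x))"
          by (intro bdd_borel_norm_integrable bdd_borel_diff bdd_borel_corr bd)
        show "integrable M (\<lambda>x. B * norm (f x - g x) + B * norm (f ((T ^^ h) x) - g ((T ^^ h) x)))"
          by (intro Bochner_Integration.integrable_add integrable_mult_right i1 i2)
      qed
      also have "\<dots> = B * ?D + B * ?D"
        using i1 i2 integral_Tn[of "\<lambda>x. norm (f x - g x)" h] by (subst Bochner_Integration.integral_add) auto
      finally have "(\<integral>x. norm (?f h x - ?g h x) \<partial>M) \<le> 2 * B * ?D" by simp
      then have "C * (\<integral>x. norm (?f h x - ?g h x) \<partial>M) \<le> C * (2 * B * ?D)"
        using C(1) by (rule mult_left_mono)
      moreover have "\<bar>hkp M T j (?f h) - hkp M T j (?g h)\<bar> \<le> C * (\<integral>x. norm (?f h x - ?g h x) \<partial>M)"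
        using nb fg by (intro C(2)) measurable
      ultimately show ?thesis by (simp add: mult.assoc)
    qed
    have "(\<lambda>H. \<bar>(1 / real H) * (\<Sum>h=1..H. hkp M T j (?f h)) - (1 / real H) * (\<Sum>h=1..H. hkp M T j (?g h))\<bar>)
       \<longlonglongrightarrow> \<bar>hkp M T (Suc j) f - hkp M T (Suc j) g\<bar>"
      by (intro tendsto_intros hkp_tendsto bd)
    moreover have "\<bar>(1 / real H) * (\<Sum>h=1..H. hkp M T j (?f h)) - (1 / real H) * (\<Sum>h=1..H. hkp M T j (?g h))\<bar> \<le> C * (2 * B) * ?D"
      if "H \<ge> 1" for H
    proof -
      have "\<bar>(1 / real H) * (\<Sum>h=1..H. hkp M T j (?f h)) - (1 / real H) * (\<Sum>h=1..H. hkp M T j (?g h))\<bar>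
        = (1 / real H) * \<bar>\<Sum>h=1..H. hkp M T j (?f h) - hkp M T j (?g h)\<bar>"
        by (simp add: sum_subtractf flip: diff_divide_distrib)
      also have "\<dots> \<le> (1 / real H) * (\<Sum>h=1..H. C * (2 * B) * ?D)"
        using step by (intro mult_left_mono order_trans[OF sum_abs] sum_mono) auto
      also have "\<dots> = C * (2 * B) * ?D" using that by simp
      finally show ?thesis .
    qed
    ultimately show "\<bar>hkp M T (Suc j) f - hkp M T (Suc j) g\<bar> \<le> C * (2 * B) * ?D"
      by (intro LIMSEQ_le_const2) auto
  qed (use C Suc.prems in simp)
qed

end

section \<open>The filtration of a Kolmogorov system\<close>

text \<open>\<open>FF i\<close> stands for \<open>T\<^sup>-\<^sup>i A\<close> and decreases in \<open>i\<close>; the map \<open>U\<close> is the inverse of \<open>T\<close>.\<close>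

locale kolmogorov_filtration = measure_preserving M T for M :: "'a measure" and T +
  fixes FF :: "int \<Rightarrow> 'a measure" and U :: "'a \<Rightarrow> 'a"
  assumes FF_sub: "subalgebra M (FF i)"
    and FF_step: "sets (FF (i + 1)) \<subseteq> sets (FF i)"
    and T_FF: "T \<in> FF (i + 1) \<rightarrow>\<^sub>M FF i"
    and U_FF: "U \<in> FF i \<rightarrow>\<^sub>M FF (i + 1)"
    and U_T: "x \<in> space M \<Longrightarrow> U (T x) = x"
    and tail_trivial: "(\<And>i. E \<in> sets (FF i)) \<Longrightarrow> prob E = 0 \<or> prob E = 1"
    and generating: "E \<in> sets M \<Longrightarrow> \<exists>E'\<in>sigma_sets (space M) (\<Union>i. sets (FF i)). AE x in M. x \<in> E \<longleftrightarrow> x \<in> E'"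

text \<open>The one-sided algebra \<open>A\<close> is moved by all integer powers of T, which turns
  the tail and the generation condition into statements about one two-sided decreasing
  family.\<close>

lemma kolmogorov_system_imp_kolmogorov_filtration:
  assumes "kolmogorov_system M T"
  shows "\<exists>FF U. kolmogorov_filtration M T FF U"
proof -
  let ?\<Omega> = "space M"
  obtain A where inv: "invertible_system M T" and sub: "subalgebra M A"
    and TA: "\<And>B. B \<in> sets A \<Longrightarrow> T -` B \<inter> ?\<Omega> \<in> sets A"
    and tail: "\<And>E. E \<in> (\<Inter>n. {(T ^^ n) -` B \<inter> ?\<Omega> | B. B \<in> sets A}) \<Longrightarrow> measure M E = 0 \<or> measure M E = 1"
    and gen: "\<And>E. E \<in> sets M \<Longrightarrow> \<exists>E' \<in> sigma_sets ?\<Omega> (\<Union>n. {(T ^^ n) ` B | B. B \<in> sets A}). AE x in M. x \<in> E \<longleftrightarrow> x \<in> E'"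
    using assms unfolding kolmogorov_system_def by blast
  define U where "U = the_inv_into ?\<Omega> T"
  have mp: "mp_system M T" and bij: "bij_betw T ?\<Omega> ?\<Omega>" and Umeas[measurable]: "U \<in> M \<rightarrow>\<^sub>M M"
    using inv by (auto simp: invertible_system_def U_def)
  interpret measure_preserving M T by standard (rule mp)
  have UT: "U (T x) = x" if "x \<in> ?\<Omega>" for x
    using bij that by (auto simp: U_def bij_betw_def the_inv_into_f_f)
  have TU: "T (U x) = x" if "x \<in> ?\<Omega>" for x
    using bij that by (auto simp: U_def bij_betw_def f_the_inv_into_f)
  have Tsp: "T x \<in> ?\<Omega>" "U x \<in> ?\<Omega>" if "x \<in> ?\<Omega>" for x
    using that measurable_space[OF T_meas] measurable_space[OF Umeas] by auto
  \<comment> \<open>The integer powers of T. Since \<open>U\<close> inverts T only on the space of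
    M, the power laws \<open>Z1\<close> and \<open>Z2\<close> are restricted to that space.\<close>
  define Z where "Z i = (if i \<ge> 0 then T ^^ nat i else U ^^ nat (- i))" for i :: int
  have Un_meas: "U ^^ n \<in> M \<rightarrow>\<^sub>M M" for n
    by (induction n) (auto intro: measurable_comp simp: id_def[symmetric])
  have Zmeas: "Z i \<in> M \<rightarrow>\<^sub>M M" for i using Un_meas Tn_meas by (simp add: Z_def)
  have Zsp: "Z i x \<in> ?\<Omega>" if "x \<in> ?\<Omega>" for x i using that measurable_space[OF Zmeas] by auto
  have Z1: "Z (i + 1) x = Z i (T x)" if "x \<in> ?\<Omega>" for i x
  proof (cases "i \<ge> 0")
    case True
    then have "nat (i + 1) = Suc (nat i)" by simp
    then show ?thesis using True by (simp add: Z_def funpow_swap1)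
  next
    case False
    then have "nat (- i) = Suc (nat (- (i + 1)))" by simp
    then have "Z i (T x) = (U ^^ nat (- (i + 1))) x"
      using False UT[OF that] by (simp add: Z_def funpow_Suc_right del: funpow.simps)
    then show ?thesis using False by (auto simp: Z_def)
  qed
  have Z2: "Z (i + 1) x = T (Z i x)" if "x \<in> ?\<Omega>" for i x
  proof (cases "i \<ge> 0")
    case True
    then have "nat (i + 1) = Suc (nat i)" by simp
    then show ?thesis using True by (simp add: Z_def)
  next
    case False
    then have "nat (- i) = Suc (nat (- (i + 1)))" by simp
    then have "T (Z i x) = (U ^^ nat (- (i + 1))) x"
      using False TU measurable_space[OF Un_meas that] by (simp add: Z_def)
    then show ?thesis using False by (auto simp: Z_def)
  qed
  define FF where "FF i = vimage_algebra ?\<Omega> (Z i) A" for i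
  have spA: "space A = ?\<Omega>" using sub by (simp add: subalgebra_def)
  have spF: "space (FF i) = ?\<Omega>" for i by (simp add: FF_def)
  have setsF: "sets (FF i) = {Z i -` B \<inter> ?\<Omega> | B. B \<in> sets A}" for i
    unfolding FF_def by (rule sets_vimage_algebra2) (simp add: spA Zsp)
  have Zi: "Z i \<in> FF i \<rightarrow>\<^sub>M A" for i
    unfolding FF_def by (rule measurable_vimage_algebra1) (simp add: spA Zsp)
  have "kolmogorov_filtration M T FF U"
  proof
    fix i
    show "subalgebra M (FF i)"
      using sub Zmeas[of i] by (auto simp: subalgebra_def spF setsF intro: measurable_sets)
    show "sets (FF (i + 1)) \<subseteq> sets (FF i)"
    proof
      fix E assume "E \<in> sets (FF (i + 1))"
      then obtain B where B: "B \<in> sets A" "E = Z (i + 1) -` B \<inter> ?\<Omega>" by (auto simp: setsF)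
      have "E = Z i -` (T -` B \<inter> ?\<Omega>) \<inter> ?\<Omega>" using Z2 Zsp by (auto simp: B(2))
      then show "E \<in> sets (FF i)" unfolding setsF using TA[OF B(1)] by blast
    qed
    show "T \<in> FF (i + 1) \<rightarrow>\<^sub>M FF i"
      unfolding FF_def[of i]
    proof (rule measurable_vimage_algebra2)
      show "T \<in> space (FF (i + 1)) \<rightarrow> ?\<Omega>" using Tsp by (auto simp: spF)
      show "(\<lambda>x. Z i (T x)) \<in> FF (i + 1) \<rightarrow>\<^sub>M A"
        using Zi[of "i + 1"] by (subst measurable_cong[of _ _ "Z (i + 1)"]) (auto simp: spF Z1)
    qed
    show "U \<in> FF i \<rightarrow>\<^sub>M FF (i + 1)"
      unfolding FF_def[of "i + 1"]
    proof (rule measurable_vimage_algebra2)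
      show "U \<in> space (FF i) \<rightarrow> ?\<Omega>" using Tsp by (auto simp: spF)
      show "(\<lambda>x. Z (i + 1) (U x)) \<in> FF i \<rightarrow>\<^sub>M A"
        using Zi[of i] by (subst measurable_cong[of _ _ "Z i"]) (auto simp: spF Z1 TU Tsp)
    qed
    show "U (T x) = x" if "x \<in> ?\<Omega>" for x using UT[OF that] .
    show "prob E = 0 \<or> prob E = 1" if "\<And>i. E \<in> sets (FF i)" for E
    proof (rule tail)
      have "E \<in> {(T ^^ n) -` B \<inter> ?\<Omega> | B. B \<in> sets A}" for n
        using that[of "int n"] unfolding setsF Z_def by simp
      then show "E \<in> (\<Inter>n. {(T ^^ n) -` B \<inter> ?\<Omega> | B. B \<in> sets A})" by blast
    qed
    show "\<exists>E'\<in>sigma_sets ?\<Omega> (\<Union>i. sets (FF i)). AE x in M. x \<in> E \<longleftrightarrow> x \<in> E'" if "E \<in> sets M" for E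
    proof -
      \<comment> \<open>The image of B under \<open>T ^^ n\<close> is its preimage under
        \<open>U ^^ n\<close>, so the sets generating the join in the definition lie in the members
        of index -n.\<close>
      have 1: "(T ^^ n) ` B \<in> sets (FF (- int n))" if "B \<in> sets A" for n B
      proof -
        have Bs: "B \<subseteq> ?\<Omega>" using that spA sets.sets_into_space by blast
        have ut: "(U ^^ n) ((T ^^ n) x) = x" if "x \<in> ?\<Omega>" for x n
        proof (induction n)
          case (Suc n)
          have "(U ^^ Suc n) ((T ^^ Suc n) x) = (U ^^ n) (U (T ((T ^^ n) x)))"
            by (simp add: funpow_swap1)
          then show ?case using Suc UT[OF measurable_space[OF Tn_meas that]] by simp
        qed simp
        have tu: "(T ^^ n) ((U ^^ n) x) = x" if "x \<in> ?\<Omega>" for x n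
        proof (induction n)
          case (Suc n)
          have "(T ^^ Suc n) ((U ^^ Suc n) x) = (T ^^ n) (T (U ((U ^^ n) x)))"
            by (simp add: funpow_swap1)
          then show ?case using Suc TU[OF measurable_space[OF Un_meas that]] by simp
        qed simp
        have "Z (- int n) = U ^^ n" by (cases "n = 0") (auto simp: Z_def fun_eq_iff)
        moreover have "(T ^^ n) ` B = (U ^^ n) -` B \<inter> ?\<Omega>"
        proof (intro set_eqI iffI)
          fix x assume "x \<in> (T ^^ n) ` B"
          then show "x \<in> (U ^^ n) -` B \<inter> ?\<Omega>" using Bs ut measurable_space[OF Tn_meas] by auto
        next
          fix x assume "x \<in> (U ^^ n) -` B \<inter> ?\<Omega>"
          then have "(U ^^ n) x \<in> B" "x = (T ^^ n) ((U ^^ n) x)" using tu by auto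
          then show "x \<in> (T ^^ n) ` B" by blast
        qed
        ultimately show ?thesis using that by (auto simp: setsF)
      qed
      have "(\<Union>n. {(T ^^ n) ` B | B. B \<in> sets A}) \<subseteq> (\<Union>i. sets (FF i))" using 1 by blast
      then have "sigma_sets ?\<Omega> (\<Union>n. {(T ^^ n) ` B | B. B \<in> sets A}) \<subseteq> sigma_sets ?\<Omega> (\<Union>i. sets (FF i))"
        by (rule sigma_sets_mono')
      then show ?thesis using gen[OF that] by blast
    qed
  qed
  then show ?thesis by blast
qed

section \<open>Tail conditional expectations and functions orthogonal to the future\<close>

context kolmogorov_filtration
begin

lemma space_FF[simp]: "space (FF i) = space M"
  using FF_sub[of i] by (simp add: subalgebra_def)

lemma sets_FF: "sets (FF i) \<subseteq> sets M"
  using FF_sub[of i] by (simp add: subalgebra_def)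

lemma FF_mono: "i \<le> j \<Longrightarrow> sets (FF j) \<subseteq> sets (FF i)"
proof (induction rule: int_ge_induct)
  case (step j)
  then show ?case using FF_step[of j] by blast
qed simp

lemma borel_FF_mono: "i \<le> j \<Longrightarrow> f \<in> borel_measurable (FF j) \<Longrightarrow> f \<in> borel_measurable (FF i)"
  unfolding measurable_def space_FF using FF_mono[of i j] by blast

lemma borel_FF_M: "f \<in> borel_measurable (FF j) \<Longrightarrow> f \<in> borel_measurable M"
  unfolding measurable_def space_FF using sets_FF[of j] by blast

lemma bdd_borel_FF_mono: "i \<le> j \<Longrightarrow> f \<in> bdd_borel (FF j) \<Longrightarrow> f \<in> bdd_borel (FF i)"
  using borel_FF_mono by (auto simp: bdd_borel_def)

lemma bdd_borel_FF_M: "f \<in> bdd_borel (FF j) \<Longrightarrow> f \<in> bdd_borel M"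
  using borel_FF_M by (auto simp: bdd_borel_def)

lemma FF_sfs: "sigma_finite_subalgebra M (FF i)"
  by (intro finite_measure_subalgebra_is_sigma_finite)
    (simp add: finite_measure_subalgebra_def finite_measure_subalgebra_axioms_def FF_sub finite_measure_axioms)

text \<open>
  Reverse martingale convergence. The squared \<open>L\<^sup>2\<close> norms of the conditional expectations decrease, which makes them a
  Cauchy sequence; the limit of a subsequence is measurable for every \<open>FF i\<close>, hence constant.
\<close>

lemma tail_cond_exp:
  assumes E: "E \<in> sets M" and e: "e > (0 :: real)"
  shows "\<exists>n\<ge>k. (\<integral>x. (real_cond_exp M (FF (int n)) (indicator E) x - prob E)\<^sup>2 \<partial>M) < e"
proof -
  define P where "P n = real_cond_exp M (FF (int n)) (indicator E)" for n
  have PF: "P n \<in> borel_measurable (FF (int n))" for n by (simp add: P_def)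
  have Pm[measurable]: "P n \<in> borel_measurable M" for n using PF borel_FF_M by blast
  have iE: "integrable M (indicator E :: 'a \<Rightarrow> real)"
    by (rule integrable_const_bound[where B=1]) (use E in \<open>auto simp: indicator_def\<close>)
  have P01: "AE x in M. 0 \<le> P n x \<and> P n x \<le> 1" for n
  proof -
    interpret sigma_finite_subalgebra M "FF (int n)" by (rule FF_sfs)
    show ?thesis unfolding P_def
      using real_cond_exp_ge_c[OF iE, of 0] real_cond_exp_le_c[OF iE, of 1] by (auto simp: indicator_def)
  qed
  have Pint: "integrable M (P n)" for n
  proof (rule integrable_const_bound[where B=1])
    show "AE x in M. norm (P n x) \<le> 1" using P01[of n] by eventually_elim auto
  qed simp
  have PP: "integrable M (\<lambda>x. P n x * P m x)" for n m
  proof (rule integrable_const_bound[where B=1])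
    show "AE x in M. norm (P n x * P m x) \<le> 1"
      using P01[of n] P01[of m] by eventually_elim (auto simp: abs_mult intro: mult_le_one)
  qed simp
  have ip: "(\<integral>x. g x * P n x \<partial>M) = (\<integral>x. g x * indicator E x \<partial>M)"
    if "g \<in> borel_measurable (FF (int n))" "integrable M g" for n g
  proof -
    interpret sigma_finite_subalgebra M "FF (int n)" by (rule FF_sfs)
    show ?thesis unfolding P_def
      using that E integrable_mult_indicator[OF E that(2)]
      by (intro real_cond_exp_intg(2)) (auto simp: mult.commute)
  qed
  define a where "a n = (\<integral>x. P n x * P n x \<partial>M)" for n
  \<comment> \<open>Pythagoras for nested orthogonal projections: \<open>P m\<close> is the
    projection of \<open>P n\<close> when n \<le> m.\<close>
  have sq: "(\<integral>x. (P n x - P m x)\<^sup>2 \<partial>M) = a n - a m" if "n \<le> m" for n m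
  proof -
    have "(\<integral>x. P m x * P n x \<partial>M) = a m"
      using ip[OF borel_FF_mono[OF _ PF[of m]] Pint[of m], of n] ip[OF PF[of m] Pint[of m]] that
      unfolding a_def by simp
    moreover have "(\<integral>x. (P n x - P m x)\<^sup>2 \<partial>M) = (\<integral>x. P n x * P n x - 2 * (P m x * P n x) + P m x * P m x \<partial>M)"
      by (rule Bochner_Integration.integral_cong) (auto simp: power2_eq_square algebra_simps)
    moreover have "\<dots> = a n - 2 * (\<integral>x. P m x * P n x \<partial>M) + a m"
      using PP by (simp add: a_def)
    ultimately show ?thesis by simp
  qed
  have a_dec: "decseq a"
  proof (rule decseq_SucI)
    fix n
    have "0 \<le> (\<integral>x. (P n x - P (Suc n) x)\<^sup>2 \<partial>M)" by simp
    then show "a (Suc n) \<le> a n" using sq[of n "Suc n"] by simp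
  qed
  have a0: "\<forall>n. 0 \<le> a n" by (simp add: a_def)
  have "Cauchy a" by (rule decseq_convergent[OF a_dec a0]) (rule LIMSEQ_imp_Cauchy)
  \<comment> \<open>The subsequence converging almost everywhere is extracted from an L^1 Cauchy
    sequence; the inequality |u| \<le> u^2 / (2 d) + d / 2 obtains this from L^2.\<close>
  have L1: "\<exists>N. \<forall>i\<ge>N. \<forall>j\<ge>N. (LINT x|M. norm (P i x - P j x)) < d" if d: "d > 0" for d
  proof -
    obtain N where N: "\<And>i j. i \<ge> N \<Longrightarrow> j \<ge> N \<Longrightarrow> \<bar>a i - a j\<bar> < d\<^sup>2"
      using CauchyD[OF \<open>Cauchy a\<close>, of "d\<^sup>2"] d by auto
    have "(LINT x|M. norm (P i x - P j x)) < d" if "i \<ge> N" "j \<ge> N" for i j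
    proof -
      have int2: "integrable M (\<lambda>x. (P i x - P j x)\<^sup>2)"
        using PP by (simp add: power2_eq_square algebra_simps)
      have "(\<integral>x. (P i x - P j x)\<^sup>2 \<partial>M) = \<bar>a i - a j\<bar>"
      proof (cases "i \<le> j")
        case True
        then show ?thesis using sq[OF True] decseqD[OF a_dec True] by simp
      next
        case False
        then show ?thesis using sq[of j i] decseqD[OF a_dec, of j i] by (simp add: power2_commute)
      qed
      then have lt: "(\<integral>x. (P i x - P j x)\<^sup>2 \<partial>M) < d\<^sup>2" using N that by simp
      have "(LINT x|M. norm (P i x - P j x)) \<le> (LINT x|M. (P i x - P j x)\<^sup>2 / (2 * d) + d / 2)"
      proof (rule integral_mono)
        show "norm (P i x - P j x) \<le> (P i x - P j x)\<^sup>2 / (2 * d) + d / 2" for x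
        proof -
          have "0 \<le> (\<bar>P i x - P j x\<bar> - d)\<^sup>2" by simp
          also have "\<dots> = (P i x - P j x)\<^sup>2 - 2 * d * \<bar>P i x - P j x\<bar> + d\<^sup>2" by (simp add: power2_diff)
          finally show ?thesis using d by (simp add: field_simps power2_eq_square)
        qed
      qed (use int2 Pint in auto)
      also have "\<dots> = (LINT x|M. (P i x - P j x)\<^sup>2) / (2 * d) + d / 2" using int2 by (simp add: prob_space)
      also have "\<dots> < d\<^sup>2 / (2 * d) + d / 2" using lt d by (intro add_strict_right_mono divide_strict_right_mono) auto
      also have "\<dots> = d" using d by (simp add: power2_eq_square)
      finally show ?thesis .
    qed
    then show ?thesis by blast
  qed
  obtain r where r: "strict_mono r" "AE x in M. Cauchy (\<lambda>i. P (r i) x)"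
    using cauchy_L1_AE_cauchy_subseq[of M P, OF Pint L1] by blast
  define g where "g x = lim (\<lambda>i. P (r i) x)" for x
  have glim: "AE x in M. (\<lambda>i. P (r i) x) \<longlonglongrightarrow> g x"
    using r(2) by eventually_elim (simp add: g_def Cauchy_convergent convergent_LIMSEQ_iff[symmetric])
  \<comment> \<open>Dropping the first |i| terms changes neither the limit nor the value of
    \<open>lim\<close> at points of divergence, and the remaining terms are measurable for
    \<open>FF i\<close> because r(n) \<ge> n. Hence measurability is exact, not only up to null
    sets.\<close>
  have gF: "g \<in> borel_measurable (FF i)" for i
  proof -
    have "g = (\<lambda>x. lim (\<lambda>n. P (r (n + nat \<bar>i\<bar>)) x))"
    proof
      fix x
      have "((\<lambda>n. P (r n) x) \<longlonglongrightarrow> L) = ((\<lambda>n. P (r (n + nat \<bar>i\<bar>)) x) \<longlonglongrightarrow> L)" for L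
        using LIMSEQ_ignore_initial_segment[of "\<lambda>n. P (r n) x" L "nat \<bar>i\<bar>"]
          LIMSEQ_offset[of "\<lambda>n. P (r n) x" "nat \<bar>i\<bar>" L] by blast
      then show "g x = lim (\<lambda>n. P (r (n + nat \<bar>i\<bar>)) x)" by (simp only: g_def lim_def)
    qed
    moreover have "P (r (n + nat \<bar>i\<bar>)) \<in> borel_measurable (FF i)" for n
    proof (rule borel_FF_mono[OF _ PF])
      show "i \<le> int (r (n + nat \<bar>i\<bar>))" using seq_suble[OF r(1), of "n + nat \<bar>i\<bar>"] by linarith
    qed
    ultimately show ?thesis by simp
  qed
  then have gm[measurable]: "g \<in> borel_measurable M" using borel_FF_M by blast
  have g01: "AE x in M. 0 \<le> g x \<and> g x \<le> 1"
  proof -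
    have "AE x in M. \<forall>n. 0 \<le> P n x \<and> P n x \<le> 1" using P01 by (simp add: AE_all_countable)
    with glim show ?thesis
    proof eventually_elim
      case (elim x)
      then show ?case using LIMSEQ_le_const[of "\<lambda>i. P (r i) x" "g x" 0] LIMSEQ_le_const2[of "\<lambda>i. P (r i) x" "g x" 1] by auto
    qed
  qed
  have gint: "integrable M g"
  proof (rule integrable_const_bound[where B=1])
    show "AE x in M. norm (g x) \<le> 1" using g01 by eventually_elim auto
  qed simp
  have Eg: "(\<integral>x. g x \<partial>M) = prob E"
  proof -
    have "(\<lambda>i. \<integral>x. P (r i) x \<partial>M) \<longlonglongrightarrow> (\<integral>x. g x \<partial>M)"
    proof (rule integral_dominated_convergence[where w="\<lambda>_. 1"])
      show "AE x in M. norm (P (r i) x) \<le> 1" for i using P01[of "r i"] by eventually_elim auto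
    qed (use glim in auto)
    moreover have "(\<integral>x. P n x \<partial>M) = prob E" for n
    proof -
      have "(\<integral>x. P n x \<partial>M) = (\<integral>x. indicator E x \<partial>M)"
        unfolding P_def by (rule sigma_finite_subalgebra.real_cond_exp_int(2)[OF FF_sfs iE])
      also have "\<dots> = prob E" using sets.sets_into_space[OF E] by (simp add: Int_absorb2)
      finally show ?thesis .
    qed
    ultimately show ?thesis by (simp add: LIMSEQ_const_iff)
  qed
  have gE: "AE x in M. g x = prob E"
  proof -
    \<comment> \<open>A tail event, so g lies on one side of its own mean almost everywhere, and
      this forces equality.\<close>
    define S where "S = {x \<in> space M. g x > prob E}"
    have SF: "S \<in> sets (FF i)" for i
    proof -
      have "{x \<in> space (FF i). g x > prob E} \<in> sets (FF i)" using gF[of i] by measurable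
      then show ?thesis by (simp add: S_def)
    qed
    have [measurable]: "S \<in> sets M" using SF[of 0] sets_FF by blast
    have "prob S = 0 \<or> prob S = 1" using tail_trivial SF by blast
    then show ?thesis
    proof
      assume "prob S = 0"
      then have "AE x in M. x \<notin> S" by (simp add: prob_eq_0)
      then have "AE x in M. 0 \<le> prob E - g x" by (auto simp: S_def)
      moreover have "(\<integral>x. prob E - g x \<partial>M) = 0" using gint Eg by (simp add: prob_space)
      ultimately have "AE x in M. prob E - g x = 0" using gint
        by (subst (asm) integral_nonneg_eq_0_iff_AE) auto
      then show ?thesis by auto
    next
      assume "prob S = 1"
      then have "AE x in M. x \<in> S" by (simp add: prob_eq_1)
      then have "AE x in M. 0 \<le> g x - prob E" by (auto simp: S_def)
      moreover have "(\<integral>x. g x - prob E \<partial>M) = 0" using gint Eg by (simp add: prob_space)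
      ultimately have "AE x in M. g x - prob E = 0" using gint
        by (subst (asm) integral_nonneg_eq_0_iff_AE) auto
      then show ?thesis by auto
    qed
  qed
  have "(\<lambda>i. \<integral>x. (P (r i) x - prob E)\<^sup>2 \<partial>M) \<longlonglongrightarrow> (\<integral>x. 0 \<partial>M)"
  proof (rule integral_dominated_convergence[where w="\<lambda>_. 1"])
    show "AE x in M. (\<lambda>i. (P (r i) x - prob E)\<^sup>2) \<longlonglongrightarrow> 0"
      using glim gE
    proof eventually_elim
      case (elim x)
      then have "(\<lambda>i. (P (r i) x - prob E)\<^sup>2) \<longlonglongrightarrow> (prob E - prob E)\<^sup>2" by (intro tendsto_intros) simp
      then show ?case by simp
    qed
    show "AE x in M. norm ((P (r i) x - prob E)\<^sup>2) \<le> 1" for i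
      using P01[of "r i"]
    proof eventually_elim
      case (elim x)
      have "\<bar>P (r i) x - prob E\<bar> \<le> 1" using elim prob_le_1[of E] measure_nonneg[of M E] by linarith
      then show ?case by (simp add: abs_square_le_1)
    qed
  qed auto
  then obtain N where N: "\<And>i. i \<ge> N \<Longrightarrow> (\<integral>x. (P (r i) x - prob E)\<^sup>2 \<partial>M) < e"
    using e order_tendstoD(2)[of _ 0 sequentially e] unfolding eventually_sequentially by auto
  have "r (max N k) \<ge> k" using seq_suble[OF r(1), of "max N k"] by simp
  then show ?thesis using N[of "max N k"] unfolding P_def by (intro exI[of _ "r (max N k)"]) simp
qed

text \<open>The shifts \<open>f \<circ> T\<^sup>n\<close> of such a function behave like martingale differences at distances \<open>\<ge> j - i\<close>.\<close>

definition kmd :: "int \<Rightarrow> int \<Rightarrow> ('a \<Rightarrow> complex) \<Rightarrow> bool" where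
  "kmd i j f \<longleftrightarrow> f \<in> bdd_borel (FF i) \<and> (\<forall>G\<in>bdd_borel (FF j). (\<integral>x. f x * G x \<partial>M) = 0)"

lemma kmd_integral_mult: "kmd i j f \<Longrightarrow> G \<in> bdd_borel (FF j) \<Longrightarrow> (\<integral>x. f x * G x \<partial>M) = 0"
  by (simp add: kmd_def)

lemma kmd_mono: "kmd i j f \<Longrightarrow> i' \<le> i \<Longrightarrow> j \<le> j' \<Longrightarrow> kmd i' j' f"
  unfolding kmd_def using bdd_borel_FF_mono by blast

lemma kmd_add: assumes "kmd i j f" "kmd i j g" shows "kmd i j (\<lambda>x. f x + g x)"
  unfolding kmd_def
proof (intro conjI ballI)
  fix G assume G: "G \<in> bdd_borel (FF j)"
  have "integrable M (\<lambda>x. f x * G x)" "integrable M (\<lambda>x. g x * G x)"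
    using assms G by (auto simp: kmd_def intro!: bdd_borel_integrable bdd_borel_mult intro: bdd_borel_FF_M)
  then show "(\<integral>x. (f x + g x) * G x \<partial>M) = 0"
    using assms G by (simp add: kmd_def distrib_right)
qed (use assms in \<open>auto simp: kmd_def intro: bdd_borel_add\<close>)

text \<open>The factor is absorbed by the test function; i \<le> j keeps the product measurable for
  \<open>FF i\<close>.\<close>

lemma kmd_mult: assumes "kmd i j f" "g \<in> bdd_borel (FF j)" "i \<le> j" shows "kmd i j (\<lambda>x. f x * g x)"
  unfolding kmd_def
proof (intro conjI ballI)
  fix G assume "G \<in> bdd_borel (FF j)"
  then have "(\<lambda>x. g x * G x) \<in> bdd_borel (FF j)" using assms by (intro bdd_borel_mult)
  then show "(\<integral>x. f x * g x * G x \<partial>M) = 0"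
    using kmd_integral_mult[OF assms(1)] by (simp add: mult.assoc)
qed (use assms bdd_borel_FF_mono[OF assms(3)] in \<open>auto simp: kmd_def intro: bdd_borel_mult\<close>)

lemma kmd_cmult: "kmd i j f \<Longrightarrow> kmd i j (\<lambda>x. c * f x)"
  by (auto simp: kmd_def mult.assoc intro: bdd_borel_cmult)

text \<open>Invertibility enters here: on the space, a test function G for \<open>FF (j + 1)\<close>
  is \<open>G \<circ> U\<close> followed after T, where \<open>G \<circ> U\<close> is a test
  function for \<open>FF j\<close>; then T preserves the integral.\<close>

lemma kmd_T: assumes f: "kmd i j f" shows "kmd (i + 1) (j + 1) (\<lambda>x. f (T x))"
  unfolding kmd_def
proof (intro conjI ballI)
  show "(\<lambda>x. f (T x)) \<in> bdd_borel (FF (i + 1))"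
    using f by (auto simp: kmd_def intro: bdd_borel_comp[OF _ T_FF])
  fix G assume "G \<in> bdd_borel (FF (j + 1))"
  then have GU: "(\<lambda>x. G (U x)) \<in> bdd_borel (FF j)" by (rule bdd_borel_comp[OF _ U_FF])
  have fm: "f \<in> bdd_borel M" using f by (auto simp: kmd_def intro: bdd_borel_FF_M)
  have "(\<integral>x. f (T x) * G x \<partial>M) = (\<integral>x. f (T x) * G (U (T x)) \<partial>M)"
    by (rule Bochner_Integration.integral_cong) (auto simp: U_T)
  also have "\<dots> = (\<integral>x. f x * G (U x) \<partial>M)"
    using integral_Tn[of "\<lambda>x. f x * G (U x)" 1] fm GU
    by (auto dest!: bdd_borel_measurable borel_FF_M)
  finally show "(\<integral>x. f (T x) * G x \<partial>M) = 0" using kmd_integral_mult[OF f GU] by simp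
qed

lemma kmd_Tn: "kmd i j f \<Longrightarrow> kmd (i + int n) (j + int n) (\<lambda>x. f ((T ^^ n) x))"
proof (induction n)
  case (Suc n)
  then show ?case using kmd_T[of "i + int n" "j + int n"] by (simp add: funpow_swap1 ac_simps)
qed simp

text \<open>The witness is the indicator minus its conditional expectation on \<open>FF n\<close>
  for large n. It is orthogonal to \<open>FF n\<close>, and it misses the centred indicator by a
  quantity that triviality of the tail makes small.\<close>

lemma kmd_approx_indicator:
  assumes E: "E \<in> sets (FF i)" and e: "e > 0"
  shows "\<exists>j f. kmd i j f \<and> (\<integral>x. (norm (indicator E x - of_real (prob E) - f x))\<^sup>2 \<partial>M) < e"
proof -
  have EM: "E \<in> sets M" using E sets_FF by blast
  obtain n where n: "n \<ge> nat i"
    "(\<integral>x. (real_cond_exp M (FF (int n)) (indicator E) x - prob E)\<^sup>2 \<partial>M) < e"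
    using tail_cond_exp[OF EM e, of "nat i"] by blast
  interpret C: sigma_finite_subalgebra M "FF (int n)" by (rule FF_sfs)
  let ?P = "real_cond_exp M (FF (int n)) (indicator E)"
  \<comment> \<open>A version of the conditional expectation with values in [0, 1] everywhere, as
    \<open>bdd_borel\<close> demands a bound at every point.\<close>
  define Q where "Q x = max 0 (min 1 (?P x))" for x
  have iE: "integrable M (indicator E :: 'a \<Rightarrow> real)"
    by (rule integrable_const_bound[where B=1]) (use EM in \<open>auto simp: indicator_def\<close>)
  have QP: "AE x in M. Q x = ?P x"
    using C.real_cond_exp_ge_c[OF iE, of 0] C.real_cond_exp_le_c[OF iE, of 1]
    by (auto simp: indicator_def Q_def)
  have QF: "Q \<in> borel_measurable (FF (int n))" unfolding Q_def by simp
  have i_le: "i \<le> int n" using n by simp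
  define f where "f x = complex_of_real (indicator E x - Q x)" for x
  have "f \<in> borel_measurable (FF i)"
    unfolding f_def using E borel_FF_mono[OF i_le QF] by measurable
  moreover have "norm (f x) \<le> 1" for x
    unfolding f_def norm_of_real by (auto simp: Q_def indicator_def)
  ultimately have fb: "f \<in> bdd_borel (FF i)" by (rule bdd_borelI)
  have orth_real: "(\<integral>x. (indicator E x - Q x) * g x \<partial>M) = 0" and int_real: "integrable M (\<lambda>x. (indicator E x - Q x) * g x)"
    if g: "g \<in> borel_measurable (FF (int n))" "\<And>x. \<bar>g x\<bar> \<le> B" for g :: "'a \<Rightarrow> real" and B
  proof -
    have gM[measurable]: "g \<in> borel_measurable M" using g borel_FF_M by blast
    have QM[measurable]: "Q \<in> borel_measurable M" using QF borel_FF_M by blast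
    have gi: "integrable M g" by (rule integrable_const_bound[where B=B]) (use g in auto)
    have 1: "integrable M (\<lambda>x. g x * indicator E x)"
      using integrable_mult_indicator[OF EM gi] by (simp add: mult.commute)
    have 2: "integrable M (\<lambda>x. g x * Q x)"
    proof (rule Bochner_Integration.integrable_bound[OF gi])
      show "AE x in M. norm (g x * Q x) \<le> norm (g x)"
        by (auto simp: abs_mult Q_def intro!: mult_left_le)
    qed simp
    have "(\<integral>x. g x * Q x \<partial>M) = (\<integral>x. g x * ?P x \<partial>M)"
      using QP by (intro integral_cong_AE) auto
    also have "\<dots> = (\<integral>x. g x * indicator E x \<partial>M)"
      using 1 g EM by (intro C.real_cond_exp_intg(2)) auto
    finally have 3: "(\<integral>x. g x * Q x \<partial>M) = (\<integral>x. g x * indicator E x \<partial>M)" .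
    have eq: "(indicator E x - Q x) * g x = g x * indicator E x - g x * Q x" for x by (simp add: algebra_simps)
    show "(\<integral>x. (indicator E x - Q x) * g x \<partial>M) = 0" "integrable M (\<lambda>x. (indicator E x - Q x) * g x)"
      unfolding eq using 1 2 3 by auto
  qed
  have "kmd i (int n) f"
    unfolding kmd_def
  proof (intro conjI ballI fb)
    fix G assume G: "G \<in> bdd_borel (FF (int n))"
    obtain B where B: "\<And>x. norm (G x) \<le> B" using bdd_borel_bound[OF G] by blast
    have Gm: "G \<in> borel_measurable (FF (int n))" using G by (rule bdd_borel_measurable)
    have r: "(\<lambda>x. Re (G x)) \<in> borel_measurable (FF (int n))" "\<And>x. \<bar>Re (G x)\<bar> \<le> B"
      using Gm B abs_Re_le_cmod order_trans by (auto, blast)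
    have m: "(\<lambda>x. Im (G x)) \<in> borel_measurable (FF (int n))" "\<And>x. \<bar>Im (G x)\<bar> \<le> B"
      using Gm B abs_Im_le_cmod order_trans by (auto, blast)
    have fG: "integrable M (\<lambda>x. f x * G x)"
      by (intro bdd_borel_integrable bdd_borel_mult bdd_borel_FF_M[OF fb] bdd_borel_FF_M[OF G])
    have "Re (\<integral>x. f x * G x \<partial>M) = (\<integral>x. (indicator E x - Q x) * Re (G x) \<partial>M)"
      using fG by (simp add: integral_Re[symmetric] f_def)
    moreover have "Im (\<integral>x. f x * G x \<partial>M) = (\<integral>x. (indicator E x - Q x) * Im (G x) \<partial>M)"
      using fG by (simp add: integral_Im[symmetric] f_def)
    ultimately show "(\<integral>x. f x * G x \<partial>M) = 0"
      using orth_real[OF r] orth_real[OF m] by (simp add: complex_eq_iff)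
  qed
  moreover have "(\<integral>x. (norm (indicator E x - of_real (prob E) - f x))\<^sup>2 \<partial>M) < e"
  proof -
    have eq: "norm (indicator E x - of_real (prob E) - f x) = \<bar>Q x - prob E\<bar>" for x
    proof -
      have "indicator E x - of_real (prob E) - f x = complex_of_real (Q x - prob E)"
        by (auto simp: f_def indicator_def)
      then show ?thesis by (simp only: norm_of_real)
    qed
    have QM[measurable]: "Q \<in> borel_measurable M" using QF borel_FF_M by blast
    have "(\<integral>x. (norm (indicator E x - of_real (prob E) - f x))\<^sup>2 \<partial>M) = (\<integral>x. (?P x - prob E)\<^sup>2 \<partial>M)"
      unfolding eq power2_abs using QP by (intro integral_cong_AE) auto
    then show ?thesis using n by simp
  qed
  ultimately show ?thesis by blast
qed

end

section \<open>Approximation in the product with a Kolmogorov system\<close>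

lemma norm_add_square_le:
  fixes a b :: "'a :: real_normed_vector"
  shows "(norm (a + b))\<^sup>2 \<le> 2 * (norm a)\<^sup>2 + 2 * (norm b)\<^sup>2"
proof -
  have "(norm (a + b))\<^sup>2 \<le> (norm a + norm b)\<^sup>2"
    by (intro power_mono norm_triangle_ineq) simp
  also have "\<dots> \<le> 2 * (norm a)\<^sup>2 + 2 * (norm b)\<^sup>2"
    using sum_squares_bound[of "norm a" "norm b"] by (simp add: power2_sum)
  finally show ?thesis .
qed

lemma (in finite_measure) bdd_borel_square_integrable:
  assumes "f \<in> bdd_borel M" shows "integrable M (\<lambda>x. (norm (f x))\<^sup>2)"
proof -
  obtain B where "\<And>x. norm (f x) \<le> B" using bdd_borel_bound[OF assms] by blast
  then show ?thesis using assms
    by (intro integrable_const_bound[where B="B\<^sup>2"]) (auto intro!: power_mono)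
qed

lemma (in finite_measure) integral_square_add_le:
  assumes "f \<in> bdd_borel M" "g \<in> bdd_borel M"
  shows "(\<integral>x. (norm (f x + g x))\<^sup>2 \<partial>M) \<le> 2 * (\<integral>x. (norm (f x))\<^sup>2 \<partial>M) + 2 * (\<integral>x. (norm (g x))\<^sup>2 \<partial>M)"
proof -
  have i: "integrable M (\<lambda>x. (norm (f x))\<^sup>2)" "integrable M (\<lambda>x. (norm (g x))\<^sup>2)"
    using assms by (auto intro: bdd_borel_square_integrable)
  have "(\<integral>x. (norm (f x + g x))\<^sup>2 \<partial>M) \<le> (\<integral>x. 2 * (norm (f x))\<^sup>2 + 2 * (norm (g x))\<^sup>2 \<partial>M)"
    by (rule integral_mono[OF _ _ norm_add_square_le])
      (use i bdd_borel_square_integrable[OF bdd_borel_add[OF assms]] in auto)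
  then show ?thesis using i by simp
qed

text \<open>The variance of |f| is nonnegative.\<close>

lemma (in prob_space) norm_integral_square_le:
  fixes f :: "'a \<Rightarrow> complex"
  assumes "f \<in> borel_measurable M" "integrable M (\<lambda>x. (norm (f x))\<^sup>2)"
  shows "(norm (\<integral>x. f x \<partial>M))\<^sup>2 \<le> (\<integral>x. (norm (f x))\<^sup>2 \<partial>M)"
proof -
  have i: "integrable M (\<lambda>x. norm (f x))"
  proof (rule Bochner_Integration.integrable_bound)
    show "integrable M (\<lambda>x. 1 + (norm (f x))\<^sup>2)" using assms(2) by simp
    have "t \<le> 1 + t\<^sup>2" for t :: real
      using sum_squares_bound[of t 1] zero_le_square[of t] unfolding power2_eq_square by linarith
    then show "AE x in M. norm (norm (f x)) \<le> norm (1 + (norm (f x))\<^sup>2)" by simp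
  qed (use assms(1) in simp)
  define a where "a = (\<integral>x. norm (f x) \<partial>M)"
  have "0 \<le> (\<integral>x. (norm (f x) - a)\<^sup>2 \<partial>M)" by (rule Bochner_Integration.integral_nonneg) simp
  also have "\<dots> = (\<integral>x. (norm (f x))\<^sup>2 - 2 * a * norm (f x) + a\<^sup>2 \<partial>M)"
    by (rule Bochner_Integration.integral_cong) (auto simp: power2_diff)
  also have "\<dots> = (\<integral>x. (norm (f x))\<^sup>2 \<partial>M) - a\<^sup>2"
    using i assms by (simp add: prob_space a_def power2_eq_square)
  finally have "a\<^sup>2 \<le> (\<integral>x. (norm (f x))\<^sup>2 \<partial>M)" by simp
  moreover have "(norm (\<integral>x. f x \<partial>M))\<^sup>2 \<le> a\<^sup>2"
    unfolding a_def by (intro power_mono integral_norm_bound) simp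
  ultimately show ?thesis by simp
qed

lemma funpow_map_prod:
  fixes f :: "'a \<Rightarrow> 'a" and g :: "'b \<Rightarrow> 'b"
  shows "(map_prod f g ^^ n) z = ((f ^^ n) (fst z), (g ^^ n) (snd z))"
  by (induction n) (auto simp: prod_eq_iff)

section \<open>The product system and its fibre means\<close>

locale kolmogorov_product = kolmogorov_filtration M T FF U + N: measure_preserving N S
  for M :: "'a measure" and T FF U and N :: "'b measure" and S
begin

abbreviation "P \<equiv> M \<Otimes>\<^sub>M N"
abbreviation "R \<equiv> map_prod T S"

sublocale PR: pair_prob_space M N ..

lemma mp_R: "mp_system P R"
proof -
  have m: "R \<in> P \<rightarrow>\<^sub>M P" by (simp add: map_prod_def)
  have "distr M M T \<Otimes>\<^sub>M distr N N S = distr P P (\<lambda>(x, y). (T x, S y))"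
  proof (rule pair_measure_distr)
    show "sigma_finite_measure (distr N N S)"
      using distr_Tn[of 1] N.distr_Tn[of 1] by (simp add: N.sigma_finite_measure_axioms)
  qed simp_all
  then have "distr P P R = P"
    using distr_Tn[of 1] N.distr_Tn[of 1] by (simp add: map_prod_def)
  then show ?thesis using m PR.prob_space_axioms by (simp add: mp_system_def)
qed

sublocale R: measure_preserving P R by standard (rule mp_R)

lemma distr_snd: "distr P N snd = N"
proof (rule measure_eqI)
  fix A assume "A \<in> sets (distr P N snd)"
  then have A: "A \<in> sets N" by simp
  have "snd -` A \<inter> space P = space M \<times> A"
    using sets.sets_into_space[OF A] by (auto simp: space_pair_measure)
  then show "emeasure (distr P N snd) A = emeasure N A"
    using A by (simp add: emeasure_distr N.emeasure_pair_measure_Times emeasure_space_1)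
qed simp

lemma integral_snd_comp:
  fixes f :: "'b \<Rightarrow> 'c :: {banach, second_countable_topology}"
  shows "f \<in> borel_measurable N \<Longrightarrow> (\<integral>z. f (snd z) \<partial>P) = (\<integral>y. f y \<partial>N)"
  using integral_distr[of snd P N f] by (simp add: distr_snd)

lemma AE_snd_comp: "AE y in N. Q y \<Longrightarrow> AE z in P. Q (snd z)"
  by (rule AE_distrD[of snd P N, unfolded distr_snd]) auto

text \<open>The conditional expectation on the second coordinate, in a version defined at each
  point. It is 0 where the section is not integrable, which matters for functions that are merely in
  L^2.\<close>

definition fibre_mean :: "('a \<times> 'b \<Rightarrow> complex) \<Rightarrow> 'b \<Rightarrow> complex" where
  "fibre_mean G y = (\<integral>x. G (x, y) \<partial>M)"

lemma fibre_mean_measurable[measurable]: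
  "G \<in> borel_measurable P \<Longrightarrow> fibre_mean G \<in> borel_measurable N"
proof -
  assume [measurable]: "G \<in> borel_measurable P"
  have "(\<lambda>p. G (snd p, fst p)) \<in> borel_measurable (N \<Otimes>\<^sub>M M)"
    by (rule measurable_compose[of _ _ P]) measurable
  then show "fibre_mean G \<in> borel_measurable N"
    unfolding fibre_mean_def[abs_def] by (intro borel_measurable_lebesgue_integral) (simp add: case_prod_beta')
qed

lemma bdd_borel_section: "G \<in> bdd_borel P \<Longrightarrow> y \<in> space N \<Longrightarrow> (\<lambda>x. G (x, y)) \<in> bdd_borel M"
  by (rule bdd_borel_comp) auto

lemma fibre_mean_bdd_borel: assumes "G \<in> bdd_borel P" shows "fibre_mean G \<in> bdd_borel N"
proof -
  obtain B where "\<And>z. norm (G z) \<le> B" using bdd_borel_bound[OF assms] by blast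
  then show ?thesis using assms
    by (intro bdd_borelI[of _ _ B]) (auto simp: fibre_mean_def intro!: norm_integral_le_bound)
qed

lemma fibre_mean_snd_bdd_borel: "G \<in> bdd_borel P \<Longrightarrow> (\<lambda>z. fibre_mean G (snd z)) \<in> bdd_borel P"
  by (rule bdd_borel_comp[OF fibre_mean_bdd_borel]) auto

lemma integral_fibre_mean: "integrable P G \<Longrightarrow> (\<integral>y. fibre_mean G y \<partial>N) = (\<integral>z. G z \<partial>P)"
  unfolding fibre_mean_def using PR.integral_snd[of "\<lambda>x y. G (x, y)"] by simp

lemma fibre_mean_add:
  "G \<in> bdd_borel P \<Longrightarrow> H \<in> bdd_borel P \<Longrightarrow> y \<in> space N \<Longrightarrow> fibre_mean (\<lambda>z. G z + H z) y = fibre_mean G y + fibre_mean H y"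
  unfolding fibre_mean_def by (intro Bochner_Integration.integral_add bdd_borel_integrable bdd_borel_section)

lemma fibre_mean_diff:
  "G \<in> bdd_borel P \<Longrightarrow> H \<in> bdd_borel P \<Longrightarrow> y \<in> space N \<Longrightarrow> fibre_mean (\<lambda>z. G z - H z) y = fibre_mean G y - fibre_mean H y"
  unfolding fibre_mean_def by (intro Bochner_Integration.integral_diff bdd_borel_integrable bdd_borel_section)

lemma fibre_mean_cmult: "fibre_mean (\<lambda>z. c * G z) y = c * fibre_mean G y"
  by (simp add: fibre_mean_def)

lemma fibre_mean_snd_fun: "fibre_mean (\<lambda>z. f (snd z)) y = f y"
  by (simp add: fibre_mean_def prob_space)

lemma fibre_mean_square_le:
  assumes G: "G \<in> borel_measurable P" "integrable P (\<lambda>z. (norm (G z))\<^sup>2)"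
  shows "integrable N (\<lambda>y. (norm (fibre_mean G y))\<^sup>2)"
    and "(\<integral>y. (norm (fibre_mean G y))\<^sup>2 \<partial>N) \<le> (\<integral>z. (norm (G z))\<^sup>2 \<partial>P)"
proof -
  have cp: "case_prod (\<lambda>x y. (norm (G (x, y)))\<^sup>2) = (\<lambda>z. (norm (G z))\<^sup>2)" by (auto simp: fun_eq_iff)
  then have i2: "integrable P (case_prod (\<lambda>x y. (norm (G (x, y)))\<^sup>2))" using G by simp
  note [measurable] = G(1)
  have le: "AE y in N. (norm (fibre_mean G y))\<^sup>2 \<le> (\<integral>x. (norm (G (x, y)))\<^sup>2 \<partial>M)"
    using PR.AE_integrable_snd[OF i2] AE_space
  proof eventually_elim
    case (elim y)
    then show ?case unfolding fibre_mean_def by (intro norm_integral_square_le) auto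
  qed
  show i: "integrable N (\<lambda>y. (norm (fibre_mean G y))\<^sup>2)"
    by (rule Bochner_Integration.integrable_bound[OF PR.integrable_snd[OF i2]])
      (use le in \<open>auto elim!: eventually_mono intro: order_trans\<close>)
  have "(\<integral>y. (norm (fibre_mean G y))\<^sup>2 \<partial>N) \<le> (\<integral>y. (\<integral>x. (norm (G (x, y)))\<^sup>2 \<partial>M) \<partial>N)"
    using i PR.integrable_snd[OF i2] le by (rule integral_mono_AE)
  also have "\<dots> = (\<integral>z. (norm (G z))\<^sup>2 \<partial>P)"
    using PR.integral_snd[OF i2] unfolding cp .
  finally show "(\<integral>y. (norm (fibre_mean G y))\<^sup>2 \<partial>N) \<le> (\<integral>z. (norm (G z))\<^sup>2 \<partial>P)" .
qed

definition centered :: "('a \<times> 'b \<Rightarrow> complex) \<Rightarrow> 'a \<times> 'b \<Rightarrow> complex" where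
  "centered G z = G z - fibre_mean G (snd z)"

lemma centered_bdd_borel: "G \<in> bdd_borel P \<Longrightarrow> centered G \<in> bdd_borel P"
  unfolding centered_def[abs_def] by (intro bdd_borel_diff fibre_mean_snd_bdd_borel)

lemma centered_square_le:
  assumes "G \<in> bdd_borel P" shows "(\<integral>z. (norm (centered G z))\<^sup>2 \<partial>P) \<le> 4 * (\<integral>z. (norm (G z))\<^sup>2 \<partial>P)"
proof -
  have e: "(\<lambda>z. - fibre_mean G (snd z)) \<in> bdd_borel P" using bdd_borel_cmult[OF fibre_mean_snd_bdd_borel[OF assms], of "-1"] by simp
  have "(\<integral>z. (norm (centered G z))\<^sup>2 \<partial>P) \<le> 2 * (\<integral>z. (norm (G z))\<^sup>2 \<partial>P) + 2 * (\<integral>z. (norm (- fibre_mean G (snd z)))\<^sup>2 \<partial>P)"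
    using PR.integral_square_add_le[OF assms e] by (simp add: centered_def)
  also have "(\<integral>z. (norm (- fibre_mean G (snd z)))\<^sup>2 \<partial>P) = (\<integral>y. (norm (fibre_mean G y))\<^sup>2 \<partial>N)"
    using integral_snd_comp[of "\<lambda>y. (norm (fibre_mean G y))\<^sup>2"] assms by (simp add: bdd_borel_measurable)
  also have "\<dots> \<le> (\<integral>z. (norm (G z))\<^sup>2 \<partial>P)"
    using assms by (intro fibre_mean_square_le PR.bdd_borel_square_integrable) (auto dest: bdd_borel_measurable)
  finally show ?thesis by simp
qed

text \<open>One pair i, j serves all fibres, so correlations vanish from one distance on, whatever y
  is. Covering every fibre rather than almost every one keeps the class stable under
  \<open>R\<close> without null sets.\<close>

definition W :: "int \<Rightarrow> int \<Rightarrow> ('a \<times> 'b \<Rightarrow> complex) \<Rightarrow> bool" where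
  "W i j V \<longleftrightarrow> V \<in> bdd_borel P \<and> (\<forall>y\<in>space N. kmd i j (\<lambda>x. V (x, y)))"

lemma W_bdd_borel: "W i j V \<Longrightarrow> V \<in> bdd_borel P" by (simp add: W_def)

lemma W_mono: "W i j V \<Longrightarrow> i' \<le> i \<Longrightarrow> j \<le> j' \<Longrightarrow> W i' j' V"
  unfolding W_def using kmd_mono by blast

lemma W_add:
  assumes "W i j V" "W i' j' V'" shows "W (min i i') (max j j') (\<lambda>z. V z + V' z)"
proof -
  have "W (min i i') (max j j') V" "W (min i i') (max j j') V'" using assms by (auto intro: W_mono)
  then show ?thesis unfolding W_def by (auto intro: bdd_borel_add kmd_add)
qed

lemma W_cmult: "W i j V \<Longrightarrow> W i j (\<lambda>z. c * V z)"
  unfolding W_def by (auto intro: bdd_borel_cmult kmd_cmult)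

lemma W_zero: "W i j (\<lambda>_. 0)"
  by (auto simp: W_def kmd_def intro: bdd_borel_const)

lemma fibre_mean_W: assumes "W i j V" "y \<in> space N" shows "fibre_mean V y = 0"
  using kmd_integral_mult[of i j "\<lambda>x. V (x, y)" "\<lambda>_. 1"] assms bdd_borel_const[of 1 "FF j"] by (simp add: W_def fibre_mean_def)

lemma bdd_borel_R: "G \<in> bdd_borel P \<Longrightarrow> (\<lambda>z. G ((R ^^ n) z)) \<in> bdd_borel P"
  by (rule R.bdd_borel_Tn)

lemma W_R: assumes "W i j V" shows "W (i + int n) (j + int n) (\<lambda>z. V ((R ^^ n) z))"
  unfolding W_def
proof (intro conjI ballI)
  show "(\<lambda>z. V ((R ^^ n) z)) \<in> bdd_borel P" using assms by (intro bdd_borel_R W_bdd_borel)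
  fix y assume "y \<in> space N"
  then have "(S ^^ n) y \<in> space N" using measurable_space[OF N.Tn_meas] by blast
  then have "kmd i j (\<lambda>x. V (x, (S ^^ n) y))" using assms by (simp add: W_def)
  then show "kmd (i + int n) (j + int n) (\<lambda>x. V ((R ^^ n) (x, y)))"
    using kmd_Tn[of i j "\<lambda>x. V (x, (S ^^ n) y)" n] by (simp add: funpow_map_prod)
qed

lemma W_mult:
  assumes "W i j V" "i \<le> j" "G \<in> bdd_borel P" "\<And>y. y \<in> space N \<Longrightarrow> (\<lambda>x. G (x, y)) \<in> bdd_borel (FF j)"
  shows "W i j (\<lambda>z. V z * G z)"
  using assms unfolding W_def by (auto intro: bdd_borel_mult kmd_mult)

text \<open>This property holds for rectangles over the \<open>FF i\<close> and passes to linear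
  combinations, to disjoint unions of sets and to L^2 limits; a monotone class argument then reaches
  all bounded measurable functions.\<close>

definition approx :: "('a \<times> 'b \<Rightarrow> complex) \<Rightarrow> bool" where
  "approx G \<longleftrightarrow> (\<forall>e>0. \<exists>i j V. W i j V \<and> (\<integral>z. (norm (centered G z - V z))\<^sup>2 \<partial>P) < e)"

lemma approxD: "approx G \<Longrightarrow> e > 0 \<Longrightarrow> \<exists>i j V. W i j V \<and> (\<integral>z. (norm (centered G z - V z))\<^sup>2 \<partial>P) < e"
  by (simp add: approx_def)

lemma approx_add:
  assumes b: "G \<in> bdd_borel P" "H \<in> bdd_borel P" and a: "approx G" "approx H"
  shows "approx (\<lambda>z. G z + H z)"
  unfolding approx_def
proof (intro allI impI)
  fix e :: real assume "e > 0"
  then have e4: "e / 4 > 0" by simp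
  obtain i j V where V: "W i j V" "(\<integral>z. (norm (centered G z - V z))\<^sup>2 \<partial>P) < e / 4"
    using approxD[OF a(1) e4] by blast
  obtain i' j' V' where V': "W i' j' V'" "(\<integral>z. (norm (centered H z - V' z))\<^sup>2 \<partial>P) < e / 4"
    using approxD[OF a(2) e4] by blast
  have "(\<integral>z. (norm (centered (\<lambda>z. G z + H z) z - (V z + V' z)))\<^sup>2 \<partial>P)
     = (\<integral>z. (norm ((centered G z - V z) + (centered H z - V' z)))\<^sup>2 \<partial>P)"
  proof (rule Bochner_Integration.integral_cong[OF refl])
    fix z assume "z \<in> space P"
    then have "snd z \<in> space N" by (auto simp: space_pair_measure)
    then have "centered (\<lambda>z. G z + H z) z - (V z + V' z) = (centered G z - V z) + (centered H z - V' z)"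
      using fibre_mean_add[OF b] by (simp add: centered_def)
    then show "(norm (centered (\<lambda>z. G z + H z) z - (V z + V' z)))\<^sup>2 = (norm ((centered G z - V z) + (centered H z - V' z)))\<^sup>2"
      by (simp only:)
  qed
  also have "\<dots> \<le> 2 * (\<integral>z. (norm (centered G z - V z))\<^sup>2 \<partial>P) + 2 * (\<integral>z. (norm (centered H z - V' z))\<^sup>2 \<partial>P)"
    by (intro PR.integral_square_add_le bdd_borel_diff centered_bdd_borel b W_bdd_borel[OF V(1)] W_bdd_borel[OF V'(1)])
  also have "\<dots> < e" using V(2) V'(2) by simp
  finally show "\<exists>i j V. W i j V \<and> (\<integral>z. (norm (centered (\<lambda>z. G z + H z) z - V z))\<^sup>2 \<partial>P) < e"
    using W_add[OF V(1) V'(1)] by blast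
qed

lemma approx_cmult:
  assumes a: "approx G" shows "approx (\<lambda>z. c * G z)"
  unfolding approx_def
proof (intro allI impI)
  fix e :: real assume e: "e > 0"
  define d where "d = e / ((norm c)\<^sup>2 + 1)"
  have c1: "(norm c)\<^sup>2 + 1 > 0" by (simp add: add_nonneg_pos)
  then have d: "d > 0" using e by (simp add: d_def)
  obtain i j V where V: "W i j V" "(\<integral>z. (norm (centered G z - V z))\<^sup>2 \<partial>P) < d"
    using approxD[OF a d] by blast
  have "centered (\<lambda>z. c * G z) z - c * V z = c * (centered G z - V z)" for z
    by (simp add: centered_def fibre_mean_cmult algebra_simps)
  then have "(\<integral>z. (norm (centered (\<lambda>z. c * G z) z - c * V z))\<^sup>2 \<partial>P) = (norm c)\<^sup>2 * (\<integral>z. (norm (centered G z - V z))\<^sup>2 \<partial>P)"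
    by (simp add: norm_mult power_mult_distrib)
  also have "\<dots> \<le> (norm c)\<^sup>2 * d" using V by (intro mult_left_mono) auto
  also have "\<dots> < ((norm c)\<^sup>2 + 1) * d" using d by simp
  also have "\<dots> = e" using c1 by (simp add: d_def)
  finally show "\<exists>i j V. W i j V \<and> (\<integral>z. (norm (centered (\<lambda>z. c * G z) z - V z))\<^sup>2 \<partial>P) < e"
    using W_cmult[OF V(1)] by blast
qed

lemma approx_zero: "approx (\<lambda>_. 0)"
  unfolding approx_def
proof (intro allI impI)
  fix e :: real assume "e > 0"
  then have "(\<integral>z. (norm (centered (\<lambda>_. 0) z - 0))\<^sup>2 \<partial>P) < e" by (simp add: centered_def fibre_mean_def)
  then show "\<exists>i j V. W i j V \<and> (\<integral>z. (norm (centered (\<lambda>_. 0) z - V z))\<^sup>2 \<partial>P) < e"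
    using W_zero[of 0 0] by blast
qed

lemma approx_empty: "approx (indicator {})"
proof -
  have "(indicator {} :: 'a \<times> 'b \<Rightarrow> complex) = (\<lambda>_. 0)" by auto
  then show ?thesis using approx_zero by simp
qed

lemma approx_diff:
  assumes "G \<in> bdd_borel P" "H \<in> bdd_borel P" "approx G" "approx H"
  shows "approx (\<lambda>z. G z - H z)"
  using approx_add[OF assms(1) bdd_borel_cmult[OF assms(2)] assms(3) approx_cmult[OF assms(4)], of "-1"] by simp

lemma approx_sum:
  "finite I \<Longrightarrow> (\<And>i. i \<in> I \<Longrightarrow> G i \<in> bdd_borel P \<and> approx (G i)) \<Longrightarrow> approx (\<lambda>z. \<Sum>i\<in>I. G i z)"
proof (induction I rule: finite_induct)
  case (insert i I)
  then show ?case using approx_add[of "G i" "\<lambda>z. \<Sum>i\<in>I. G i z"] bdd_borel_sum[of I G P] by simp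
qed (simp add: approx_zero)

text \<open>Centring multiplies squared L^2 norms by at most 4. So the budget e / 16 for G - H turns
  into 2 * 4 * e / 16 = e / 2, and e / 4 for the centred part of H into the other half.\<close>

lemma approx_limit:
  assumes b: "G \<in> bdd_borel P"
    and lim: "\<And>e. e > 0 \<Longrightarrow> \<exists>H. H \<in> bdd_borel P \<and> approx H \<and> (\<integral>z. (norm (G z - H z))\<^sup>2 \<partial>P) < e"
  shows "approx G"
  unfolding approx_def
proof (intro allI impI)
  fix e :: real assume "e > 0"
  then have e: "e / 16 > 0" "e / 4 > 0" by auto
  obtain H where H: "H \<in> bdd_borel P" "approx H" "(\<integral>z. (norm (G z - H z))\<^sup>2 \<partial>P) < e / 16"
    using lim[OF e(1)] by blast
  obtain i j V where V: "W i j V" "(\<integral>z. (norm (centered H z - V z))\<^sup>2 \<partial>P) < e / 4"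
    using approxD[OF H(2) e(2)] by blast
  have "(\<integral>z. (norm (centered G z - V z))\<^sup>2 \<partial>P) = (\<integral>z. (norm (centered (\<lambda>z. G z - H z) z + (centered H z - V z)))\<^sup>2 \<partial>P)"
  proof (rule Bochner_Integration.integral_cong[OF refl])
    fix z assume "z \<in> space P"
    then have "snd z \<in> space N" by (auto simp: space_pair_measure)
    then have "centered G z - V z = centered (\<lambda>z. G z - H z) z + (centered H z - V z)"
      using fibre_mean_diff[OF b H(1)] by (simp add: centered_def)
    then show "(norm (centered G z - V z))\<^sup>2 = (norm (centered (\<lambda>z. G z - H z) z + (centered H z - V z)))\<^sup>2"
      by (simp only:)
  qed
  also have "\<dots> \<le> 2 * (\<integral>z. (norm (centered (\<lambda>z. G z - H z) z))\<^sup>2 \<partial>P) + 2 * (\<integral>z. (norm (centered H z - V z))\<^sup>2 \<partial>P)"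
    by (intro PR.integral_square_add_le bdd_borel_diff centered_bdd_borel b H(1) W_bdd_borel[OF V(1)])
  also have "\<dots> < e" using centered_square_le[OF bdd_borel_diff[OF b H(1)]] H(3) V(2) by simp
  finally show "\<exists>i j V. W i j V \<and> (\<integral>z. (norm (centered G z - V z))\<^sup>2 \<partial>P) < e" using V(1) by blast
qed

abbreviation ind :: "('a \<times> 'b) set \<Rightarrow> 'a \<times> 'b \<Rightarrow> complex" where "ind A \<equiv> indicator A"

lemma ind_bdd_borel: "A \<in> sets P \<Longrightarrow> ind A \<in> bdd_borel P"
  by (rule bdd_borelI[of _ _ 1]) (auto simp: indicator_def)

text \<open>On a rectangle centring acts on the first coordinate alone, so the approximation on X
  multiplied by the indicator of F will do.\<close>

lemma approx_rectangle_FF: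
  assumes E: "E \<in> sets (FF i)" and F: "F \<in> sets N"
  shows "approx (ind (E \<times> F))"
  unfolding approx_def
proof (intro allI impI)
  fix e :: real assume e: "e > 0"
  have EM[measurable]: "E \<in> sets M" using E sets_FF by blast
  note [measurable] = F
  obtain j f where f: "kmd i j f" "(\<integral>x. (norm (indicator E x - of_real (prob E) - f x))\<^sup>2 \<partial>M) < e"
    using kmd_approx_indicator[OF E e] by blast
  have fb: "f \<in> bdd_borel M" using f(1) by (auto simp: kmd_def intro: bdd_borel_FF_M)
  define V where "V z = indicator F (snd z) * f (fst z)" for z :: "'a \<times> 'b"
  have Vb: "V \<in> bdd_borel P"
    unfolding V_def
  proof (rule bdd_borel_mult)
    show "(\<lambda>z. indicator F (snd z)) \<in> bdd_borel P" by (rule bdd_borelI[of _ _ 1]) (auto simp: indicator_def)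
    show "(\<lambda>z. f (fst z)) \<in> bdd_borel P" by (rule bdd_borel_comp[OF fb]) auto
  qed
  have "W i j V" using Vb kmd_cmult[OF f(1)] by (auto simp: W_def V_def)
  moreover have "(\<integral>z. (norm (centered (ind (E \<times> F)) z - V z))\<^sup>2 \<partial>P) < e"
  proof -
    define g where "g x = (norm (indicator E x - of_real (prob E) - f x))\<^sup>2" for x
    have gm[measurable]: "g \<in> borel_measurable M" unfolding g_def using fb by (simp add: bdd_borel_measurable)
    have gb: "integrable M g"
      unfolding g_def
    proof (rule bdd_borel_square_integrable)
      show "(\<lambda>x. indicator E x - of_real (prob E) - f x) \<in> bdd_borel M"
        by (intro bdd_borel_diff bdd_borel_const fb bdd_borelI[of _ _ 1]) (auto simp: indicator_def)
    qed
    have avgr: "fibre_mean (ind (E \<times> F)) y = of_real (prob E) * indicator F y" for y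
    proof -
      have "fibre_mean (ind (E \<times> F)) y = (\<integral>x. indicator E x * indicator F y \<partial>M)"
        unfolding fibre_mean_def by (simp add: indicator_times)
      also have "\<dots> = (\<integral>x. indicator E x \<partial>M) * indicator F y" by simp
      also have "(\<integral>x. indicator E x \<partial>M) = complex_of_real (\<integral>x. indicator E x \<partial>M)"
        unfolding integral_complex_of_real[symmetric]
        by (rule Bochner_Integration.integral_cong) (auto simp: indicator_def)
      also have "(\<integral>x. indicator E x \<partial>M) = prob E"
        using sets.sets_into_space[OF EM] by (simp add: Int_absorb2)
      finally show ?thesis .
    qed
    have eq: "centered (ind (E \<times> F)) z - V z = indicator F (snd z) * (indicator E (fst z) - of_real (prob E) - f (fst z))" for z
      unfolding centered_def V_def avgr by (cases z) (simp add: indicator_times algebra_simps)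
    have i1: "integrable P (\<lambda>z. (norm (centered (ind (E \<times> F)) z - V z))\<^sup>2)"
      by (intro PR.bdd_borel_square_integrable bdd_borel_diff centered_bdd_borel ind_bdd_borel Vb) measurable
    have i2: "integrable P (\<lambda>z. g (fst z))"
      using integrable_distr_eq[of fst P M g] gb N.distr_pair_fst[of M] by simp
    have "(\<integral>z. (norm (centered (ind (E \<times> F)) z - V z))\<^sup>2 \<partial>P) \<le> (\<integral>z. g (fst z) \<partial>P)"
      by (rule integral_mono[OF i1 i2]) (auto simp: eq g_def indicator_def)
    also have "\<dots> = (\<integral>x. g x \<partial>M)"
      using integral_distr[of fst P M g] N.distr_pair_fst[of M] by simp
    finally show ?thesis using f(2) by (simp add: g_def)
  qed
  ultimately show "\<exists>i j V. W i j V \<and> (\<integral>z. (norm (centered (ind (E \<times> F)) z - V z))\<^sup>2 \<partial>P) < e" by blast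
qed

text \<open>The indicators of finite unions converge in L^2 by dominated convergence, and
  disjointness makes them finite sums.\<close>

lemma approx_disjoint_union:
  fixes A :: "nat \<Rightarrow> ('a \<times> 'b) set"
  assumes A: "\<And>n. A n \<in> sets P" "disjoint_family A" "\<And>n. approx (ind (A n))"
  shows "approx (ind (\<Union>n. A n))"
proof (rule approx_limit)
  have [measurable]: "(\<Union>n. A n) \<in> sets P" by (rule sets.countable_nat_UN) (use A(1) in blast)
  note [measurable] = A(1)
  show "ind (\<Union>n. A n) \<in> bdd_borel P" by (rule ind_bdd_borel) measurable
  fix e :: real assume e: "e > 0"
  have "(\<lambda>m. \<integral>z. (norm (ind (\<Union>n. A n) z - (\<Sum>n<m. ind (A n) z)))\<^sup>2 \<partial>P) \<longlonglongrightarrow> (\<integral>z. (0::real) \<partial>P)"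
  proof (rule integral_dominated_convergence[where w="\<lambda>_. 1"])
    have S: "(\<Sum>n<m. ind (A n) z) = (if \<exists>n<m. z \<in> A n then 1 else 0)" for m z
    proof (cases "\<exists>n<m. z \<in> A n")
      case True
      then obtain n where n: "n < m" "z \<in> A n" by blast
      have "ind (A k) z = (if k = n then 1 else 0)" for k
        using n(2) A(2) unfolding disjoint_family_on_def indicator_def by auto
      then show ?thesis using n True by simp
    qed (auto simp: indicator_def)
    have eq: "(norm (ind (\<Union>n. A n) z - (\<Sum>n<m. ind (A n) z)))\<^sup>2 = (if z \<in> (\<Union>n. A n) \<and> \<not> (\<exists>n<m. z \<in> A n) then 1 else 0 :: real)" for m z
      unfolding S by (auto simp: indicator_def)
    show "AE z in P. (\<lambda>m. (norm (ind (\<Union>n. A n) z - (\<Sum>n<m. ind (A n) z)))\<^sup>2) \<longlonglongrightarrow> 0"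
    proof (rule AE_I2)
      fix z
      show "(\<lambda>m. (norm (ind (\<Union>n. A n) z - (\<Sum>n<m. ind (A n) z)))\<^sup>2) \<longlonglongrightarrow> 0"
      proof (cases "z \<in> (\<Union>n. A n)")
        case True
        then obtain n where "z \<in> A n" by blast
        then have "eventually (\<lambda>m. (norm (ind (\<Union>n. A n) z - (\<Sum>n<m. ind (A n) z)))\<^sup>2 = 0) sequentially"
          unfolding eq eventually_sequentially by (intro exI[of _ "Suc n"]) (auto simp: Suc_le_eq)
        then show ?thesis by (rule tendsto_eventually)
      qed (simp add: eq)
    qed
    show "AE z in P. norm ((norm (ind (\<Union>n. A n) z - (\<Sum>n<m. ind (A n) z)))\<^sup>2) \<le> 1" for m
      unfolding eq by auto
  qed measurable
  then obtain m where m: "(\<integral>z. (norm (ind (\<Union>n. A n) z - (\<Sum>n<m. ind (A n) z)))\<^sup>2 \<partial>P) < e"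
    using e order_tendstoD(2)[of _ 0 sequentially e] unfolding eventually_sequentially by auto
  have "approx (\<lambda>z. \<Sum>n<m. ind (A n) z)" "(\<lambda>z. \<Sum>n<m. ind (A n) z) \<in> bdd_borel P"
    using A by (auto intro!: approx_sum bdd_borel_sum ind_bdd_borel)
  then show "\<exists>H. H \<in> bdd_borel P \<and> approx H \<and> (\<integral>z. (norm (ind (\<Union>n. A n) z - H z))\<^sup>2 \<partial>P) < e"
    using m by blast
qed

text \<open>For fixed F, a pi-lambda argument passes from the nested \<open>FF i\<close> to the
  sigma-algebra that they generate. E agrees with a member of the latter up to a null set, which L^2
  does not see.\<close>

lemma approx_rectangle:
  assumes E: "E \<in> sets M" and F: "F \<in> sets N"
  shows "approx (ind (E \<times> F))"
proof -
  let ?G = "\<Union>i. sets (FF i)"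
  have sub: "sigma_sets (space M) ?G \<subseteq> sets M"
    using sets_FF by (intro sets.sigma_sets_subset) blast
  have 1: "approx (ind (E' \<times> F))" if "E' \<in> sigma_sets (space M) ?G" for E'
  proof (rule sigma_sets_induct_disjoint[of ?G "space M" E'])
    show "Int_stable ?G"
    proof (rule Int_stableI)
      fix a b assume "a \<in> ?G" "b \<in> ?G"
      then obtain i j where "a \<in> sets (FF i)" "b \<in> sets (FF j)" by blast
      then have "a \<in> sets (FF (min i j))" "b \<in> sets (FF (min i j))"
        using FF_mono[of "min i j" i] FF_mono[of "min i j" j] by auto
      then show "a \<inter> b \<in> ?G" by blast
    qed
    show "?G \<subseteq> Pow (space M)" using sets_FF sets.sets_into_space by blast
    show "E' \<in> sigma_sets (space M) ?G" by (rule that)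
    show "approx (ind (A \<times> F))" if "A \<in> ?G" for A
      using that approx_rectangle_FF[OF _ F] by blast
    show "approx (ind ({} \<times> F))" by (simp add: approx_empty)
    show "approx (ind ((space M - A) \<times> F))" if "A \<in> sigma_sets (space M) ?G" "approx (ind (A \<times> F))" for A
    proof -
      have A: "A \<in> sets M" using that sub by blast
      have top: "space M \<in> sets (FF 0)" using sets.top[of "FF 0"] by simp
      have "approx (\<lambda>z. ind (space M \<times> F) z - ind (A \<times> F) z)"
        using A F that(2) by (intro approx_diff ind_bdd_borel approx_rectangle_FF[OF top]) auto
      moreover have "(\<lambda>z. ind (space M \<times> F) z - ind (A \<times> F) z) = ind ((space M - A) \<times> F)"
        using sets.sets_into_space[OF A] by (auto simp: indicator_def fun_eq_iff)
      ultimately show ?thesis by simp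
    qed
    show "approx (ind ((\<Union>n. A n) \<times> F))"
      if "disjoint_family A" "range A \<subseteq> sigma_sets (space M) ?G" "\<And>n. approx (ind (A n \<times> F))" for A :: "nat \<Rightarrow> 'a set"
    proof -
      have "approx (ind (\<Union>n. A n \<times> F))"
      proof (rule approx_disjoint_union)
        show "A n \<times> F \<in> sets P" for n using that(2) sub F by auto
        show "disjoint_family (\<lambda>n. A n \<times> F)" using that(1) by (auto simp: disjoint_family_on_def)
      qed (rule that(3))
      moreover have "(\<Union>n. A n \<times> F) = (\<Union>n. A n) \<times> F" by auto
      ultimately show ?thesis by simp
    qed
  qed
  obtain E' where E': "E' \<in> sigma_sets (space M) ?G" "AE x in M. x \<in> E \<longleftrightarrow> x \<in> E'"
    using generating[OF E] by blast
  have E'M: "E' \<in> sets M" using E' sub by blast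
  note [measurable] = E E'M F
  have AEP: "AE z in P. fst z \<in> E \<longleftrightarrow> fst z \<in> E'"
  proof (rule AE_distrD[of fst P M])
    show "AE x in distr P M fst. x \<in> E \<longleftrightarrow> x \<in> E'" unfolding N.distr_pair_fst by (rule E'(2))
  qed simp
  have "(\<integral>z. (norm (ind (E \<times> F) z - ind (E' \<times> F) z))\<^sup>2 \<partial>P) = (\<integral>z. (0::real) \<partial>P)"
  proof (rule integral_cong_AE)
    show "AE z in P. (norm (ind (E \<times> F) z - ind (E' \<times> F) z))\<^sup>2 = 0"
      using AEP by eventually_elim (auto simp: indicator_def)
  qed measurable
  then show ?thesis
    using 1[OF E'(1)] by (intro approx_limit) (auto intro!: ind_bdd_borel exI[of _ "ind (E' \<times> F)"])
qed

text \<open>A second pi-lambda argument, now from rectangles to the product sigma-algebra.\<close>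

lemma approx_indicator:
  assumes "A \<in> sets P" shows "approx (ind A)"
proof -
  let ?G = "{a \<times> b | a b. a \<in> sets M \<and> b \<in> sets N}"
  have sP: "sets P = sigma_sets (space M \<times> space N) ?G" by (rule sets_pair_measure)
  show ?thesis
  proof (rule sigma_sets_induct_disjoint[of ?G "space M \<times> space N" A])
    show "Int_stable ?G" by (rule Int_stable_pair_measure_generator)
    show "?G \<subseteq> Pow (space M \<times> space N)" by (rule pair_measure_closed)
    show "A \<in> sigma_sets (space M \<times> space N) ?G" using assms sP by simp
    show "approx (ind B)" if "B \<in> ?G" for B using that approx_rectangle by blast
    show "approx (ind {})" by (simp add: approx_empty)
    show "approx (ind (space M \<times> space N - B))" if "B \<in> sigma_sets (space M \<times> space N) ?G" "approx (ind B)" for B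
    proof -
      have B: "B \<in> sets P" using that sP by simp
      have "approx (\<lambda>z. ind (space M \<times> space N) z - ind B z)"
        using B that(2) by (intro approx_diff ind_bdd_borel approx_rectangle) auto
      moreover have "(\<lambda>z. ind (space M \<times> space N) z - ind B z) = ind (space M \<times> space N - B)"
        using sets.sets_into_space[OF B] by (auto simp: indicator_def fun_eq_iff space_pair_measure)
      ultimately show ?thesis by simp
    qed
    show "approx (ind (\<Union>n. B n))"
      if "disjoint_family B" "range B \<subseteq> sigma_sets (space M \<times> space N) ?G" "\<And>n. approx (ind (B n))" for B :: "nat \<Rightarrow> ('a \<times> 'b) set"
      using that by (intro approx_disjoint_union) (auto simp: sP)
  qed
qed

text \<open>Simple functions converge to G in L^2 by dominated convergence; their moduli stay below
  twice that of G, whence the dominating constant \<open>(3 * B)\<^sup>2\<close>.\<close>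

theorem approx_bdd_borel:
  assumes G: "G \<in> bdd_borel P" shows "approx G"
proof (rule approx_limit[OF G])
  fix e :: real assume e: "e > 0"
  obtain B where B: "\<And>z. norm (G z) \<le> B" "B > 0" using bdd_borel_bound[OF G] by blast
  have Gm[measurable]: "G \<in> borel_measurable P" using G by (rule bdd_borel_measurable)
  obtain s where s: "\<And>i. simple_function P (s i)" "\<And>z. z \<in> space P \<Longrightarrow> (\<lambda>i. s i z) \<longlonglongrightarrow> G z"
    "\<And>i z. z \<in> space P \<Longrightarrow> norm (s i z) \<le> 2 * norm (G z)"
  proof -
    obtain s where "\<forall>i. simple_function P (s i)" "\<forall>x\<in>space P. (\<lambda>i. s i x) \<longlonglongrightarrow> G x"
      "\<forall>i. \<forall>x\<in>space P. dist (s i x) 0 \<le> 2 * dist (G x) 0"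
      using borel_measurable_implies_sequence_metric[OF Gm, of 0] by blast
    then show ?thesis using that[of s] unfolding dist_0_norm dist_norm diff_zero by blast
  qed
  have sm[measurable]: "s i \<in> borel_measurable P" for i by (rule borel_measurable_simple_function[OF s(1)])
  \<comment> \<open>\<open>s i\<close> as an explicit combination of indicators of measurable sets;
    the two agree only on the space of P.\<close>
  define H where "H i z = (\<Sum>v\<in>s i ` space P. v * ind (s i -` {v} \<inter> space P) z)" for i z
  have Hs: "H i z = s i z" if "z \<in> space P" for i z
  proof -
    have fin: "finite (s i ` space P)" using s(1) by (simp add: simple_function_def)
    have "H i z = (\<Sum>v\<in>s i ` space P. if v = s i z then v else 0)"
      unfolding H_def using that by (intro sum.cong) (auto simp: indicator_def)
    then show ?thesis using fin that by simp
  qed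
  have setm: "s i -` {v} \<inter> space P \<in> sets P" for i v by measurable
  have Hb: "H i \<in> bdd_borel P" for i
    unfolding H_def by (intro bdd_borel_sum bdd_borel_cmult ind_bdd_borel setm)
  have Ha: "approx (H i)" for i
    unfolding H_def using s(1)[of i]
    by (intro approx_sum conjI bdd_borel_cmult ind_bdd_borel setm approx_cmult approx_indicator) (simp add: simple_function_def)
  have "(\<lambda>i. \<integral>z. (norm (G z - H i z))\<^sup>2 \<partial>P) \<longlonglongrightarrow> (\<integral>z. (0::real) \<partial>P)"
  proof (rule integral_dominated_convergence[where w="\<lambda>_. (3 * B)\<^sup>2"])
    show "AE z in P. (\<lambda>i. (norm (G z - H i z))\<^sup>2) \<longlonglongrightarrow> 0"
    proof (rule AE_I2)
      fix z assume z: "z \<in> space P"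
      have "(\<lambda>i. (norm (G z - s i z))\<^sup>2) \<longlonglongrightarrow> (norm (G z - G z))\<^sup>2"
        by (intro tendsto_intros s(2) z)
      then show "(\<lambda>i. (norm (G z - H i z))\<^sup>2) \<longlonglongrightarrow> 0" using z by (simp add: Hs)
    qed
    show "AE z in P. norm ((norm (G z - H i z))\<^sup>2) \<le> (3 * B)\<^sup>2" for i
    proof (rule AE_I2)
      fix z assume z: "z \<in> space P"
      have "norm (G z - H i z) \<le> norm (G z) + norm (s i z)" using z by (simp add: Hs norm_triangle_ineq4)
      also have "\<dots> \<le> 3 * B" using s(3)[OF z, of i] B(1)[of z] by simp
      finally have "(norm (G z - H i z))\<^sup>2 \<le> (3 * B)\<^sup>2" by (intro power_mono) auto
      then show "norm ((norm (G z - H i z))\<^sup>2) \<le> (3 * B)\<^sup>2" by simp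
    qed
  qed (use bdd_borel_measurable[OF Hb] in auto)
  then obtain i where "(\<integral>z. (norm (G z - H i z))\<^sup>2 \<partial>P) < e"
    using e order_tendstoD(2)[of _ 0 sequentially e] unfolding eventually_sequentially by auto
  then show "\<exists>H. H \<in> bdd_borel P \<and> approx H \<and> (\<integral>z. (norm (G z - H z))\<^sup>2 \<partial>P) < e"
    using Hb Ha by blast
qed

end

section \<open>Ergodicity and the factors of the product\<close>

lemma L_infinity_truncate:
  assumes "f \<in> L_infinity M"
  obtains g where "g \<in> bdd_borel M" "AE x in M. f x = g x"
proof -
  obtain B where f: "f \<in> borel_measurable M" "AE x in M. norm (f x) \<le> B"
    using assms by (auto simp: L_infinity_def)
  define g where "g x = (if norm (f x) \<le> B then f x else 0)" for x
  have "g \<in> bdd_borel M"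
    using f(1) by (intro bdd_borelI[of _ _ "max B 0"]) (auto simp: g_def[abs_def])
  moreover have "AE x in M. f x = g x" using f(2) by eventually_elim (simp add: g_def)
  ultimately show ?thesis by (rule that)
qed

lemma bdd_borel_L_infinity: "f \<in> bdd_borel M \<Longrightarrow> f \<in> L_infinity M"
  by (auto simp: bdd_borel_def L_infinity_def)

lemma (in finite_measure) bdd_borel_L_two: "f \<in> bdd_borel M \<Longrightarrow> f \<in> L_two M"
  by (simp add: L_two_def bdd_borel_measurable bdd_borel_square_integrable)

lemma (in finite_measure) L_two_integrable:
  assumes "f \<in> L_two M" shows "integrable M f"
proof (rule Bochner_Integration.integrable_bound)
  show "integrable M (\<lambda>x. 1 + (norm (f x))\<^sup>2)" using assms by (simp add: L_two_def)
  have "t \<le> 1 + t\<^sup>2" for t :: real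
    using sum_squares_bound[of t 1] zero_le_square[of t] unfolding power2_eq_square by linarith
  then show "AE x in M. norm (f x) \<le> norm (1 + (norm (f x))\<^sup>2)" by simp
qed (use assms in \<open>simp add: L_two_def\<close>)

lemma L_two_add:
  assumes "f \<in> L_two M" "g \<in> L_two M" shows "(\<lambda>x. f x + g x) \<in> L_two M"
  unfolding L_two_def
proof (intro CollectI conjI)
  show m: "(\<lambda>x. f x + g x) \<in> borel_measurable M" using assms by (auto simp: L_two_def)
  have "integrable M (\<lambda>x. 2 * (norm (f x))\<^sup>2 + 2 * (norm (g x))\<^sup>2)"
    using assms by (simp add: L_two_def)
  then show "integrable M (\<lambda>x. (norm (f x + g x))\<^sup>2)"
    by (rule Bochner_Integration.integrable_bound) (use m norm_add_square_le in auto)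
qed

lemma L_two_cmult: "f \<in> L_two M \<Longrightarrow> (\<lambda>x. c * f x) \<in> L_two M"
  by (auto simp: L_two_def norm_mult power_mult_distrib)

lemma L_two_diff:
  assumes "f \<in> L_two M" "g \<in> L_two M" shows "(\<lambda>x. f x - g x) \<in> L_two M"
  using L_two_add[OF assms(1) L_two_cmult[OF assms(2), of "-1"]] by simp

lemma L_two_square_add_le:
  assumes "f \<in> L_two M" "g \<in> L_two M"
  shows "(\<integral>x. (norm (f x + g x))\<^sup>2 \<partial>M) \<le> 2 * (\<integral>x. (norm (f x))\<^sup>2 \<partial>M) + 2 * (\<integral>x. (norm (g x))\<^sup>2 \<partial>M)"
proof -
  have "(\<integral>x. (norm (f x + g x))\<^sup>2 \<partial>M) \<le> (\<integral>x. 2 * (norm (f x))\<^sup>2 + 2 * (norm (g x))\<^sup>2 \<partial>M)"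
    by (rule integral_mono[OF _ _ norm_add_square_le])
      (use assms L_two_add[OF assms] in \<open>auto simp: L_two_def\<close>)
  then show ?thesis using assms by (simp add: L_two_def)
qed

lemma L_two_truncate:
  assumes f: "f \<in> L_two M" and e: "e > 0"
  shows "\<exists>g\<in>bdd_borel M. (\<integral>x. (norm (f x - g x))\<^sup>2 \<partial>M) < e"
proof -
  have fm[measurable]: "f \<in> borel_measurable M" and fi: "integrable M (\<lambda>x. (norm (f x))\<^sup>2)"
    using f by (auto simp: L_two_def)
  define g where "g n x = (if norm (f x) \<le> real n then f x else 0)" for n x
  have gm[measurable]: "g n \<in> borel_measurable M" for n unfolding g_def[abs_def] by measurable
  have gb: "g n \<in> bdd_borel M" for n by (rule bdd_borelI[of _ _ "real n"]) (auto simp: g_def)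
  have "(\<lambda>n. \<integral>x. (norm (f x - g n x))\<^sup>2 \<partial>M) \<longlonglongrightarrow> (\<integral>x. (0::real) \<partial>M)"
  proof (rule integral_dominated_convergence[OF _ _ fi])
    show "AE x in M. (\<lambda>n. (norm (f x - g n x))\<^sup>2) \<longlonglongrightarrow> 0"
    proof (rule AE_I2)
      fix x
      obtain n0 where "norm (f x) \<le> real n0" using real_arch_simple by blast
      then have "eventually (\<lambda>n. (norm (f x - g n x))\<^sup>2 = 0) sequentially"
        unfolding eventually_sequentially g_def by (intro exI[of _ n0]) auto
      then show "(\<lambda>n. (norm (f x - g n x))\<^sup>2) \<longlonglongrightarrow> 0" by (rule tendsto_eventually)
    qed
  qed (auto simp: g_def)
  then obtain n where "(\<integral>x. (norm (f x - g n x))\<^sup>2 \<partial>M) < e"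
    using e order_tendstoD(2)[of _ 0 sequentially e] unfolding eventually_sequentially by auto
  then show ?thesis using gb by blast
qed

lemma complex_cond_exp_zero_cong:
  assumes "sigma_finite_subalgebra M Z" "f \<in> borel_measurable M" "g \<in> borel_measurable M" "AE x in M. f x = g x"
  shows "(AE x in M. complex_cond_exp M Z f x = 0) \<longleftrightarrow> (AE x in M. complex_cond_exp M Z g x = 0)"
proof -
  interpret sigma_finite_subalgebra M Z by fact
  have "AE x in M. real_cond_exp M Z (\<lambda>y. Re (f y)) x = real_cond_exp M Z (\<lambda>y. Re (g y)) x"
    using assms by (intro real_cond_exp_cong) auto
  moreover have "AE x in M. real_cond_exp M Z (\<lambda>y. Im (f y)) x = real_cond_exp M Z (\<lambda>y. Im (g y)) x"
    using assms by (intro real_cond_exp_cong) auto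
  ultimately have "AE x in M. complex_cond_exp M Z f x = complex_cond_exp M Z g x"
    by eventually_elim (simp add: complex_cond_exp_def)
  then show ?thesis by (auto elim: eventually_elim2)
qed

context kolmogorov_product
begin

lemma integral_norm_fibre_mean_le:
  assumes "G \<in> bdd_borel P" shows "(\<integral>y. norm (fibre_mean G y) \<partial>N) \<le> (\<integral>z. norm (G z) \<partial>P)"
proof -
  have i: "integrable P (case_prod (\<lambda>x y. norm (G (x, y))))"
    using PR.bdd_borel_norm_integrable[OF assms] by (simp add: case_prod_beta')
  have "(\<integral>y. norm (fibre_mean G y) \<partial>N) \<le> (\<integral>y. (\<integral>x. norm (G (x, y)) \<partial>M) \<partial>N)"
    using N.bdd_borel_norm_integrable[OF fibre_mean_bdd_borel[OF assms]] PR.integrable_snd[OF i]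
    by (rule integral_mono) (simp add: fibre_mean_def)
  also have "\<dots> = (\<integral>z. norm (G z) \<partial>P)"
    using PR.integral_snd[OF i] by (simp add: case_prod_beta')
  finally show ?thesis .
qed

lemma fibre_mean_centered: "G \<in> bdd_borel P \<Longrightarrow> y \<in> space N \<Longrightarrow> fibre_mean (centered G) y = 0"
  using fibre_mean_diff[of G "\<lambda>z. fibre_mean G (snd z)" y] fibre_mean_snd_bdd_borel[of G] fibre_mean_snd_fun[of "fibre_mean G" y]
  unfolding centered_def[abs_def] by simp

lemma Sn_space: "y \<in> space N \<Longrightarrow> (S ^^ n) y \<in> space N"
  using measurable_space[OF N.Tn_meas] by blast

lemma fibre_mean_R:
  assumes "G \<in> bdd_borel P" "y \<in> space N"
  shows "fibre_mean (\<lambda>z. G ((R ^^ n) z)) y = fibre_mean G ((S ^^ n) y)"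
  unfolding fibre_mean_def funpow_map_prod fst_conv snd_conv
  using integral_Tn[of "\<lambda>x. G (x, (S ^^ n) y)" n] bdd_borel_section[OF assms(1) Sn_space[OF assms(2)]]
  by (simp add: bdd_borel_measurable)

text \<open>A centred factor times a constant of the fibre integrates to 0, so only mean times mean
  and centred times centred remain.\<close>

lemma fibre_mean_correlation:
  assumes F: "F \<in> bdd_borel P" and y: "y \<in> space N"
  shows "fibre_mean (\<lambda>z. F z * cnj (F ((R ^^ h) z))) y - fibre_mean F y * cnj (fibre_mean F ((S ^^ h) y))
     = fibre_mean (\<lambda>z. centered F z * cnj (centered F ((R ^^ h) z))) y"
proof -
  define c where "c x = centered F (x, y)" for x
  define c' where "c' x = centered F ((R ^^ h) (x, y))" for x
  define \<alpha> \<beta> where "\<alpha> = fibre_mean F y" and "\<beta> = fibre_mean F ((S ^^ h) y)"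
  have cb: "c \<in> bdd_borel M" unfolding c_def[abs_def] by (intro bdd_borel_section centered_bdd_borel F y)
  have cb': "c' \<in> bdd_borel M" unfolding c'_def[abs_def] by (rule bdd_borel_section[OF bdd_borel_R[OF centered_bdd_borel[OF F]] y])
  have c0: "(\<integral>x. c x \<partial>M) = 0" using fibre_mean_centered[OF F y] by (simp add: fibre_mean_def c_def)
  have c0': "(\<integral>x. c' x \<partial>M) = 0"
    using fibre_mean_R[OF centered_bdd_borel[OF F] y, of h] fibre_mean_centered[OF F Sn_space[OF y]] by (simp add: fibre_mean_def c'_def)
  have Fc: "F (x, y) = c x + \<alpha>" "F ((R ^^ h) (x, y)) = c' x + \<beta>" for x
    by (simp_all add: c_def c'_def \<alpha>_def \<beta>_def centered_def funpow_map_prod)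
  have i: "integrable M (\<lambda>x. c x * cnj (c' x))" "integrable M c" "integrable M (\<lambda>x. cnj (c' x))"
    using cb cb' by (auto intro!: bdd_borel_integrable bdd_borel_mult bdd_borel_cnj)
  have "fibre_mean (\<lambda>z. F z * cnj (F ((R ^^ h) z))) y = (\<integral>x. c x * cnj (c' x) + c x * cnj \<beta> + \<alpha> * cnj (c' x) + \<alpha> * cnj \<beta> \<partial>M)"
    unfolding fibre_mean_def Fc by (rule Bochner_Integration.integral_cong) (auto simp: algebra_simps)
  also have "\<dots> = (\<integral>x. c x * cnj (c' x) \<partial>M) + \<alpha> * cnj \<beta>"
    using i c0 c0' by (simp add: prob_space)
  finally show ?thesis by (simp add: fibre_mean_def c_def c'_def \<alpha>_def \<beta>_def)
qed

text \<open>The centred part C is replaced by an approximation V, whose correlations vanish on every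
  fibre once h \<ge> j - i. The remainder is controlled by the L^2 distance of C and V, uniformly in
  h.\<close>

lemma correlation_decay:
  assumes F: "F \<in> bdd_borel P"
  shows "(\<lambda>h. \<integral>y. norm (fibre_mean (\<lambda>z. F z * cnj (F ((R ^^ h) z))) y - fibre_mean F y * cnj (fibre_mean F ((S ^^ h) y))) \<partial>N) \<longlonglongrightarrow> 0"
proof (rule LIMSEQ_I)
  fix e :: real assume e: "e > 0"
  define C where "C = centered F"
  have Cb: "C \<in> bdd_borel P" unfolding C_def by (rule centered_bdd_borel[OF F])
  obtain B where B: "\<And>z. norm (C z) \<le> B" "B > 0" using bdd_borel_bound[OF Cb] by blast
  \<comment> \<open>Twice the coefficient B^2 / e + 1/2, which results from B t \<le> e / 4 + (B^2 /
    e) t^2, applied to u and to v, and from u v \<le> (u^2 + v^2) / 2.\<close>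
  define K where "K = 2 * B\<^sup>2 / e + 1"
  have K: "K > 0" unfolding K_def using e B by (simp add: add_nonneg_pos)
  have "e / 2 / K > 0" using e K by simp
  then obtain i j V where V: "W i j V" "(\<integral>z. (norm (C z - V z))\<^sup>2 \<partial>P) < e / 2 / K"
    using approxD[OF approx_bdd_borel[OF F]] unfolding C_def by blast
  define D where "D z = C z - V z" for z
  have Vb: "V \<in> bdd_borel P" by (rule W_bdd_borel[OF V(1)])
  have Db: "D \<in> bdd_borel P" unfolding D_def[abs_def] by (rule bdd_borel_diff[OF Cb Vb])
  have "norm ((\<integral>y. norm (fibre_mean (\<lambda>z. F z * cnj (F ((R ^^ h) z))) y - fibre_mean F y * cnj (fibre_mean F ((S ^^ h) y))) \<partial>N) - 0) < e"
    if h: "h \<ge> nat (j - i)" for h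
  proof -
    \<comment> \<open>The difference C C' - V V' in terms of D = C - V, where the dash means shift
      by h and conjugation.\<close>
    let ?E = "\<lambda>z. D z * cnj (C ((R ^^ h) z)) + C z * cnj (D ((R ^^ h) z)) - D z * cnj (D ((R ^^ h) z))"
    have Eb: "?E \<in> bdd_borel P" by (intro bdd_borel_diff bdd_borel_add bdd_borel_mult bdd_borel_cnj bdd_borel_R Db Cb)
    have V0: "fibre_mean (\<lambda>z. V z * cnj (V ((R ^^ h) z))) y = 0" if y: "y \<in> space N" for y
    proof -
      have "(\<lambda>x. V ((R ^^ h) (x, y))) \<in> bdd_borel (FF (i + int h))"
        using W_R[OF V(1), of h] y by (simp add: W_def kmd_def)
      then have "(\<lambda>x. cnj (V ((R ^^ h) (x, y)))) \<in> bdd_borel (FF j)"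
        using h by (intro bdd_borel_cnj bdd_borel_FF_mono[of j "i + int h"]) auto
      then show ?thesis unfolding fibre_mean_def
        using V(1) y by (intro kmd_integral_mult[of i j]) (auto simp: W_def)
    qed
    have "(\<integral>y. norm (fibre_mean (\<lambda>z. F z * cnj (F ((R ^^ h) z))) y - fibre_mean F y * cnj (fibre_mean F ((S ^^ h) y))) \<partial>N)
      = (\<integral>y. norm (fibre_mean ?E y) \<partial>N)"
    proof (rule Bochner_Integration.integral_cong[OF refl])
      fix y assume y: "y \<in> space N"
      have "(\<lambda>z. C z * cnj (C ((R ^^ h) z))) = (\<lambda>z. V z * cnj (V ((R ^^ h) z)) + ?E z)"
        by (auto simp: D_def algebra_simps)
      then have "fibre_mean (\<lambda>z. C z * cnj (C ((R ^^ h) z))) y = fibre_mean ?E y"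
        using fibre_mean_add[OF R.bdd_borel_corr[OF Vb, of h] Eb y] V0[OF y] by simp
      then show "norm (fibre_mean (\<lambda>z. F z * cnj (F ((R ^^ h) z))) y - fibre_mean F y * cnj (fibre_mean F ((S ^^ h) y))) = norm (fibre_mean ?E y)"
        unfolding fibre_mean_correlation[OF F y] C_def by simp
    qed
    also have "\<dots> \<le> (\<integral>z. norm (?E z) \<partial>P)" by (rule integral_norm_fibre_mean_le[OF Eb])
    also have "\<dots> \<le> (\<integral>z. e / 2 + (K / 2) * (norm (D z))\<^sup>2 + (K / 2) * (norm (D ((R ^^ h) z)))\<^sup>2 \<partial>P)"
    proof (rule integral_mono[OF PR.bdd_borel_norm_integrable[OF Eb]])
      show "integrable P (\<lambda>z. e / 2 + (K / 2) * (norm (D z))\<^sup>2 + (K / 2) * (norm (D ((R ^^ h) z)))\<^sup>2)"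
        using PR.bdd_borel_square_integrable[OF Db] PR.bdd_borel_square_integrable[OF bdd_borel_R[OF Db, of h]] by simp
      fix z
      define u v where "u = norm (D z)" and "v = norm (D ((R ^^ h) z))"
      have amgm: "B * t \<le> e / 4 + (B\<^sup>2 / e) * t\<^sup>2" for t
      proof -
        have "0 \<le> (B * t / sqrt e - sqrt e / 2)\<^sup>2" by simp
        also have "\<dots> = (B\<^sup>2 / e) * t\<^sup>2 - B * t + e / 4"
          using e by (simp add: power2_diff power_divide power_mult_distrib)
        finally show ?thesis by simp
      qed
      have "norm (?E z) \<le> norm (D z * cnj (C ((R ^^ h) z))) + norm (C z * cnj (D ((R ^^ h) z))) + norm (D z * cnj (D ((R ^^ h) z)))"
        by (intro order_trans[OF norm_triangle_ineq4] add_mono norm_triangle_ineq order_refl)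
      also have "\<dots> \<le> B * u + B * v + u * v"
        using mult_left_mono[OF B(1)[of "(R ^^ h) z"], of u] mult_right_mono[OF B(1)[of z], of v]
        unfolding norm_mult complex_mod_cnj u_def[symmetric] v_def[symmetric]
        by (simp add: u_def v_def mult.commute[of _ B])
      also have "\<dots> \<le> e / 2 + (K / 2) * u\<^sup>2 + (K / 2) * v\<^sup>2"
        using amgm[of u] amgm[of v] sum_squares_bound[of u v] by (simp add: K_def algebra_simps add_divide_distrib)
      finally show "norm (?E z) \<le> e / 2 + (K / 2) * (norm (D z))\<^sup>2 + (K / 2) * (norm (D ((R ^^ h) z)))\<^sup>2"
        by (simp only: u_def v_def)
    qed
    also have "\<dots> = e / 2 + K * (\<integral>z. (norm (D z))\<^sup>2 \<partial>P)"
      using PR.bdd_borel_square_integrable[OF Db] PR.bdd_borel_square_integrable[OF bdd_borel_R[OF Db, of h]]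
        R.integral_Tn[of "\<lambda>z. (norm (D z))\<^sup>2" h] bdd_borel_measurable[OF Db] by (simp add: PR.prob_space)
    also have "\<dots> < e" using V(2) K by (simp add: D_def field_simps)
    finally show ?thesis by simp
  qed
  then show "\<exists>no. \<forall>h\<ge>no. norm ((\<integral>y. norm (fibre_mean (\<lambda>z. F z * cnj (F ((R ^^ h) z))) y - fibre_mean F y * cnj (fibre_mean F ((S ^^ h) y))) \<partial>N) - 0) < e"
    by blast
qed

text \<open>By induction, the h-th terms on both sides are values of the lower level at two
  functions on Y whose L^1 distance tends to 0. The Lipschitz bound transfers this to the values,
  and Cesaro averaging makes the limits equal.\<close>

theorem hkp_prod: "F \<in> bdd_borel P \<Longrightarrow> hkp P R j F = hkp N S j (fibre_mean F)"
proof (induction j arbitrary: F)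
  case 0
  then show ?case using integral_fibre_mean[of F] by (simp add: PR.bdd_borel_integrable)
next
  case (Suc j)
  define a where "a h = hkp P R j (\<lambda>z. F z * cnj (F ((R ^^ h) z)))" for h
  define b where "b h = hkp N S j (\<lambda>y. fibre_mean F y * cnj (fibre_mean F ((S ^^ h) y)))" for h
  have blim: "(\<lambda>H. (1 / real H) * (\<Sum>h=1..H. b h)) \<longlonglongrightarrow> hkp N S (Suc j) (fibre_mean F)"
    unfolding b_def by (rule N.hkp_tendsto[OF fibre_mean_bdd_borel[OF Suc.prems]])
  have alim: "(\<lambda>H. (1 / real H) * (\<Sum>h=1..H. a h)) \<longlonglongrightarrow> hkp P R (Suc j) F"
    unfolding a_def by (rule R.hkp_tendsto[OF Suc.prems])
  obtain B where B: "\<And>z. norm (F z) \<le> B" "B > 0" using bdd_borel_bound[OF Suc.prems] by blast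
  have B2: "B * B \<ge> 0" using B by simp
  obtain C where C: "C \<ge> 0" "\<And>f g. f \<in> borel_measurable N \<Longrightarrow> g \<in> borel_measurable N \<Longrightarrow>
    \<forall>x. norm (f x) \<le> B * B \<Longrightarrow> \<forall>x. norm (g x) \<le> B * B \<Longrightarrow>
    \<bar>hkp N S j f - hkp N S j g\<bar> \<le> C * (\<integral>x. norm (f x - g x) \<partial>N)"
    using N.hkp_lipschitz[OF B2, of j] by (elim exE conjE) blast
  have avgB: "norm (fibre_mean F y) \<le> B" for y
    using B by (simp add: fibre_mean_def norm_integral_le_bound)
  let ?d = "\<lambda>h. \<integral>y. norm (fibre_mean (\<lambda>z. F z * cnj (F ((R ^^ h) z))) y - fibre_mean F y * cnj (fibre_mean F ((S ^^ h) y))) \<partial>N"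
  have ab: "\<bar>a h - b h\<bar> \<le> C * ?d h" for h
    unfolding a_def b_def Suc.IH[OF R.bdd_borel_corr[OF Suc.prems]]
  proof (rule C(2))
    show "fibre_mean (\<lambda>z. F z * cnj (F ((R ^^ h) z))) \<in> borel_measurable N"
      by (intro bdd_borel_measurable fibre_mean_bdd_borel R.bdd_borel_corr Suc.prems)
    show "(\<lambda>y. fibre_mean F y * cnj (fibre_mean F ((S ^^ h) y))) \<in> borel_measurable N"
      by (intro bdd_borel_measurable N.bdd_borel_corr fibre_mean_bdd_borel Suc.prems)
    show "\<forall>y. norm (fibre_mean (\<lambda>z. F z * cnj (F ((R ^^ h) z))) y) \<le> B * B"
      unfolding fibre_mean_def
    proof (intro allI norm_integral_le_bound)
      show "norm (F (x, y) * cnj (F ((R ^^ h) (x, y)))) \<le> B * B" for x y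
        unfolding norm_mult complex_mod_cnj using B(2) by (intro mult_mono B(1)) auto
    qed
    show "\<forall>y. norm (fibre_mean F y * cnj (fibre_mean F ((S ^^ h) y))) \<le> B * B"
      using avgB B(2) by (auto simp: norm_mult intro!: mult_mono)
  qed
  have "(\<lambda>h. a h - b h) \<longlonglongrightarrow> 0"
  proof (rule Lim_null_comparison)
    show "\<forall>\<^sub>F h in sequentially. norm (a h - b h) \<le> C * ?d h" using ab by simp
    show "(\<lambda>h. C * ?d h) \<longlonglongrightarrow> 0"
      using tendsto_mult[OF tendsto_const[of C] correlation_decay[OF Suc.prems]] by simp
  qed
  from cesaro_null[OF this]
  have "(\<lambda>H. (1 / real H) * (\<Sum>h=1..H. a h) - (1 / real H) * (\<Sum>h=1..H. b h)) \<longlonglongrightarrow> 0"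
    by (simp add: sum_subtractf diff_divide_distrib)
  with tendsto_diff[OF alim blim] show ?case
    using LIMSEQ_unique by fastforce
qed

text \<open>For the indicator F of an invariant set, F times its conjugated shift is F itself, and
  its fibre mean a is invariant under S. So the quantity that decays is constant in h: the integral
  of |a - |a|^2| is 0. Hence a is almost everywhere 0 or 1, and ergodicity of S selects one of the
  two values.\<close>

theorem ergodic_prod:
  assumes "ergodic_system N S" shows "ergodic_system P R"
  unfolding ergodic_system_def
proof (intro conjI ballI impI mp_R)
  fix A assume A: "A \<in> sets P" and inv: "R -` A \<inter> space P = A"
  define F where "F = ind A"
  define a where "a = fibre_mean F"
  have Fb: "F \<in> bdd_borel P" unfolding F_def by (rule ind_bdd_borel[OF A])
  have ab: "a \<in> bdd_borel N" unfolding a_def by (rule fibre_mean_bdd_borel[OF Fb])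
  have FR: "F ((R ^^ h) z) = F z" if "z \<in> space P" for z h
    using that
  proof (induction h)
    case (Suc h)
    have "(R ^^ h) z \<in> space P" using measurable_space[OF R.Tn_meas Suc.prems] .
    then have "R ((R ^^ h) z) \<in> A \<longleftrightarrow> (R ^^ h) z \<in> A" using inv by blast
    then show ?case using Suc by (simp add: F_def indicator_def)
  qed simp
  have pairsp: "(x, y) \<in> space P" if "x \<in> space M" "y \<in> space N" for x y
    using that by (simp add: space_pair_measure)
  have aS: "a ((S ^^ h) y) = a y" if "y \<in> space N" for h y
    unfolding a_def fibre_mean_R[OF Fb that, symmetric]
    unfolding fibre_mean_def by (intro Bochner_Integration.integral_cong refl FR pairsp that)
  have acorr: "fibre_mean (\<lambda>z. F z * cnj (F ((R ^^ h) z))) y = a y" if "y \<in> space N" for h y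
    unfolding a_def fibre_mean_def
    by (intro Bochner_Integration.integral_cong refl) (use FR[OF pairsp[OF _ that]] in \<open>simp add: F_def indicator_def\<close>)
  have "(\<integral>y. norm (fibre_mean (\<lambda>z. F z * cnj (F ((R ^^ h) z))) y - fibre_mean F y * cnj (fibre_mean F ((S ^^ h) y))) \<partial>N)
      = (\<integral>y. norm (a y - a y * cnj (a y)) \<partial>N)" for h
    by (intro Bochner_Integration.integral_cong refl) (simp add: acorr aS flip: a_def)
  then have "(\<lambda>h::nat. \<integral>y. norm (a y - a y * cnj (a y)) \<partial>N) \<longlonglongrightarrow> 0"
    using correlation_decay[OF Fb] by simp
  then have "(\<integral>y. norm (a y - a y * cnj (a y)) \<partial>N) = 0" by (simp add: LIMSEQ_const_iff)
  then have "AE y in N. norm (a y - a y * cnj (a y)) = 0"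
    by (subst (asm) integral_nonneg_eq_0_iff_AE) (auto intro!: N.bdd_borel_norm_integrable bdd_borel_diff bdd_borel_mult bdd_borel_cnj ab)
  then have a01: "AE y in N. a y = 0 \<or> a y = 1"
  proof eventually_elim
    case (elim y)
    then have "a y * (1 - cnj (a y)) = 0" by (simp add: algebra_simps)
    then have "a y = 0 \<or> cnj (a y) = 1" by auto
    then show ?case by (metis complex_cnj_cnj complex_cnj_one)
  qed
  have [measurable]: "a \<in> borel_measurable N" using ab by (rule bdd_borel_measurable)
  define Q where "Q = {y \<in> space N. a y = 1}"
  have Qm: "Q \<in> sets N" unfolding Q_def by measurable
  have "S -` Q \<inter> space N = Q"
    using aS[of _ 1] Sn_space[of _ 1] by (auto simp: Q_def)
  then have "N.prob Q = 0 \<or> N.prob Q = 1"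
    using assms Qm by (simp add: ergodic_system_def)
  then obtain c where c: "c = 0 \<or> c = 1" "AE y in N. a y = of_real c"
  proof
    assume "N.prob Q = 0"
    then have "AE y in N. y \<notin> Q" using Qm by (simp add: N.prob_eq_0)
    with a01 have "AE y in N. a y = of_real 0" using AE_space by eventually_elim (auto simp: Q_def)
    then show ?thesis using that[of 0] by blast
  next
    assume "N.prob Q = 1"
    then have "AE y in N. y \<in> Q" using Qm by (simp add: N.prob_eq_1)
    then have "AE y in N. a y = of_real 1" by eventually_elim (auto simp: Q_def)
    then show ?thesis using that[of 1] by blast
  qed
  have "complex_of_real (PR.prob A) = (\<integral>z. F z \<partial>P)"
  proof -
    have "(\<integral>z. F z \<partial>P) = complex_of_real (\<integral>z. indicator A z \<partial>P)"
      unfolding integral_complex_of_real[symmetric] F_def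
      by (rule Bochner_Integration.integral_cong) (auto simp: indicator_def)
    also have "(\<integral>z. indicator A z \<partial>P) = PR.prob A"
      using sets.sets_into_space[OF A] by (simp add: Int_absorb2)
    finally show ?thesis by simp
  qed
  also have "\<dots> = (\<integral>y. a y \<partial>N)" unfolding a_def by (rule integral_fibre_mean[symmetric, OF PR.bdd_borel_integrable[OF Fb]])
  also have "\<dots> = (\<integral>y. of_real c \<partial>N)" by (rule integral_cong_AE[OF _ _ c(2)]) auto
  also have "\<dots> = of_real c" by (simp add: N.prob_space)
  finally show "PR.prob A = 0 \<or> PR.prob A = 1" using c(1) by simp
qed

text \<open>The trivial sigma-algebra on X times \<open>Z\<close>: its members are the cylinders X x
  B with B in \<open>Z\<close>. That X contributes nothing else to the factor is
  \<open>hkz_factor_ZP\<close>.\<close>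

definition ZP :: "'b measure \<Rightarrow> ('a \<times> 'b) measure" where
  "ZP Z = vimage_algebra (space P) snd Z"

lemma space_ZP[simp]: "space (ZP Z) = space P" by (simp add: ZP_def)

lemma snd_ZP: "subalgebra N Z \<Longrightarrow> snd \<in> ZP Z \<rightarrow>\<^sub>M Z"
  unfolding ZP_def by (rule measurable_vimage_algebra1) (auto simp: subalgebra_def space_pair_measure)

lemma sets_ZP: "subalgebra N Z \<Longrightarrow> sets (ZP Z) = {snd -` B \<inter> space P | B. B \<in> sets Z}"
  unfolding ZP_def by (rule sets_vimage_algebra2) (auto simp: subalgebra_def space_pair_measure)

lemma subalgebra_ZP: assumes "subalgebra N Z" shows "subalgebra P (ZP Z)"
  unfolding subalgebra_def
proof (intro conjI subsetI)
  fix A assume "A \<in> sets (ZP Z)"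
  then obtain B where B: "B \<in> sets Z" "A = snd -` B \<inter> space P" using sets_ZP[OF assms] by auto
  then have "B \<in> sets N" using assms by (auto simp: subalgebra_def)
  then show "A \<in> sets P" unfolding B(2) by (rule measurable_sets[OF measurable_snd])
qed simp

lemma sfs_N: "subalgebra N Z \<Longrightarrow> sigma_finite_subalgebra N Z"
  by (intro finite_measure_subalgebra_is_sigma_finite)
    (simp add: finite_measure_subalgebra_def finite_measure_subalgebra_axioms_def N.finite_measure_axioms)

lemma sfs_ZP: "subalgebra N Z \<Longrightarrow> sigma_finite_subalgebra P (ZP Z)"
  by (intro finite_measure_subalgebra_is_sigma_finite)
    (simp add: finite_measure_subalgebra_def finite_measure_subalgebra_axioms_def PR.finite_measure_axioms subalgebra_ZP)

text \<open>The members of \<open>ZP Z\<close> are cylinders, so Fubini reduces the defining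
  integrals of the conditional expectation to those on Y.\<close>

lemma real_cond_exp_ZP:
  assumes Z: "subalgebra N Z" and f: "integrable P f"
  shows "AE z in P. real_cond_exp P (ZP Z) f z = real_cond_exp N Z (\<lambda>y. \<integral>x. f (x, y) \<partial>M) (snd z)"
proof -
  interpret ZN: sigma_finite_subalgebra N Z by (rule sfs_N[OF Z])
  interpret ZP: sigma_finite_subalgebra P "ZP Z" by (rule sfs_ZP[OF Z])
  define g where "g y = (\<integral>x. f (x, y) \<partial>M)" for y
  have f': "integrable P (case_prod (\<lambda>x y. f (x, y)))" using f by (simp add: case_prod_beta')
  have gi: "integrable N g" unfolding g_def[abs_def] by (rule PR.integrable_snd[OF f'])
  have ci: "integrable N (real_cond_exp N Z g)" by (rule ZN.real_cond_exp_int(1)[OF gi])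
  have "AE z in P. real_cond_exp P (ZP Z) f z = real_cond_exp N Z g (snd z)"
  proof (rule ZP.real_cond_exp_charact)
    show "integrable P f" by fact
    show "integrable P (\<lambda>z. real_cond_exp N Z g (snd z))"
      using integrable_distr_eq[of snd P N "real_cond_exp N Z g"] ci by (simp add: distr_snd)
    show "(\<lambda>z. real_cond_exp N Z g (snd z)) \<in> borel_measurable (ZP Z)"
      by (rule measurable_compose[OF snd_ZP[OF Z]]) simp
    fix A assume "A \<in> sets (ZP Z)"
    then obtain B where B: "B \<in> sets Z" "A = snd -` B \<inter> space P" using sets_ZP[OF Z] by auto
    have BN[measurable]: "B \<in> sets N" using B(1) Z by (auto simp: subalgebra_def)
    have Am[measurable]: "A \<in> sets P" unfolding B(2) by (rule measurable_sets[OF measurable_snd BN])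
    have iA: "indicator A z = (indicator B (snd z) :: real)" if "z \<in> space P" for z
      using that by (simp add: B(2) indicator_def)
    have fi: "integrable P (\<lambda>z. indicator A z *\<^sub>R f z)" by (rule integrable_mult_indicator[OF Am f])
    have "set_lebesgue_integral P A f = (\<integral>z. indicator A z *\<^sub>R f z \<partial>P)" by (simp add: set_lebesgue_integral_def)
    also have "\<dots> = (\<integral>y. (\<integral>x. indicator A (x, y) *\<^sub>R f (x, y) \<partial>M) \<partial>N)"
      using PR.integral_snd[of "\<lambda>x y. indicator A (x, y) *\<^sub>R f (x, y)"] fi by (simp add: case_prod_beta')
    also have "\<dots> = (\<integral>y. indicator B y *\<^sub>R g y \<partial>N)"
    proof (rule Bochner_Integration.integral_cong[OF refl])
      fix y assume y: "y \<in> space N"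
      have "(\<integral>x. indicator A (x, y) *\<^sub>R f (x, y) \<partial>M) = (\<integral>x. indicator B y *\<^sub>R f (x, y) \<partial>M)"
        by (rule Bochner_Integration.integral_cong) (use y iA in \<open>auto simp: space_pair_measure\<close>)
      then show "(\<integral>x. indicator A (x, y) *\<^sub>R f (x, y) \<partial>M) = indicator B y *\<^sub>R g y" by (simp add: g_def)
    qed
    also have "\<dots> = set_lebesgue_integral N B g" by (simp add: set_lebesgue_integral_def)
    also have "\<dots> = set_lebesgue_integral N B (real_cond_exp N Z g)" by (rule ZN.real_cond_exp_intA[OF gi B(1)])
    also have "\<dots> = (\<integral>y. indicator B y *\<^sub>R real_cond_exp N Z g y \<partial>N)" by (simp add: set_lebesgue_integral_def)
    also have "\<dots> = (\<integral>z. indicator B (snd z) *\<^sub>R real_cond_exp N Z g (snd z) \<partial>P)"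
      by (rule integral_snd_comp[symmetric]) measurable
    also have "\<dots> = set_lebesgue_integral P A (\<lambda>z. real_cond_exp N Z g (snd z))"
      unfolding set_lebesgue_integral_def by (rule Bochner_Integration.integral_cong) (auto simp: iA)
    finally show "set_lebesgue_integral P A f = set_lebesgue_integral P A (\<lambda>z. real_cond_exp N Z g (snd z))" .
  qed
  then show ?thesis by (simp only: g_def[abs_def])
qed

lemma complex_cond_exp_ZP_zero_iff:
  assumes Z: "subalgebra N Z" and G: "integrable P G"
  shows "(AE z in P. complex_cond_exp P (ZP Z) G z = 0) \<longleftrightarrow> (AE y in N. complex_cond_exp N Z (fibre_mean G) y = 0)"
proof -
  interpret ZN: sigma_finite_subalgebra N Z by (rule sfs_N[OF Z])
  have G': "integrable P (case_prod (\<lambda>x y. G (x, y)))" using G by (simp add: case_prod_beta')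
  have Gr: "integrable P (case_prod (\<lambda>x y. Re (G (x, y))))" "integrable P (case_prod (\<lambda>x y. Im (G (x, y))))"
    using G by (simp_all add: case_prod_beta')
  have [measurable]: "G \<in> borel_measurable P" using G by simp
  \<comment> \<open>Sections are integrable for almost every y only, so taking real or imaginary
    parts commutes with the fibre mean only almost everywhere.\<close>
  have sec: "AE y in N. integrable M (\<lambda>x. G (x, y))" by (rule PR.AE_integrable_snd[OF G'])
  have re: "AE y in N. (\<integral>x. Re (G (x, y)) \<partial>M) = Re (fibre_mean G y)"
    using sec by eventually_elim (simp add: fibre_mean_def)
  have im: "AE y in N. (\<integral>x. Im (G (x, y)) \<partial>M) = Im (fibre_mean G y)"
    using sec by eventually_elim (simp add: fibre_mean_def)
  have "AE y in N. real_cond_exp N Z (\<lambda>y. \<integral>x. Re (G (x, y)) \<partial>M) y = real_cond_exp N Z (\<lambda>y. Re (fibre_mean G y)) y"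
    by (rule ZN.real_cond_exp_cong[OF re]) (use PR.integrable_snd[OF Gr(1)] in \<open>auto dest: borel_measurable_integrable\<close>)
  from AE_snd_comp[OF this]
  have 1: "AE z in P. real_cond_exp P (ZP Z) (\<lambda>z. Re (G z)) z = real_cond_exp N Z (\<lambda>y. Re (fibre_mean G y)) (snd z)"
    using real_cond_exp_ZP[OF Z, of "\<lambda>z. Re (G z)"] G by (auto elim!: eventually_elim2)
  have "AE y in N. real_cond_exp N Z (\<lambda>y. \<integral>x. Im (G (x, y)) \<partial>M) y = real_cond_exp N Z (\<lambda>y. Im (fibre_mean G y)) y"
    by (rule ZN.real_cond_exp_cong[OF im]) (use PR.integrable_snd[OF Gr(2)] in \<open>auto dest: borel_measurable_integrable\<close>)
  from AE_snd_comp[OF this]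
  have 2: "AE z in P. real_cond_exp P (ZP Z) (\<lambda>z. Im (G z)) z = real_cond_exp N Z (\<lambda>y. Im (fibre_mean G y)) (snd z)"
    using real_cond_exp_ZP[OF Z, of "\<lambda>z. Im (G z)"] G by (auto elim!: eventually_elim2)
  have eq: "AE z in P. complex_cond_exp P (ZP Z) G z = complex_cond_exp N Z (fibre_mean G) (snd z)"
    using 1 2 by eventually_elim (simp add: complex_cond_exp_def)
  have iff: "complex_cond_exp N Z (fibre_mean G) y = 0 \<longleftrightarrow>
      real_cond_exp N Z (\<lambda>y. Re (fibre_mean G y)) y = 0 \<and> real_cond_exp N Z (\<lambda>y. Im (fibre_mean G y)) y = 0" for y
    by (simp add: complex_cond_exp_def complex_eq_iff)
  have "(AE z in P. complex_cond_exp P (ZP Z) G z = 0) \<longleftrightarrow> (AE z in P. complex_cond_exp N Z (fibre_mean G) (snd z) = 0)"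
    using eq by (auto elim: eventually_elim2)
  also have "\<dots> \<longleftrightarrow> (AE y in distr P N snd. complex_cond_exp N Z (fibre_mean G) y = 0)"
    unfolding iff by (rule AE_distr_iff[symmetric]) measurable
  finally show ?thesis unfolding distr_snd .
qed

text \<open>Both sides of the characterization depend on the fibre mean alone: the conditional
  expectation by \<open>complex_cond_exp_ZP_zero_iff\<close>, the seminorm by
  \<open>hkp_prod\<close>. A truncated version g replaces f because \<open>hkp_prod\<close> speaks
  of \<open>bdd_borel\<close>.\<close>

theorem hkz_factor_ZP:
  assumes k: "k \<ge> 1" and Z: "hkz_factor N S k Z"
  shows "hkz_factor P R k (ZP Z)"
  unfolding hkz_factor_def
proof (intro conjI ballI)
  have sub: "subalgebra N Z" and SZ: "S \<in> Z \<rightarrow>\<^sub>M Z"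
    and iff: "\<And>f. f \<in> L_infinity N \<Longrightarrow> (AE x in N. complex_cond_exp N Z f x = 0) \<longleftrightarrow> hk_seminorm N S (k + 1) f = 0"
    using Z by (auto simp: hkz_factor_def)
  show "subalgebra P (ZP Z)" by (rule subalgebra_ZP[OF sub])
  show "R \<in> ZP Z \<rightarrow>\<^sub>M ZP Z"
    unfolding ZP_def[of Z]
  proof (rule measurable_vimage_algebra2)
    show "R \<in> space (vimage_algebra (space P) snd Z) \<rightarrow> space P"
      using measurable_space[OF R.T_meas] by auto
    have "(\<lambda>z. S (snd z)) \<in> ZP Z \<rightarrow>\<^sub>M Z" by (rule measurable_compose[OF snd_ZP[OF sub] SZ])
    then show "(\<lambda>z. snd (R z)) \<in> vimage_algebra (space P) snd Z \<rightarrow>\<^sub>M Z" by (simp add: ZP_def)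
  qed
  fix f assume "f \<in> L_infinity P"
  then have fm: "f \<in> borel_measurable P" by (simp add: L_infinity_def)
  obtain g where g: "g \<in> bdd_borel P" "AE z in P. f z = g z" using L_infinity_truncate[OF \<open>f \<in> L_infinity P\<close>] by blast
  have gm: "g \<in> borel_measurable P" using g(1) by (rule bdd_borel_measurable)
  have "(AE z in P. complex_cond_exp P (ZP Z) f z = 0) \<longleftrightarrow> (AE z in P. complex_cond_exp P (ZP Z) g z = 0)"
    by (rule complex_cond_exp_zero_cong[OF sfs_ZP[OF sub] fm gm g(2)])
  also have "\<dots> \<longleftrightarrow> (AE y in N. complex_cond_exp N Z (fibre_mean g) y = 0)"
    by (rule complex_cond_exp_ZP_zero_iff[OF sub PR.bdd_borel_integrable[OF g(1)]])
  also have "\<dots> \<longleftrightarrow> hk_seminorm N S (k + 1) (fibre_mean g) = 0"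
    by (rule iff[OF bdd_borel_L_infinity[OF fibre_mean_bdd_borel[OF g(1)]]])
  also have "hk_seminorm N S (k + 1) (fibre_mean g) = hk_seminorm P R (k + 1) g"
    by (simp only: hk_seminorm_def hk_power_eq_hkp hkp_prod[OF g(1)])
  also have "\<dots> = hk_seminorm P R (k + 1) f"
    unfolding hk_seminorm_def hk_power_eq_hkp R.hkp_cong_AE[OF fm gm g(2)] ..
  finally show "(AE z in P. complex_cond_exp P (ZP Z) f z = 0) \<longleftrightarrow> hk_seminorm P R (k + 1) f = 0" .
qed

text \<open>Truncation leads back to bounded functions, with the same budget e / 16 and e / 4 as in
  \<open>approx_limit\<close>. Sections of G are integrable only almost everywhere, hence additivity
  of the fibre mean holds only in that sense.\<close>

lemma centered_L_two_approx:
  assumes G: "G \<in> L_two P" and e: "e > 0"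
  shows "\<exists>i j V. W i j V \<and> (\<integral>z. (norm (centered G z - V z))\<^sup>2 \<partial>P) < e"
proof -
  have e16: "e / 16 > 0" "e / 4 > 0" using e by auto
  obtain H where H: "H \<in> bdd_borel P" "(\<integral>z. (norm (G z - H z))\<^sup>2 \<partial>P) < e / 16"
    using L_two_truncate[OF G e16(1)] by blast
  obtain i j V where V: "W i j V" "(\<integral>z. (norm (centered H z - V z))\<^sup>2 \<partial>P) < e / 4"
    using approxD[OF approx_bdd_borel[OF H(1)] e16(2)] by blast
  define D where "D z = G z - H z" for z
  have D: "D \<in> L_two P" unfolding D_def[abs_def] by (rule L_two_diff[OF G PR.bdd_borel_L_two[OF H(1)]])
  have [measurable]: "G \<in> borel_measurable P" "D \<in> borel_measurable P" "H \<in> borel_measurable P" "V \<in> borel_measurable P"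
    using G D H(1) W_bdd_borel[OF V(1)] by (auto simp: L_two_def bdd_borel_measurable)
  have aD: "fibre_mean D \<in> L_two N"
    unfolding L_two_def using D fibre_mean_square_le(1)[of D] by (simp add: L_two_def)
  have aDs: "(\<lambda>z. - fibre_mean D (snd z)) \<in> L_two P"
    unfolding L_two_def
  proof (intro CollectI conjI)
    show "integrable P (\<lambda>z. (norm (- fibre_mean D (snd z)))\<^sup>2)"
      using integrable_distr_eq[of snd P N "\<lambda>y. (norm (fibre_mean D y))\<^sup>2"] aD by (simp add: distr_snd L_two_def)
  qed measurable
  have CD: "centered D \<in> L_two P"
    using L_two_add[OF D aDs] unfolding centered_def[abs_def] by simp
  have CDle: "(\<integral>z. (norm (centered D z))\<^sup>2 \<partial>P) \<le> 4 * (\<integral>z. (norm (D z))\<^sup>2 \<partial>P)"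
  proof -
    have "(\<integral>z. (norm (centered D z))\<^sup>2 \<partial>P) \<le> 2 * (\<integral>z. (norm (D z))\<^sup>2 \<partial>P) + 2 * (\<integral>z. (norm (- fibre_mean D (snd z)))\<^sup>2 \<partial>P)"
      using L_two_square_add_le[OF D aDs] by (simp add: centered_def)
    also have "(\<integral>z. (norm (- fibre_mean D (snd z)))\<^sup>2 \<partial>P) = (\<integral>y. (norm (fibre_mean D y))\<^sup>2 \<partial>N)"
      using integral_snd_comp[of "\<lambda>y. (norm (fibre_mean D y))\<^sup>2"] by simp
    also have "\<dots> \<le> (\<integral>z. (norm (D z))\<^sup>2 \<partial>P)"
      using D by (intro fibre_mean_square_le) (auto simp: L_two_def)
    finally show ?thesis by simp
  qed
  have eqN: "AE y in N. fibre_mean G y = fibre_mean D y + fibre_mean H y"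
  proof -
    have Gi: "integrable P (case_prod (\<lambda>x y. G (x, y)))"
      using PR.L_two_integrable[OF G] by (simp add: case_prod_beta')
    show ?thesis using PR.AE_integrable_snd[OF Gi] AE_space
    proof eventually_elim
      case (elim y)
      then show ?case using bdd_borel_integrable[OF bdd_borel_section[OF H(1)]] by (simp add: fibre_mean_def D_def)
    qed
  qed
  have "(\<integral>z. (norm (centered G z - V z))\<^sup>2 \<partial>P) = (\<integral>z. (norm (centered D z + (centered H z - V z)))\<^sup>2 \<partial>P)"
  proof (rule integral_cong_AE)
    show "AE z in P. (norm (centered G z - V z))\<^sup>2 = (norm (centered D z + (centered H z - V z)))\<^sup>2"
      using AE_snd_comp[OF eqN]
    proof eventually_elim
      case (elim z)
      then have "centered G z - V z = centered D z + (centered H z - V z)" by (simp add: centered_def D_def)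
      then show ?case by (simp only:)
    qed
  qed (unfold centered_def, measurable)
  also have "\<dots> \<le> 2 * (\<integral>z. (norm (centered D z))\<^sup>2 \<partial>P) + 2 * (\<integral>z. (norm (centered H z - V z))\<^sup>2 \<partial>P)"
    by (intro L_two_square_add_le CD PR.bdd_borel_L_two bdd_borel_diff centered_bdd_borel H(1) W_bdd_borel[OF V(1)])
  also have "\<dots> < e" using CDle H(2) V(2) by (simp add: D_def)
  finally show ?thesis using V(1) by blast
qed

end

section \<open>Wiener-Wintner averages of functions orthogonal to the future\<close>

text \<open>The pairs in the expanded square are grouped by their distance r. Within a group the
  phase is constant and leaves the modulus unchanged, so the bound is free of \<theta>; this is what
  permits a supremum over all frequencies.\<close>

lemma norm_trig_sum_square_le:
  fixes a :: "nat \<Rightarrow> complex"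
  shows "(norm (\<Sum>m=1..n. cis (real m * \<theta>) * a m))\<^sup>2
    \<le> 2 * (\<Sum>r<n. norm (\<Sum>m=1..n - r. a (m + r) * cnj (a m)))"
proof -
  define b where "b m = cis (real m * \<theta>) * a m" for m
  define c where "c r = (\<Sum>m=1..n - r. a (m + r) * cnj (a m))" for r
  let ?f = "\<lambda>(m, m'). b m * cnj (b m')"
  \<comment> \<open>The diagonal belongs to \<open>?A\<close>; the estimate for \<open>?B\<close>
    adds r = 0 merely to reach the same bound.\<close>
  let ?A = "{(m, m'). m \<in> {1..n} \<and> m' \<in> {1..n} \<and> m' \<le> m}"
  let ?B = "{(m, m'). m \<in> {1..n} \<and> m' \<in> {1..n} \<and> m < m'}"
  have fin: "finite ?A" "finite ?B"
    by (rule finite_subset[of _ "{1..n} \<times> {1..n}"]; auto)+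
  have bb: "b (m + r) * cnj (b m) = cis (real r * \<theta>) * (a (m + r) * cnj (a m))" for m r
  proof -
    have "cis (real (m + r) * \<theta>) * cnj (cis (real m * \<theta>)) = cis (real r * \<theta>)"
      by (simp add: cis_cnj cis_mult algebra_simps)
    moreover have "b (m + r) * cnj (b m) = (cis (real (m + r) * \<theta>) * cnj (cis (real m * \<theta>))) * (a (m + r) * cnj (a m))"
      unfolding b_def complex_cnj_mult by (simp only: mult_ac)
    ultimately show ?thesis by simp
  qed
  have A: "norm (\<Sum>p\<in>?A. ?f p) \<le> (\<Sum>r<n. norm (c r))"
  proof -
    have "(\<Sum>p\<in>?A. ?f p) = (\<Sum>(r, m)\<in>Sigma {..<n} (\<lambda>r. {1..n - r}). b (m + r) * cnj (b m))"
      by (rule sum.reindex_bij_witness[of _ "\<lambda>(r, m). (m + r, m)" "\<lambda>(m, m'). (m - m', m')"]) auto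
    also have "\<dots> = (\<Sum>r<n. \<Sum>m=1..n - r. b (m + r) * cnj (b m))"
      by (rule sum.Sigma[symmetric]) auto
    also have "\<dots> = (\<Sum>r<n. cis (real r * \<theta>) * c r)"
      by (simp add: bb c_def sum_distrib_left)
    finally show ?thesis by (simp add: norm_mult order_trans[OF norm_sum])
  qed
  have B: "norm (\<Sum>p\<in>?B. ?f p) \<le> (\<Sum>r<n. norm (c r))"
  proof -
    have "(\<Sum>p\<in>?B. ?f p) = (\<Sum>(r, m)\<in>Sigma {1..<n} (\<lambda>r. {1..n - r}). b m * cnj (b (m + r)))"
      by (rule sum.reindex_bij_witness[of _ "\<lambda>(r, m). (m, m + r)" "\<lambda>(m, m'). (m' - m, m)"]) auto
    also have "\<dots> = (\<Sum>r=1..<n. \<Sum>m=1..n - r. b m * cnj (b (m + r)))"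
      by (rule sum.Sigma[symmetric]) auto
    also have "\<dots> = (\<Sum>r=1..<n. cnj (cis (real r * \<theta>) * c r))"
    proof (rule sum.cong[OF refl])
      fix r
      have "(\<Sum>m=1..n - r. b m * cnj (b (m + r))) = cnj (\<Sum>m=1..n - r. b (m + r) * cnj (b m))"
        by (simp add: cnj_sum mult.commute)
      also have "(\<Sum>m=1..n - r. b (m + r) * cnj (b m)) = cis (real r * \<theta>) * c r"
        by (simp add: bb c_def sum_distrib_left)
      finally show "(\<Sum>m=1..n - r. b m * cnj (b (m + r))) = cnj (cis (real r * \<theta>) * c r)" .
    qed
    finally have "norm (\<Sum>p\<in>?B. ?f p) \<le> (\<Sum>r=1..<n. norm (cnj (cis (real r * \<theta>) * c r)))"
      by (simp only: norm_sum)
    also have "\<dots> = (\<Sum>r=1..<n. norm (c r))" unfolding complex_mod_cnj by (simp add: norm_mult)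
    also have "\<dots> \<le> (\<Sum>r<n. norm (c r))" by (rule sum_mono2) auto
    finally show ?thesis .
  qed
  let ?S = "\<Sum>m=1..n. b m"
  have "complex_of_real ((norm ?S)\<^sup>2) = ?S * cnj ?S" by (rule complex_norm_square)
  also have "\<dots> = (\<Sum>p\<in>{1..n} \<times> {1..n}. ?f p)"
    by (simp add: cnj_sum sum_product sum.cartesian_product)
  also have "{1..n} \<times> {1..n} = ?A \<union> ?B" by auto
  also have "(\<Sum>p\<in>?A \<union> ?B. ?f p) = (\<Sum>p\<in>?A. ?f p) + (\<Sum>p\<in>?B. ?f p)"
    using fin by (intro sum.union_disjoint) auto
  finally have "norm (complex_of_real ((norm ?S)\<^sup>2)) \<le> (\<Sum>r<n. norm (c r)) + (\<Sum>r<n. norm (c r))"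
    using A B norm_triangle_le by (metis (no_types, lifting) add_mono)
  then show ?thesis by (simp add: norm_power b_def c_def)
qed

section \<open>Elementary properties of the Wiener-Wintner supremum\<close>

lemma ww_term_bdd_above:
  "bdd_above (range (\<lambda>t::real. norm ((1 / of_nat n) * (\<Sum>m=1..n. cis (2 * pi * real m * t) * F ((T ^^ m) x)) :: complex)))"
proof (rule bdd_aboveI2)
  fix t :: real
  have "norm ((1 / of_nat n) * (\<Sum>m=1..n. cis (2 * pi * real m * t) * F ((T ^^ m) x)) :: complex)
     = (1 / real n) * norm (\<Sum>m=1..n. cis (2 * pi * real m * t) * F ((T ^^ m) x))"
    by (simp add: norm_mult norm_divide)
  also have "\<dots> \<le> (1 / real n) * (\<Sum>m=1..n. norm (cis (2 * pi * real m * t) * F ((T ^^ m) x)))"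
    by (intro mult_left_mono norm_sum) simp
  also have "\<dots> = (1 / real n) * (\<Sum>m=1..n. norm (F ((T ^^ m) x)))" by (simp add: norm_mult)
  finally show "norm ((1 / of_nat n) * (\<Sum>m=1..n. cis (2 * pi * real m * t) * F ((T ^^ m) x)) :: complex)
    \<le> (1 / real n) * (\<Sum>m=1..n. norm (F ((T ^^ m) x)))" .
qed

lemma ww_sup_upper:
  "norm ((1 / of_nat n) * (\<Sum>m=1..n. cis (2 * pi * real m * t) * F ((T ^^ m) x))) \<le> ww_sup T n F x"
  unfolding ww_sup_def by (rule cSUP_upper[OF UNIV_I ww_term_bdd_above])

lemma ww_sup_least:
  "(\<And>t. norm ((1 / of_nat n) * (\<Sum>m=1..n. cis (2 * pi * real m * t) * F ((T ^^ m) x))) \<le> c) \<Longrightarrow> ww_sup T n F x \<le> c"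
  unfolding ww_sup_def by (rule cSUP_least) auto

lemma ww_sup_nonneg: "0 \<le> ww_sup T n F x"
  by (rule order_trans[OF norm_ge_zero ww_sup_upper])

lemma ww_sup_add_le: "ww_sup T n (\<lambda>x. F x + G x) x \<le> ww_sup T n F x + ww_sup T n G x"
proof (rule ww_sup_least)
  fix t
  let ?s = "\<lambda>F. (1 / of_nat n) * (\<Sum>m=1..n. cis (2 * pi * real m * t) * F ((T ^^ m) x)) :: complex"
  have "?s (\<lambda>x. F x + G x) = ?s F + ?s G" by (simp add: distrib_left sum.distrib)
  then have "norm (?s (\<lambda>x. F x + G x)) \<le> norm (?s F) + norm (?s G)" by (simp only: norm_triangle_ineq)
  also have "\<dots> \<le> ww_sup T n F x + ww_sup T n G x" by (intro add_mono ww_sup_upper)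
  finally show "norm (?s (\<lambda>x. F x + G x)) \<le> ww_sup T n F x + ww_sup T n G x" .
qed

lemma ww_sup_zero: "ww_sup T n (\<lambda>_. 0) x = 0"
  by (simp add: ww_sup_def)

lemma ww_sup_sum_le: "finite I \<Longrightarrow> ww_sup T n (\<lambda>x. \<Sum>i\<in>I. F i x) x \<le> (\<Sum>i\<in>I. ww_sup T n (F i) x)"
proof (induction I rule: finite_induct)
  case (insert i I)
  then show ?case using ww_sup_add_le[of T n "F i" "\<lambda>x. \<Sum>i\<in>I. F i x" x] by simp
qed (simp add: ww_sup_zero)

lemma ww_sup_le_bound:
  assumes "\<And>x. norm (F x) \<le> B" "B \<ge> 0" shows "ww_sup T n F x \<le> B"
proof (rule ww_sup_least)
  fix t
  have "norm ((1 / of_nat n) * (\<Sum>m=1..n. cis (2 * pi * real m * t) * F ((T ^^ m) x)) :: complex)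
     = (1 / real n) * norm (\<Sum>m=1..n. cis (2 * pi * real m * t) * F ((T ^^ m) x))"
    by (simp add: norm_mult norm_divide)
  also have "\<dots> \<le> (1 / real n) * (\<Sum>m=1..n. B)"
    using assms by (intro mult_left_mono sum_norm_le) (auto simp: norm_mult)
  also have "\<dots> \<le> B" using assms by simp
  finally show "norm ((1 / of_nat n) * (\<Sum>m=1..n. cis (2 * pi * real m * t) * F ((T ^^ m) x)) :: complex) \<le> B" .
qed

text \<open>The averages are continuous in t, so the supremum over the rationals is the
  same.\<close>

lemma (in measure_preserving) ww_sup_measurable[measurable]:
  assumes [measurable]: "F \<in> borel_measurable M"
  shows "ww_sup T n F \<in> borel_measurable M"
proof -
  let ?g = "\<lambda>t x. norm ((1 / of_nat n) * (\<Sum>m=1..n. cis (2 * pi * real m * t) * F ((T ^^ m) x)) :: complex)"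
  have "ww_sup T n F x = (SUP t\<in>\<rat>. ?g t x)" for x
  proof (rule antisym)
    have bdd: "bdd_above ((\<lambda>t. ?g t x) ` \<rat>)"
      using ww_term_bdd_above by (rule bdd_above_mono) auto
    have cl: "closed {t. ?g t x \<le> (SUP t\<in>\<rat>. ?g t x)}"
      unfolding cis_conv_exp by (intro closed_Collect_le continuous_intros)
    have "\<rat> \<subseteq> {t. ?g t x \<le> (SUP t\<in>\<rat>. ?g t x)}" using bdd by (auto intro: cSUP_upper)
    then have "closure \<rat> \<subseteq> {t. ?g t x \<le> (SUP t\<in>\<rat>. ?g t x)}" using cl by (rule closure_minimal)
    then have "?g t x \<le> (SUP t\<in>\<rat>. ?g t x)" for t unfolding Rats_closure_real by blast
    then show "ww_sup T n F x \<le> (SUP t\<in>\<rat>. ?g t x)" by (rule ww_sup_least)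
    have "(0::real) \<in> \<rat>" by simp
    then show "(SUP t\<in>\<rat>. ?g t x) \<le> ww_sup T n F x" by (intro cSUP_least ww_sup_upper) auto
  qed
  then have eq: "ww_sup T n F = (\<lambda>x. SUP t\<in>\<rat>. ?g t x)" by (simp add: fun_eq_iff)
  show ?thesis unfolding eq
  proof (rule borel_measurable_cSUP)
    show "bdd_above ((\<lambda>t. ?g t x) ` \<rat>)" for x
      using ww_term_bdd_above by (rule bdd_above_mono) auto
  qed (auto simp: countable_rat)
qed

context kolmogorov_filtration
begin

lemma kmd_cnj: assumes f: "kmd i j f" shows "kmd i j (\<lambda>x. cnj (f x))"
  unfolding kmd_def
proof (intro conjI ballI)
  show "(\<lambda>x. cnj (f x)) \<in> bdd_borel (FF i)" using f by (auto simp: kmd_def intro: bdd_borel_cnj)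
  fix G assume G: "G \<in> bdd_borel (FF j)"
  have "(\<integral>x. cnj (f x) * G x \<partial>M) = cnj (\<integral>x. f x * cnj (G x) \<partial>M)"
    unfolding Bochner_Integration.integral_cnj[symmetric] by simp
  then show "(\<integral>x. cnj (f x) * G x \<partial>M) = 0" using kmd_integral_mult[OF f bdd_borel_cnj[OF G]] by simp
qed

end

section \<open>Second moments of Wiener-Wintner averages\<close>

context kolmogorov_product
begin

text \<open>With index j, these are the factors that a function of type \<open>W i j\<close>
  tolerates without losing its orthogonality.\<close>

definition adapted :: "int \<Rightarrow> ('a \<times> 'b \<Rightarrow> complex) \<Rightarrow> bool" where
  "adapted i G \<longleftrightarrow> G \<in> bdd_borel P \<and> (\<forall>y\<in>space N. (\<lambda>x. G (x, y)) \<in> bdd_borel (FF i))"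

lemma adapted_mono: "adapted j G \<Longrightarrow> i \<le> j \<Longrightarrow> adapted i G"
  unfolding adapted_def using bdd_borel_FF_mono by blast

lemma W_adapted: "W i j V \<Longrightarrow> adapted i V" by (auto simp: W_def adapted_def kmd_def)

lemma adapted_mult: "adapted i G \<Longrightarrow> adapted i H \<Longrightarrow> adapted i (\<lambda>z. G z * H z)"
  unfolding adapted_def by (auto intro: bdd_borel_mult)

lemma adapted_add: "adapted i G \<Longrightarrow> adapted i H \<Longrightarrow> adapted i (\<lambda>z. G z + H z)"
  unfolding adapted_def by (auto intro: bdd_borel_add)

lemma adapted_cnj: "adapted i G \<Longrightarrow> adapted i (\<lambda>z. cnj (G z))"
  unfolding adapted_def by (auto intro: bdd_borel_cnj)

lemma adapted_snd: "u \<in> bdd_borel N \<Longrightarrow> adapted i (\<lambda>z. u (snd z))"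
  unfolding adapted_def by (auto intro: bdd_borel_const bdd_borel_comp)

lemma W_adapted_mult: "W i j V \<Longrightarrow> i \<le> j \<Longrightarrow> adapted j G \<Longrightarrow> W i j (\<lambda>z. V z * G z)"
  by (rule W_mult) (auto simp: adapted_def)

lemma W_cnj: "W i j V \<Longrightarrow> W i j (\<lambda>z. cnj (V z))"
  unfolding W_def by (auto intro: bdd_borel_cnj kmd_cnj)

lemma integral_W: "W i j V \<Longrightarrow> (\<integral>z. V z \<partial>P) = 0"
proof -
  assume V: "W i j V"
  have "(\<integral>z. V z \<partial>P) = (\<integral>y. fibre_mean V y \<partial>N)"
    by (rule integral_fibre_mean[symmetric, OF PR.bdd_borel_integrable[OF W_bdd_borel[OF V]]])
  also have "\<dots> = (\<integral>y. 0 \<partial>N)"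
    by (intro Bochner_Integration.integral_cong refl fibre_mean_W[OF V])
  finally show ?thesis by simp
qed

lemma W_R_adapted: "W i j V \<Longrightarrow> adapted (i + int m) (\<lambda>z. V ((R ^^ m) z))"
  by (rule W_adapted[OF W_R])

text \<open>The earliest factor sits at time m, the others at m + r, m' and m' + r, all at least m +
  L. Together the latter form a test function for the former.\<close>

lemma W_autocorrelation_orth:
  assumes V: "W i (i + int L) V" and r: "L \<le> r" and mm: "m + L \<le> m'"
  shows "(\<integral>z. V ((R ^^ m) z) * (cnj (V ((R ^^ (m + r)) z)) * (V ((R ^^ (m' + r)) z) * cnj (V ((R ^^ m') z)))) \<partial>P) = 0"
proof (rule integral_W)
  have a: "adapted (i + int L + int m) (\<lambda>z. V ((R ^^ q) z))" if "m + L \<le> q" for q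
    using that by (intro adapted_mono[OF W_R_adapted[OF V]]) auto
  show "W (i + int m) (i + int L + int m)
     (\<lambda>z. V ((R ^^ m) z) * (cnj (V ((R ^^ (m + r)) z)) * (V ((R ^^ (m' + r)) z) * cnj (V ((R ^^ m') z)))))"
    by (intro W_adapted_mult W_R V adapted_mult adapted_cnj a) (use r mm in auto)
qed

text \<open>In the expanded square only pairs with |m - m'| < L survive, at most 2 L in each row and
  each at most B^4. The hypothesis L \<le> r separates the two factors within one
  correlation.\<close>

lemma W_autocorrelation_square_le:
  assumes V: "W i (i + int L) V" and B: "\<And>z. norm (V z) \<le> B" and r: "L \<le> r"
  shows "(\<integral>z. (norm (\<Sum>m=1..K. V ((R ^^ (m + r)) z) * cnj (V ((R ^^ m) z))))\<^sup>2 \<partial>P) \<le> real K * (2 * real L * B ^ 4)"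
proof -
  have B0: "B \<ge> 0" using B[of undefined] norm_ge_zero order_trans by blast
  have Vb: "V \<in> bdd_borel P" by (rule W_bdd_borel[OF V])
  define a where "a m z = V ((R ^^ m) z)" for m z
  have ab: "a m \<in> bdd_borel P" for m unfolding a_def[abs_def] by (rule bdd_borel_R[OF Vb])
  let ?c = "\<lambda>z. \<Sum>m=1..K. a (m + r) z * cnj (a m z)"
  let ?f = "\<lambda>m m' z. (a (m + r) z * cnj (a m z)) * (cnj (a (m' + r) z) * a m' z)"
  have fb: "?f m m' \<in> bdd_borel P" for m m' by (intro bdd_borel_mult bdd_borel_cnj ab)
  have bound: "norm (\<integral>z. ?f m m' z \<partial>P) \<le> (if m < m' + L \<and> m' < m + L then B ^ 4 else 0)" for m m'
  proof -
    consider "m < m' + L \<and> m' < m + L" | "m + L \<le> m'" | "m' + L \<le> m" by linarith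
    then show ?thesis
    proof cases
      case 1
      have "norm (\<integral>z. ?f m m' z \<partial>P) \<le> B ^ 4"
      proof (rule PR.norm_integral_le_bound)
        fix z
        have "norm (?f m m' z) \<le> (B * B) * (B * B)"
          unfolding norm_mult complex_mod_cnj a_def using B0 by (intro mult_mono B) auto
        then show "norm (?f m m' z) \<le> B ^ 4" by (simp add: power4_eq_xxxx mult.assoc)
      qed
      then show ?thesis using 1 by simp
    next
      case 2
      \<comment> \<open>Conjugating the integral frees the earliest factor of its
        \<open>cnj\<close>, which gives the form of \<open>W_autocorrelation_orth\<close>.\<close>
      have "(\<integral>z. ?f m m' z \<partial>P) = cnj (\<integral>z. a m z * (cnj (a (m + r) z) * (a (m' + r) z * cnj (a m' z))) \<partial>P)"
        unfolding Bochner_Integration.integral_cnj[symmetric]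
        by (rule Bochner_Integration.integral_cong) (auto simp: mult_ac)
      then have "(\<integral>z. ?f m m' z \<partial>P) = 0"
        using W_autocorrelation_orth[OF V r 2] unfolding a_def by (simp only: complex_cnj_zero)
      then show ?thesis using B0 by simp
    next
      case 3
      have "(\<integral>z. ?f m m' z \<partial>P) = (\<integral>z. a m' z * (cnj (a (m' + r) z) * (a (m + r) z * cnj (a m z))) \<partial>P)"
        by (rule Bochner_Integration.integral_cong) (auto simp: mult_ac)
      then have "(\<integral>z. ?f m m' z \<partial>P) = 0"
        using W_autocorrelation_orth[OF V r 3] unfolding a_def by (simp only:)
      then show ?thesis using B0 by simp
    qed
  qed
  have "complex_of_real (\<integral>z. (norm (?c z))\<^sup>2 \<partial>P) = (\<integral>z. (\<Sum>m=1..K. \<Sum>m'=1..K. ?f m m' z) \<partial>P)"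
    unfolding integral_complex_of_real[symmetric] complex_norm_square
    by (rule Bochner_Integration.integral_cong) (auto simp: cnj_sum sum_product)
  also have "\<dots> = (\<Sum>m=1..K. \<Sum>m'=1..K. \<integral>z. ?f m m' z \<partial>P)"
    by (rule PR.bdd_borel_integral_sum2[OF fb])
  finally have "norm (complex_of_real (\<integral>z. (norm (?c z))\<^sup>2 \<partial>P)) = norm (\<Sum>m=1..K. \<Sum>m'=1..K. \<integral>z. ?f m m' z \<partial>P)"
    by (rule arg_cong)
  then have "\<bar>\<integral>z. (norm (?c z))\<^sup>2 \<partial>P\<bar> = norm (\<Sum>m=1..K. \<Sum>m'=1..K. \<integral>z. ?f m m' z \<partial>P)"
    by (simp only: norm_of_real)
  also have "\<dots> \<le> (\<Sum>m=1..K. \<Sum>m'=1..K. if m < m' + L \<and> m' < m + L then B ^ 4 else 0)"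
    by (intro sum_norm_le bound)
  also have "\<dots> \<le> (\<Sum>m=1..K. 2 * real L * B ^ 4)"
  proof (rule sum_mono)
    fix m
    have "(\<Sum>m'=1..K. if m < m' + L \<and> m' < m + L then B ^ 4 else 0)
      = real (card {m'\<in>{1..K}. m < m' + L \<and> m' < m + L}) * B ^ 4"
      by (simp add: sum.If_cases Int_def)
    also have "\<dots> \<le> real (card {m + 1 - L..<m + L}) * B ^ 4"
      using B0 by (intro mult_right_mono of_nat_mono card_mono) auto
    also have "\<dots> \<le> 2 * real L * B ^ 4" using B0 by (intro mult_right_mono) auto
    finally show "(\<Sum>m'=1..K. if m < m' + L \<and> m' < m + L then B ^ 4 else 0) \<le> 2 * real L * B ^ 4" .
  qed
  also have "\<dots> = real K * (2 * real L * B ^ 4)" by simp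
  finally show ?thesis unfolding a_def by linarith
qed

text \<open>Autocorrelations at distance r < L carry no cancellation and are bounded trivially;
  there are at most L of them, so they contribute O(1 / n). Those with r \<ge> L have L^1 norm at
  most \<open>sqrt (2 * real L * real n) * B\<^sup>2\<close> and determine the rate
  n^(-1/2).\<close>

lemma ww_sup_W_square_le:
  assumes V: "W i (i + int L) V" and B: "\<And>z. norm (V z) \<le> B" and n: "n \<ge> 1"
  shows "(\<integral>z. (ww_sup R n V z)\<^sup>2 \<partial>P) \<le> 6 * (real L + 1) * B\<^sup>2 / sqrt (real n)"
proof -
  have B0: "B \<ge> 0" using B[of undefined] norm_ge_zero order_trans by blast
  have Vb: "V \<in> bdd_borel P" by (rule W_bdd_borel[OF V])
  note [measurable] = bdd_borel_measurable[OF Vb]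
  let ?c = "\<lambda>r z. \<Sum>m=1..n - r. V ((R ^^ (m + r)) z) * cnj (V ((R ^^ m) z))"
  have cb: "?c r \<in> bdd_borel P" for r by (intro bdd_borel_sum bdd_borel_mult bdd_borel_cnj bdd_borel_R Vb)
  have pw: "(ww_sup R n V z)\<^sup>2 \<le> (2 / (real n)\<^sup>2) * (\<Sum>r<n. norm (?c r z))" for z
  proof -
    let ?X = "(2 / (real n)\<^sup>2) * (\<Sum>r<n. norm (?c r z))"
    have X0: "?X \<ge> 0" by (intro mult_nonneg_nonneg sum_nonneg) auto
    have "ww_sup R n V z \<le> sqrt ?X"
    proof (rule ww_sup_least)
      fix t
      have "(norm ((1 / of_nat n) * (\<Sum>m=1..n. cis (2 * pi * real m * t) * V ((R ^^ m) z)) :: complex))\<^sup>2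
        = (1 / (real n)\<^sup>2) * (norm (\<Sum>m=1..n. cis (real m * (2 * pi * t)) * V ((R ^^ m) z)))\<^sup>2"
        by (simp add: norm_mult norm_divide power_mult_distrib power_divide mult_ac)
      also have "\<dots> \<le> (1 / (real n)\<^sup>2) * (2 * (\<Sum>r<n. norm (?c r z)))"
        by (intro mult_left_mono norm_trig_sum_square_le) simp
      finally show "norm ((1 / of_nat n) * (\<Sum>m=1..n. cis (2 * pi * real m * t) * V ((R ^^ m) z)) :: complex) \<le> sqrt ?X"
        by (intro real_le_rsqrt) simp
    qed
    then have "(ww_sup R n V z)\<^sup>2 \<le> (sqrt ?X)\<^sup>2" by (intro power_mono ww_sup_nonneg)
    then show ?thesis using X0 by simp
  qed
  have ci: "integrable P (\<lambda>z. norm (?c r z))" for r by (rule PR.bdd_borel_norm_integrable[OF cb])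
  have wi: "integrable P (\<lambda>z. (ww_sup R n V z)\<^sup>2)"
    by (rule PR.integrable_const_bound[where B="B\<^sup>2"])
      (auto intro!: power_mono ww_sup_nonneg ww_sup_le_bound B B0)
  have "(\<integral>z. (ww_sup R n V z)\<^sup>2 \<partial>P) \<le> (\<integral>z. (2 / (real n)\<^sup>2) * (\<Sum>r<n. norm (?c r z)) \<partial>P)"
    using wi ci by (intro integral_mono pw) auto
  also have "\<dots> = (2 / (real n)\<^sup>2) * (\<Sum>r<n. \<integral>z. norm (?c r z) \<partial>P)"
    using ci by simp
  also have "\<dots> \<le> (2 / (real n)\<^sup>2) * (\<Sum>r<n. (if r < L then real n * B\<^sup>2 else 0) + sqrt (2 * real L * real n) * B\<^sup>2)"
  proof (intro mult_left_mono sum_mono)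
    fix r assume r: "r \<in> {..<n}"
    show "(\<integral>z. norm (?c r z) \<partial>P) \<le> (if r < L then real n * B\<^sup>2 else 0) + sqrt (2 * real L * real n) * B\<^sup>2"
    proof (cases "r < L")
      case True
      have "norm (?c r z) \<le> real n * B\<^sup>2" for z
      proof -
        have "norm (?c r z) \<le> (\<Sum>m=1..n - r. B * B)"
        proof (rule sum_norm_le)
          fix m
          show "norm (V ((R ^^ (m + r)) z) * cnj (V ((R ^^ m) z))) \<le> B * B"
            unfolding norm_mult complex_mod_cnj using B0 by (intro mult_mono B) auto
        qed
        also have "\<dots> \<le> real n * B\<^sup>2" by (simp add: power2_eq_square mult_right_mono)
        finally show ?thesis .
      qed
      then have "(\<integral>z. norm (?c r z) \<partial>P) \<le> (\<integral>z. real n * B\<^sup>2 \<partial>P)"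
        using ci by (intro integral_mono) auto
      then show ?thesis using True B0 by (simp add: PR.prob_space add_increasing2)
    next
      case False
      have "(\<integral>z. norm (?c r z) \<partial>P)\<^sup>2 \<le> (\<integral>z. (norm (?c r z))\<^sup>2 \<partial>P)"
      proof -
        have "norm (\<integral>z. complex_of_real (norm (?c r z)) \<partial>P) = (\<integral>z. norm (?c r z) \<partial>P)"
          unfolding integral_complex_of_real norm_of_real by simp
        then show ?thesis
          using PR.norm_integral_square_le[of "\<lambda>z. complex_of_real (norm (?c r z))"]
            PR.bdd_borel_square_integrable[OF cb, of r] ci[of r] by simp
      qed
      also have "\<dots> \<le> real (n - r) * (2 * real L * B ^ 4)"
        by (rule W_autocorrelation_square_le[OF V B]) (use False in simp)
      also have "\<dots> \<le> real n * (2 * real L * B ^ 4)"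
        using B0 by (intro mult_right_mono) auto
      also have "\<dots> = (sqrt (2 * real L * real n) * B\<^sup>2)\<^sup>2"
        by (simp add: power_mult_distrib real_sqrt_pow2)
      finally have "(\<integral>z. norm (?c r z) \<partial>P) \<le> sqrt (2 * real L * real n) * B\<^sup>2"
        by (rule power2_le_imp_le) simp
      then show ?thesis using False by simp
    qed
  qed simp
  also have "(\<Sum>r<n. (if r < L then real n * B\<^sup>2 else 0) + sqrt (2 * real L * real n) * B\<^sup>2)
     = real (card {r. r < n \<and> r < L}) * (real n * B\<^sup>2) + real n * (sqrt (2 * real L * real n) * B\<^sup>2)"
    by (simp add: sum.distrib sum.If_cases Int_def)
  also have "(2 / (real n)\<^sup>2) * \<dots> \<le> (2 / (real n)\<^sup>2) * (real n * B\<^sup>2 * sqrt (real n) * (3 * (real L + 1)))"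
  proof (rule mult_left_mono)
    have c: "card {r. r < n \<and> r < L} \<le> L"
      using card_mono[of "{..<L}" "{r. r < n \<and> r < L}"] by auto
    have s1: "1 \<le> sqrt (real n)" using n by simp
    define t where "t = real n * B\<^sup>2 * sqrt (real n)"
    have t0: "0 \<le> t" by (simp add: t_def)
    have "real (card {r. r < n \<and> r < L}) * (real n * B\<^sup>2) \<le> real L * t"
      unfolding t_def by (rule mult_mono) (use c mult_left_mono[OF s1, of "real n * B\<^sup>2"] in auto)
    moreover have "real n * (sqrt (2 * real L * real n) * B\<^sup>2) \<le> 2 * (real L * t) + t"
    proof -
      \<comment> \<open>Crude, but it makes the constant linear in L and covers L = 0.\<close>
      have "sqrt (2 * real L) \<le> 2 * real L + 1"
        by (rule real_le_lsqrt) (auto simp: power2_eq_square algebra_simps)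
      then have "sqrt (2 * real L * real n) \<le> (2 * real L + 1) * sqrt (real n)"
        by (simp add: real_sqrt_mult mult_right_mono)
      then have "real n * (sqrt (2 * real L * real n) * B\<^sup>2) \<le> real n * ((2 * real L + 1) * sqrt (real n) * B\<^sup>2)"
        by (intro mult_left_mono mult_right_mono) auto
      also have "\<dots> = 2 * (real L * t) + t" by (simp add: t_def algebra_simps)
      finally show ?thesis .
    qed
    ultimately have "real (card {r. r < n \<and> r < L}) * (real n * B\<^sup>2) + real n * (sqrt (2 * real L * real n) * B\<^sup>2)
      \<le> 3 * (real L * t) + 3 * t" using t0 by linarith
    also have "\<dots> = real n * B\<^sup>2 * sqrt (real n) * (3 * (real L + 1))" by (simp add: t_def algebra_simps)
    finally show "real (card {r. r < n \<and> r < L}) * (real n * B\<^sup>2) + real n * (sqrt (2 * real L * real n) * B\<^sup>2)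
       \<le> real n * B\<^sup>2 * sqrt (real n) * (3 * (real L + 1))" .
  qed simp
  also have "\<dots> = 6 * (real L + 1) * B\<^sup>2 / sqrt (real n)"
  proof -
    have "sqrt (real n) * sqrt (real n) = real n" by simp
    then have "(2 / (real n)\<^sup>2) * (real n * B\<^sup>2 * sqrt (real n) * (3 * (real L + 1)))
      = 6 * (real L + 1) * B\<^sup>2 * (sqrt (real n) / real n)"
      using n by (simp add: power2_eq_square field_simps)
    also have "sqrt (real n) / real n = 1 / sqrt (real n)" using n by (simp add: real_div_sqrt field_simps)
    finally show ?thesis by simp
  qed
  finally show ?thesis .
qed

text \<open>
  Telescoping with the factors ordered by \<open>\<tau>\<close>: \<open>V \<eta>\<close> is \<open>v \<eta>\<close> times functions on \<open>Y\<close> for the earlier factors and times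
  the full factors \<open>u + v\<close> at later times, which are measurable for the sigma-algebra to which \<open>v \<eta>\<close> is orthogonal.
\<close>

lemma prod_perturbation:
  fixes \<tau> :: "'i \<Rightarrow> nat"
  assumes I: "finite I"
    and sep: "\<And>\<eta> \<eta>'. \<eta> \<in> I \<Longrightarrow> \<eta>' \<in> I \<Longrightarrow> \<eta> \<noteq> \<eta>' \<Longrightarrow> \<tau> \<eta> + L \<le> \<tau> \<eta>' \<or> \<tau> \<eta>' + L \<le> \<tau> \<eta>"
    and u: "\<And>\<eta>. \<eta> \<in> I \<Longrightarrow> u \<eta> \<in> bdd_borel N" "\<And>\<eta> y. \<eta> \<in> I \<Longrightarrow> norm (u \<eta> y) \<le> B"
    and v: "\<And>\<eta>. \<eta> \<in> I \<Longrightarrow> W (i + int (\<tau> \<eta>)) (i + int (\<tau> \<eta>) + int L) (v \<eta>)"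
      "\<And>\<eta> z. \<eta> \<in> I \<Longrightarrow> norm (v \<eta> z) \<le> B"
    and B: "B \<ge> 1"
  shows "\<exists>V. (\<forall>\<eta>\<in>I. W (i + int (\<tau> \<eta>)) (i + int (\<tau> \<eta>) + int L) (V \<eta>) \<and> (\<forall>z. norm (V \<eta> z) \<le> (2 * B) ^ card I))
    \<and> (\<forall>z. (\<Prod>\<eta>\<in>I. u \<eta> (snd z) + v \<eta> z) = (\<Prod>\<eta>\<in>I. u \<eta> (snd z)) + (\<Sum>\<eta>\<in>I. V \<eta> z))"
  using I sep u v
\<comment> \<open>The rule inserts an index \<open>a\<close> with maximal \<tau>. The new factor is
  therefore the latest and may be multiplied onto each older \<open>V \<eta>\<close>, while the new
  term carries only functions on Y from the earlier times.\<close>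
proof (induction I rule: finite_ranking_induct[where f=\<tau>])
  case empty
  then show ?case by auto
next
  case (insert a J)
  show ?case
  proof (cases "a \<in> J")
    case True
    then have "insert a J = J" by auto
    then show ?thesis using insert.IH insert.prems by simp
  next
    case False
    note p = insert.prems
    have ex: "\<exists>V. (\<forall>\<eta>\<in>J. W (i + int (\<tau> \<eta>)) (i + int (\<tau> \<eta>) + int L) (V \<eta>) \<and> (\<forall>z. norm (V \<eta> z) \<le> (2 * B) ^ card J))
      \<and> (\<forall>z. (\<Prod>\<eta>\<in>J. u \<eta> (snd z) + v \<eta> z) = (\<Prod>\<eta>\<in>J. u \<eta> (snd z)) + (\<Sum>\<eta>\<in>J. V \<eta> z))"
      by (rule insert.IH[OF p]) auto
    obtain V where V: "\<And>\<eta>. \<eta> \<in> J \<Longrightarrow> W (i + int (\<tau> \<eta>)) (i + int (\<tau> \<eta>) + int L) (V \<eta>)"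
        "\<And>\<eta> z. \<eta> \<in> J \<Longrightarrow> norm (V \<eta> z) \<le> (2 * B) ^ card J"
        "\<And>z. (\<Prod>\<eta>\<in>J. u \<eta> (snd z) + v \<eta> z) = (\<Prod>\<eta>\<in>J. u \<eta> (snd z)) + (\<Sum>\<eta>\<in>J. V \<eta> z)"
      using ex by blast
    define q where "q z = u a (snd z) + v a z" for z
    define V' where "V' \<eta> z = (if \<eta> = a then v a z * (\<Prod>\<eta>\<in>J. u \<eta> (snd z)) else V \<eta> z * q z)" for \<eta> z
    have qa: "adapted (i + int (\<tau> a)) q"
      unfolding q_def[abs_def] by (intro adapted_add adapted_snd W_adapted[OF p(4)] p(2)) auto
    have nq: "norm (q z) \<le> 2 * B" for z
      using norm_triangle_ineq[of "u a (snd z)" "v a z"] p(3)[of a "snd z"] p(5)[of a z] by (simp add: q_def)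
    have cI: "card (insert a J) = Suc (card J)" using False insert.hyps by simp
    have 1: "W (i + int (\<tau> \<eta>)) (i + int (\<tau> \<eta>) + int L) (V' \<eta>) \<and> (\<forall>z. norm (V' \<eta> z) \<le> (2 * B) ^ card (insert a J))"
      if \<eta>: "\<eta> \<in> insert a J" for \<eta>
    proof (cases "\<eta> = a")
      case True
      have "(\<lambda>y. \<Prod>\<eta>\<in>J. u \<eta> y) \<in> bdd_borel N" by (rule bdd_borel_prod) (use p(2) in auto)
      then have "W (i + int (\<tau> a)) (i + int (\<tau> a) + int L) (\<lambda>z. v a z * (\<Prod>\<eta>\<in>J. u \<eta> (snd z)))"
        by (intro W_adapted_mult p(4) adapted_snd) auto
      moreover have "norm (v a z * (\<Prod>\<eta>\<in>J. u \<eta> (snd z))) \<le> (2 * B) ^ card (insert a J)" for z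
      proof -
        have "norm (\<Prod>\<eta>\<in>J. u \<eta> (snd z)) \<le> (\<Prod>\<eta>\<in>J. B)"
          unfolding prod_norm[symmetric] by (rule prod_mono) (use p(3) in auto)
        also have "\<dots> \<le> (2 * B) ^ card J" using B by (simp add: power_mono)
        finally have "norm (v a z) * norm (\<Prod>\<eta>\<in>J. u \<eta> (snd z)) \<le> (2 * B) * (2 * B) ^ card J"
          using p(5)[of a z] B by (intro mult_mono) auto
        then show ?thesis unfolding cI norm_mult by simp
      qed
      ultimately show ?thesis using True by (simp add: V'_def[abs_def])
    next
      case F: False
      then have J: "\<eta> \<in> J" using \<eta> by simp
      have "\<tau> \<eta> + L \<le> \<tau> a \<or> \<tau> a + L \<le> \<tau> \<eta>" using p(1)[of \<eta> a] J F by auto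
      then have "\<tau> \<eta> + L \<le> \<tau> a" using insert.hyps(2)[OF J] by auto
      then have "adapted (i + int (\<tau> \<eta>) + int L) q" by (intro adapted_mono[OF qa]) auto
      then have "W (i + int (\<tau> \<eta>)) (i + int (\<tau> \<eta>) + int L) (\<lambda>z. V \<eta> z * q z)"
        by (intro W_adapted_mult V(1) J) auto
      moreover have "norm (V \<eta> z * q z) \<le> (2 * B) ^ card (insert a J)" for z
      proof -
        have "norm (V \<eta> z) * norm (q z) \<le> (2 * B) ^ card J * (2 * B)"
          using V(2)[OF J] nq B by (intro mult_mono) auto
        then show ?thesis unfolding cI norm_mult by (simp add: mult.commute)
      qed
      ultimately show ?thesis using F by (simp add: V'_def[abs_def])
    qed
    have 2: "(\<Prod>\<eta>\<in>insert a J. u \<eta> (snd z) + v \<eta> z) = (\<Prod>\<eta>\<in>insert a J. u \<eta> (snd z)) + (\<Sum>\<eta>\<in>insert a J. V' \<eta> z)" for z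
    proof -
      have s: "(\<Sum>\<eta>\<in>J. V' \<eta> z) = (\<Sum>\<eta>\<in>J. V \<eta> z) * q z"
        unfolding sum_distrib_right by (rule sum.cong) (use False in \<open>auto simp: V'_def\<close>)
      have "(\<Prod>\<eta>\<in>insert a J. u \<eta> (snd z) + v \<eta> z) = q z * ((\<Prod>\<eta>\<in>J. u \<eta> (snd z)) + (\<Sum>\<eta>\<in>J. V \<eta> z))"
        using False insert.hyps V(3) by (simp add: q_def)
      also have "\<dots> = u a (snd z) * (\<Prod>\<eta>\<in>J. u \<eta> (snd z)) + (v a z * (\<Prod>\<eta>\<in>J. u \<eta> (snd z)) + (\<Sum>\<eta>\<in>J. V \<eta> z) * q z)"
        by (simp add: q_def algebra_simps)
      also have "v a z * (\<Prod>\<eta>\<in>J. u \<eta> (snd z)) = V' a z" by (simp add: V'_def)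
      finally show ?thesis using False insert.hyps s by simp
    qed
    show ?thesis using 1 2 by blast
  qed
qed

end

section \<open>Means of order at most two and cubes\<close>

text \<open>After division by (a + b)^s this is x \<le> x^s on [0, 1], applied to the two
  proportions.\<close>

lemma powr_add_le_add_powr:
  fixes a b s :: real
  assumes "0 \<le> a" "0 \<le> b" "0 < s" "s \<le> 1"
  shows "(a + b) powr s \<le> a powr s + b powr s"
proof (cases "a + b = 0")
  case False
  then have ab: "a + b > 0" using assms by simp
  have le: "x / (a + b) \<le> (x / (a + b)) powr s" if "0 \<le> x" "x \<le> a + b" for x
  proof (cases "x = 0")
    case False
    have "(x / (a + b)) powr 1 \<le> (x / (a + b)) powr s"
      using that assms ab by (intro powr_mono') auto
    then show ?thesis using that ab by simp
  qed simp
  have "1 = a / (a + b) + b / (a + b)" using ab by (simp add: add_divide_distrib[symmetric])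
  also have "\<dots> \<le> (a / (a + b)) powr s + (b / (a + b)) powr s"
    using assms by (intro add_mono le) auto
  also have "\<dots> = (a powr s + b powr s) / (a + b) powr s"
    using assms ab by (simp add: powr_divide add_divide_distrib)
  finally show ?thesis using ab by (simp add: field_simps)
qed (use assms in auto)

lemma add_powr_le:
  fixes a b q :: real
  assumes "0 \<le> a" "0 \<le> b" "0 < q"
  shows "(a + b) powr q \<le> 2 powr q * (a powr q + b powr q)"
proof -
  have "(a + b) powr q \<le> (2 * max a b) powr q" using assms by (intro powr_mono2) auto
  also have "\<dots> = 2 powr q * (max a b) powr q" using assms by (simp add: powr_mult)
  also have "(max a b) powr q \<le> a powr q + b powr q" by (simp add: max_def)
  finally show ?thesis by simp
qed

section \<open>Power means on a probability space\<close>

definition bdd_nonneg :: "'a measure \<Rightarrow> ('a \<Rightarrow> real) set" where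
  "bdd_nonneg M = {f \<in> borel_measurable M. (\<forall>x. 0 \<le> f x) \<and> (\<exists>B. \<forall>x. f x \<le> B)}"

lemma bdd_nonnegI: "f \<in> borel_measurable M \<Longrightarrow> (\<And>x. 0 \<le> f x) \<Longrightarrow> (\<And>x. f x \<le> B) \<Longrightarrow> f \<in> bdd_nonneg M"
  by (auto simp: bdd_nonneg_def)

lemma bdd_nonneg_nonneg: "f \<in> bdd_nonneg M \<Longrightarrow> 0 \<le> f x" by (simp add: bdd_nonneg_def)

lemma bdd_nonneg_measurable[measurable_dest]: "f \<in> bdd_nonneg M \<Longrightarrow> f \<in> borel_measurable M" by (simp add: bdd_nonneg_def)

lemma bdd_nonneg_bound:
  assumes "f \<in> bdd_nonneg M" obtains B where "B \<ge> 0" "\<And>x. f x \<le> B"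
proof -
  obtain B where B: "\<And>x. f x \<le> B" using assms by (auto simp: bdd_nonneg_def)
  have "0 \<le> B" using B[of undefined] bdd_nonneg_nonneg[OF assms, of undefined] by simp
  then show ?thesis using that B by blast
qed

lemma bdd_nonneg_add: assumes "f \<in> bdd_nonneg M" "g \<in> bdd_nonneg M" shows "(\<lambda>x. f x + g x) \<in> bdd_nonneg M"
proof -
  obtain B C where "\<And>x. f x \<le> B" "\<And>x. g x \<le> C" using assms by (metis bdd_nonneg_bound)
  then show ?thesis using assms
    by (intro bdd_nonnegI[of _ _ "B + C"]) (auto intro: add_mono simp: bdd_nonneg_nonneg)
qed

context prob_space
begin

lemma bdd_nonneg_powr_integrable:
  assumes "f \<in> bdd_nonneg M" "q > 0" shows "integrable M (\<lambda>x. f x powr q)"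
proof -
  obtain B where B: "B \<ge> 0" "\<And>x. f x \<le> B" using bdd_nonneg_bound[OF assms(1)] by blast
  show ?thesis
    by (rule integrable_const_bound[where B="B powr q"])
      (use B assms bdd_nonneg_nonneg[OF assms(1)] in \<open>auto intro!: powr_mono2\<close>)
qed

text \<open>Let a be the r-mean. The weighted inequality between geometric and arithmetic mean,
  applied pointwise to (f / a)^r and 1 with weights q / r and 1 - q / r, is integrated. If a = 0,
  then f vanishes almost everywhere.\<close>

lemma powr_mean_mono:
  assumes f: "f \<in> bdd_nonneg M" and q: "0 < q" "q \<le> r"
  shows "(\<integral>x. f x powr q \<partial>M) powr (1 / q) \<le> (\<integral>x. f x powr r \<partial>M) powr (1 / r)"
proof -
  have r: "r > 0" using q by simp
  note i = bdd_nonneg_powr_integrable[OF f]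
  define a where "a = (\<integral>x. f x powr r \<partial>M) powr (1 / r)"
  have I0: "0 \<le> (\<integral>x. f x powr r \<partial>M)" by simp
  have f0: "0 \<le> f x" for x by (rule bdd_nonneg_nonneg[OF f])
  show ?thesis
  proof (cases "a = 0")
    case True
    then have "(\<integral>x. f x powr r \<partial>M) = 0" by (simp add: a_def)
    then have "AE x in M. f x powr r = 0"
      by (subst (asm) integral_nonneg_eq_0_iff_AE[OF i[OF r]]) auto
    then have "AE x in M. f x powr q = 0" by eventually_elim simp
    then have "(\<integral>x. f x powr q \<partial>M) = 0" by (rule integral_eq_zero_AE)
    then show ?thesis using q by simp
  next
    case False
    then have a: "a > 0" by (simp add: a_def less_le)
    have ar: "a powr r = (\<integral>x. f x powr r \<partial>M)" unfolding a_def using r I0 by (simp add: powr_powr)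
    have pw: "f x powr q \<le> a powr q * ((q / r) * (f x powr r / a powr r) + (1 - q / r))" for x
    proof (cases "f x = 0")
      case True
      then show ?thesis using q r by simp
    next
      case False
      then have fx: "f x > 0" using f0[of x] by simp
      have "((f x / a) powr r) powr (q / r) * 1 powr (1 - q / r) \<le> (q / r) * ((f x / a) powr r) + (1 - q / r) * 1"
        by (rule Youngs_inequality_0) (use q r fx a in auto)
      moreover have "((f x / a) powr r) powr (q / r) = f x powr q / a powr q"
        using r fx a by (simp add: powr_powr powr_divide)
      moreover have "(f x / a) powr r = f x powr r / a powr r" using fx a by (simp add: powr_divide)
      ultimately have "f x powr q / a powr q \<le> (q / r) * (f x powr r / a powr r) + (1 - q / r)" by simp
      then show ?thesis using a by (simp add: divide_le_eq mult.commute)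
    qed
    have "(\<integral>x. f x powr q \<partial>M) \<le> (\<integral>x. a powr q * ((q / r) * (f x powr r / a powr r) + (1 - q / r)) \<partial>M)"
      using i[OF q(1)] i[OF r] by (intro integral_mono pw) auto
    also have "\<dots> = a powr q * ((q / r) * ((\<integral>x. f x powr r \<partial>M) / a powr r) + (1 - q / r))"
      using i[OF r] by (simp add: prob_space)
    also have "\<dots> = a powr q" using a unfolding ar[symmetric] by simp
    finally have "(\<integral>x. f x powr q \<partial>M) powr (1 / q) \<le> (a powr q) powr (1 / q)"
      using q by (intro powr_mono2) auto
    then show ?thesis using q a by (simp add: powr_powr a_def)
  qed
qed

text \<open>Even for p = \<infinity> the exponent is finite, so on the product the branch of
  \<open>Lp_norm\<close> with the essential supremum never arises.\<close>

lemma Lp_norm_min2: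
  assumes "1 \<le> p"
  obtains q where "1 \<le> q" "q \<le> 2" "min 2 p = ereal q" "\<And>f. f \<in> bdd_nonneg M \<Longrightarrow> Lp_norm M (min 2 p) f = (\<integral>x. f x powr q \<partial>M) powr (1 / q)"
proof -
  obtain q where q: "min 2 p = ereal q" "1 \<le> q" "q \<le> 2"
  proof (cases p)
    case (real r)
    then have "min 2 p = ereal (min 2 r)" by (auto simp: min_def)
    then show ?thesis using that[of "min 2 r"] assms real by simp
  next
    case PInf
    then have "min 2 p = ereal 2" by (simp add: min_def)
    then show ?thesis using that[of 2] by simp
  qed (use assms in auto)
  have "Lp_norm M (min 2 p) f = (\<integral>x. f x powr q \<partial>M) powr (1 / q)" if "f \<in> bdd_nonneg M" for f
    unfolding Lp_norm_def q(1) using bdd_nonneg_nonneg[OF that] by simp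
  then show ?thesis using that q by blast
qed

lemma Lp_norm_min2_le_sqrt:
  assumes "1 \<le> p" "f \<in> bdd_nonneg M"
  shows "Lp_norm M (min 2 p) f \<le> sqrt (\<integral>x. (f x)\<^sup>2 \<partial>M)"
proof -
  obtain q where q: "1 \<le> q" "q \<le> 2" "Lp_norm M (min 2 p) f = (\<integral>x. f x powr q \<partial>M) powr (1 / q)"
    using Lp_norm_min2[OF assms(1)] assms(2) by metis
  have "(\<integral>x. f x powr q \<partial>M) powr (1 / q) \<le> (\<integral>x. f x powr 2 \<partial>M) powr (1 / 2)"
    using q by (intro powr_mean_mono assms) auto
  also have "(\<lambda>x. f x powr 2) = (\<lambda>x. (f x)\<^sup>2)"
    using bdd_nonneg_nonneg[OF assms(2)] by (simp add: powr_numeral fun_eq_iff)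
  finally show ?thesis using q by (simp add: powr_half_sqrt)
qed

lemma Lp_norm_min2_le:
  assumes "1 \<le> p" "f \<in> bdd_nonneg M"
  shows "Lp_norm M (min 2 p) f \<le> Lp_norm M p f"
proof (cases p)
  case (real r)
  show ?thesis
  proof (cases "r \<le> 2")
    case True
    then have "min 2 p = p" using real by (simp add: min_def)
    then show ?thesis by simp
  next
    case False
    then have "min 2 p = ereal 2" using real by (simp add: min_def)
    then have "Lp_norm M (min 2 p) f = (\<integral>x. f x powr 2 \<partial>M) powr (1 / 2)"
      using bdd_nonneg_nonneg[OF assms(2)] by (simp add: Lp_norm_def)
    also have "\<dots> \<le> (\<integral>x. f x powr r \<partial>M) powr (1 / r)"
      using False by (intro powr_mean_mono assms) auto
    also have "\<dots> = Lp_norm M p f" using real bdd_nonneg_nonneg[OF assms(2)] by (simp add: Lp_norm_def)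
    finally show ?thesis .
  qed
next
  case PInf
  obtain B where B: "B \<ge> 0" "\<And>x. f x \<le> B" using bdd_nonneg_bound[OF assms(2)] by blast
  have [measurable]: "f \<in> borel_measurable M" by (rule bdd_nonneg_measurable[OF assms(2)])
  define s where "s = esssup M (\<lambda>x. ereal (f x))"
  have s1: "s \<le> ereal B" unfolding s_def by (rule esssup_I) (use B in auto)
  have ae: "AE x in M. ereal (f x) \<le> s" unfolding s_def by (rule esssup_AE)
  \<comment> \<open>Together with \<open>s1\<close> this shows that the essential supremum is a real
    number, which \<open>real_of_ereal\<close> returns faithfully.\<close>
  have s0: "0 \<le> s"
  proof -
    have "esssup M (\<lambda>_. 0 :: ereal) \<le> s"
      unfolding s_def by (rule esssup_AE_mono) (use bdd_nonneg_nonneg[OF assms(2)] in auto)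
    then show ?thesis by (simp add: esssup_const emeasure_space_1)
  qed
  then obtain c where c: "s = ereal c" "c \<ge> 0" using s1 by (cases s) auto
  have fc: "AE x in M. f x \<le> c" using ae c by simp
  obtain q where q: "1 \<le> q" "q \<le> 2" "Lp_norm M (min 2 p) f = (\<integral>x. f x powr q \<partial>M) powr (1 / q)"
    using Lp_norm_min2[OF assms(1)] assms(2) by metis
  have "(\<integral>x. f x powr q \<partial>M) \<le> (\<integral>x. c powr q \<partial>M)"
  proof (rule integral_mono_AE)
    show "integrable M (\<lambda>x. f x powr q)" using q by (intro bdd_nonneg_powr_integrable assms) auto
    show "AE x in M. f x powr q \<le> c powr q"
      using fc by eventually_elim (use q bdd_nonneg_nonneg[OF assms(2)] in \<open>auto intro!: powr_mono2\<close>)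
  qed simp
  then have "(\<integral>x. f x powr q \<partial>M) powr (1 / q) \<le> (c powr q) powr (1 / q)"
    using q by (intro powr_mono2) (auto simp: prob_space)
  also have "\<dots> = c" using q c by (simp add: powr_powr)
  also have "c = Lp_norm M p f"
  proof -
    have "(\<lambda>x. ereal (norm (f x))) = (\<lambda>x. ereal (f x))" using bdd_nonneg_nonneg[OF assms(2)] by simp
    then show ?thesis using PInf c(1) by (simp add: Lp_norm_def s_def)
  qed
  finally show ?thesis using q by simp
qed (use assms in auto)

lemma Lp_norm_min2_mono:
  assumes "1 \<le> p" "f \<in> bdd_nonneg M" "g \<in> bdd_nonneg M" "\<And>x. f x \<le> g x"
  shows "Lp_norm M (min 2 p) f \<le> Lp_norm M (min 2 p) g"
proof -
  obtain q where q: "1 \<le> q" "\<And>f. f \<in> bdd_nonneg M \<Longrightarrow> Lp_norm M (min 2 p) f = (\<integral>x. f x powr q \<partial>M) powr (1 / q)"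
    using Lp_norm_min2[OF assms(1)] by metis
  have "(\<integral>x. f x powr q \<partial>M) \<le> (\<integral>x. g x powr q \<partial>M)"
    using q(1) assms bdd_nonneg_nonneg[OF assms(2)] by (intro integral_mono bdd_nonneg_powr_integrable powr_mono2) auto
  then show ?thesis using q assms by (simp add: powr_mono2)
qed

text \<open>The factor \<open>2 powr q\<close> of \<open>add_powr_le\<close> becomes 2 under the
  q-th root, and the root is subadditive. Compared with Minkowski the loss is a factor 2, which only
  enters the constants of the Wiener-Wintner bounds.\<close>

lemma Lp_norm_min2_add_le:
  assumes "1 \<le> p" "f \<in> bdd_nonneg M" "g \<in> bdd_nonneg M"
  shows "Lp_norm M (min 2 p) (\<lambda>x. f x + g x) \<le> 2 * (Lp_norm M (min 2 p) f + Lp_norm M (min 2 p) g)"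
proof -
  obtain q where q: "1 \<le> q" "\<And>f. f \<in> bdd_nonneg M \<Longrightarrow> Lp_norm M (min 2 p) f = (\<integral>x. f x powr q \<partial>M) powr (1 / q)"
    using Lp_norm_min2[OF assms(1)] by metis
  let ?a = "\<integral>x. f x powr q \<partial>M" and ?b = "\<integral>x. g x powr q \<partial>M"
  have i: "integrable M (\<lambda>x. f x powr q)" "integrable M (\<lambda>x. g x powr q)" "integrable M (\<lambda>x. (f x + g x) powr q)"
    using q(1) assms by (auto intro!: bdd_nonneg_powr_integrable bdd_nonneg_add)
  have "(\<integral>x. (f x + g x) powr q \<partial>M) \<le> (\<integral>x. 2 powr q * (f x powr q + g x powr q) \<partial>M)"
    using i q(1) bdd_nonneg_nonneg[OF assms(2)] bdd_nonneg_nonneg[OF assms(3)] by (intro integral_mono add_powr_le) auto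
  also have "\<dots> = 2 powr q * (?a + ?b)" using i by simp
  finally have "(\<integral>x. (f x + g x) powr q \<partial>M) powr (1 / q) \<le> (2 powr q * (?a + ?b)) powr (1 / q)"
    using q(1) by (intro powr_mono2) auto
  also have "\<dots> = 2 * (?a + ?b) powr (1 / q)"
    using q(1) by (subst powr_mult) (auto simp: powr_powr intro!: add_nonneg_nonneg)
  also have "\<dots> \<le> 2 * (?a powr (1 / q) + ?b powr (1 / q))"
    using q(1) by (intro mult_left_mono powr_add_le_add_powr) auto
  finally show ?thesis using q(2) assms bdd_nonneg_add[OF assms(2,3)] by simp
qed

lemma Lp_norm_nonneg_min2: "1 \<le> p \<Longrightarrow> f \<in> bdd_nonneg M \<Longrightarrow> 0 \<le> Lp_norm M (min 2 p) f"
  using Lp_norm_min2[of p] by (metis powr_ge_zero)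

end

lemma Lp_norm_cong_AE:
  fixes f g :: "'a \<Rightarrow> 'b::{real_normed_vector, second_countable_topology}"
  assumes "f \<in> borel_measurable M" "g \<in> borel_measurable M" "AE x in M. f x = g x"
  shows "Lp_norm M p f = Lp_norm M p g"
proof -
  have "esssup M (\<lambda>x. ereal (norm (f x))) = esssup M (\<lambda>x. ereal (norm (g x)))"
    by (rule esssup_AE_cong) (use assms in \<open>auto elim: eventually_mono\<close>)
  moreover have "(\<integral>x. norm (f x) powr real_of_ereal p \<partial>M) = (\<integral>x. norm (g x) powr real_of_ereal p \<partial>M)"
    by (rule integral_cong_AE) (use assms in \<open>auto elim: eventually_mono\<close>)
  ultimately show ?thesis by (simp add: Lp_norm_def)
qed

section \<open>Separation of the vertices of a cube\<close>

lemma finite_cube: "finite (cube k)" unfolding cube_def by (rule finite_PiE) auto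

abbreviation dot :: "nat \<Rightarrow> (nat \<Rightarrow> nat) \<Rightarrow> (nat \<Rightarrow> nat) \<Rightarrow> nat" where
  "dot k h \<eta> \<equiv> \<Sum>j=1..k. h j * \<eta> j"

definition separated :: "nat \<Rightarrow> nat \<Rightarrow> (nat \<Rightarrow> nat) \<Rightarrow> bool" where
  "separated k L h \<longleftrightarrow> (\<forall>\<eta>\<in>cube k. \<forall>\<eta>'\<in>cube k. \<eta> \<noteq> \<eta>' \<longrightarrow>
     dot k h \<eta> + L \<le> dot k h \<eta>' \<or> dot k h \<eta>' + L \<le> dot k h \<eta>)"

text \<open>At a coordinate c where the vertices differ, \<open>h c\<close> is determined by the
  other coordinates of h and the difference of the two dot products. This difference takes at most 2
  L values, so one of the k powers of r becomes a constant.\<close>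

lemma card_close_dot_le:
  assumes \<eta>: "\<eta> \<in> cube k" "\<eta>' \<in> cube k" "\<eta> \<noteq> \<eta>'"
  shows "card {h \<in> {1..k} \<rightarrow>\<^sub>E {1..r}. dot k h \<eta> < dot k h \<eta>' + L \<and> dot k h \<eta>' < dot k h \<eta> + L}
    \<le> 2 * L * r ^ (k - 1)"
    (is "card ?A \<le> _")
proof -
  obtain c where c: "c \<in> {1..k}" "\<eta> c \<noteq> \<eta>' c"
    using \<eta> unfolding cube_def by (metis PiE_ext)
  have c01: "\<eta> c = 0 \<and> \<eta>' c = 1 \<or> \<eta> c = 1 \<and> \<eta>' c = 0"
  proof -
    have "\<eta> c \<in> {0, 1}" "\<eta>' c \<in> {0, 1}"
      using PiE_mem[OF \<eta>(1)[unfolded cube_def] c(1)] PiE_mem[OF \<eta>(2)[unfolded cube_def] c(1)] .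
    then show ?thesis using c(2) by auto
  qed
  let ?J = "{1..k} - {c}"
  define f where "f h = (restrict h ?J, int (dot k h \<eta>) - int (dot k h \<eta>'))" for h
  have split: "dot k h \<xi> = h c * \<xi> c + (\<Sum>j\<in>?J. h j * \<xi> j)" for h \<xi>
    using c by (intro sum.remove) auto
  have inj: "inj_on f ?A"
  proof (rule inj_onI)
    fix h h' assume hh: "h \<in> ?A" "h' \<in> ?A" "f h = f h'"
    have J: "h j = h' j" if "j \<in> ?J" for j
      using hh(3) that unfolding f_def by (metis (no_types, lifting) Pair_inject restrict_apply')
    have s: "(\<Sum>j\<in>?J. h j * \<xi> j) = (\<Sum>j\<in>?J. h' j * \<xi> j)" for \<xi> by (rule sum.cong) (use J in auto)
    have "int (dot k h \<eta>) - int (dot k h \<eta>') = int (dot k h' \<eta>) - int (dot k h' \<eta>')"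
      using hh(3) by (simp only: f_def prod.inject)
    then have "h c = h' c" using c01 unfolding split s by auto
    then have "h j = h' j" if "j \<in> {1..k}" for j using J that by (cases "j = c") auto
    then show "h = h'" using hh(1,2) by (intro PiE_ext[of h "{1..k}" _ h']) auto
  qed
  have img: "f ` ?A \<subseteq> (?J \<rightarrow>\<^sub>E {1..r}) \<times> {- int L + 1..<int L}"
  proof
    fix x assume "x \<in> f ` ?A"
    then obtain h where h: "h \<in> {1..k} \<rightarrow>\<^sub>E {1..r}" "dot k h \<eta> < dot k h \<eta>' + L" "dot k h \<eta>' < dot k h \<eta> + L"
      and x: "x = f h" by blast
    have "int (dot k h \<eta>) - int (dot k h \<eta>') \<in> {- int L + 1..<int L}"
      using h(2,3) unfolding atLeastLessThan_iff by linarith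
    moreover have "restrict h ?J \<in> ?J \<rightarrow>\<^sub>E {1..r}" using h(1) by (auto simp: PiE_def Pi_def)
    ultimately show "x \<in> (?J \<rightarrow>\<^sub>E {1..r}) \<times> {- int L + 1..<int L}" by (simp only: x f_def mem_Sigma_iff)
  qed
  have "card ?A = card (f ` ?A)" by (rule card_image[OF inj, symmetric])
  also have "\<dots> \<le> card ((?J \<rightarrow>\<^sub>E {1..r}) \<times> {- int L + 1..<int L})"
    by (rule card_mono[OF _ img]) (auto intro: finite_PiE)
  also have "\<dots> = r ^ (k - 1) * nat (2 * int L - 1)"
    using c by (simp add: card_cartesian_product card_PiE)
  also have "\<dots> \<le> r ^ (k - 1) * (2 * L)" by (intro mult_left_mono) auto
  finally show ?thesis by (simp add: mult.commute)
qed

lemma card_not_separated_le: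
  "card {h \<in> {1..k} \<rightarrow>\<^sub>E {1..r}. \<not> separated k L h} \<le> (card (cube k))\<^sup>2 * (2 * L * r ^ (k - 1))"
proof -
  let ?A = "\<lambda>p. {h \<in> {1..k} \<rightarrow>\<^sub>E {1..r}. dot k h (fst p) < dot k h (snd p) + L \<and> dot k h (snd p) < dot k h (fst p) + L}"
  let ?I = "{p \<in> cube k \<times> cube k. fst p \<noteq> snd p}"
  have finI: "finite ?I" using finite_cube by simp
  have finA: "finite (?A p)" for p by (simp add: finite_PiE)
  have "{h \<in> {1..k} \<rightarrow>\<^sub>E {1..r}. \<not> separated k L h} \<subseteq> (\<Union>p\<in>?I. ?A p)"
  proof
    fix h assume "h \<in> {h \<in> {1..k} \<rightarrow>\<^sub>E {1..r}. \<not> separated k L h}"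
    then obtain \<eta> \<eta>' where h: "h \<in> {1..k} \<rightarrow>\<^sub>E {1..r}" "\<eta> \<in> cube k" "\<eta>' \<in> cube k" "\<eta> \<noteq> \<eta>'"
      "dot k h \<eta> < dot k h \<eta>' + L" "dot k h \<eta>' < dot k h \<eta> + L"
      unfolding separated_def mem_Collect_eq not_le[symmetric] by blast
    then show "h \<in> (\<Union>p\<in>?I. ?A p)" by (intro UN_I[of "(\<eta>, \<eta>')"]) auto
  qed
  then have "card {h \<in> {1..k} \<rightarrow>\<^sub>E {1..r}. \<not> separated k L h} \<le> card (\<Union>p\<in>?I. ?A p)"
    by (rule card_mono[rotated]) (use finI finA in blast)
  also have "\<dots> \<le> (\<Sum>p\<in>?I. card (?A p))" by (rule card_UN_le[OF finI])
  also have "\<dots> \<le> (\<Sum>p\<in>?I. 2 * L * r ^ (k - 1))"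
  proof (rule sum_mono)
    fix p assume "p \<in> ?I"
    then show "card (?A p) \<le> 2 * L * r ^ (k - 1)" by (intro card_close_dot_le) auto
  qed
  also have "\<dots> = card ?I * (2 * L * r ^ (k - 1))" by simp
  also have "\<dots> \<le> (card (cube k))\<^sup>2 * (2 * L * r ^ (k - 1))"
  proof (rule mult_right_mono)
    have "card ?I \<le> card (cube k \<times> cube k)" by (rule card_mono) (auto simp: finite_cube)
    then show "card ?I \<le> (card (cube k))\<^sup>2" by (simp add: card_cartesian_product power2_eq_square)
  qed simp
  finally show ?thesis .
qed

lemma norm_cnj_pow: "norm ((cnj ^^ n) z) = norm z"
  by (induction n) auto

lemma cnj_pow_add: "(cnj ^^ n) (a + b) = (cnj ^^ n) a + (cnj ^^ n) b"
  by (induction n) auto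

lemma bdd_borel_cnj_pow: "f \<in> bdd_borel M \<Longrightarrow> (\<lambda>x. (cnj ^^ n) (f x)) \<in> bdd_borel M"
  by (induction n) (auto intro: bdd_borel_cnj)

lemma borel_measurable_cnj_pow[measurable]: "f \<in> borel_measurable M \<Longrightarrow> (\<lambda>x. (cnj ^^ n) (f x)) \<in> borel_measurable M"
  by (induction n) auto

context measure_preserving
begin

lemma cube_product_bdd_borel: "f \<in> bdd_borel M \<Longrightarrow> cube_product T k h f \<in> bdd_borel M"
  unfolding cube_product_def[abs_def] by (intro bdd_borel_prod bdd_borel_cnj_pow bdd_borel_Tn)

lemma ww_sup_bdd_nonneg: assumes "F \<in> bdd_borel M" shows "ww_sup T n F \<in> bdd_nonneg M"
proof -
  obtain B where B: "B > 0" "\<And>x. norm (F x) \<le> B" using bdd_borel_bound[OF assms] by blast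
  show ?thesis
    by (rule bdd_nonnegI[of _ _ B]) (use assms B in \<open>auto intro!: ww_sup_nonneg ww_sup_le_bound bdd_borel_measurable\<close>)
qed

lemma cube_product_measurable[measurable]:
  "f \<in> borel_measurable M \<Longrightarrow> cube_product T k h f \<in> borel_measurable M"
  unfolding cube_product_def[abs_def]
  by (intro borel_measurable_prod borel_measurable_cnj_pow measurable_compose[OF Tn_meas])

text \<open>Outside a null set the two functions agree along whole orbits, and there all averages
  and cube products coincide. So a Wiener-Wintner function on Y may be assumed bounded at every
  point.\<close>

lemma ww_function_cong_AE:
  assumes f: "ww_function k \<alpha> p M T f" and g: "g \<in> bdd_borel M" and ae: "AE x in M. f x = g x"
  shows "ww_function k \<alpha> p M T g"
proof -
  have fm[measurable]: "f \<in> borel_measurable M" using f by (auto simp: ww_function_def L_infinity_def)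
  have gm[measurable]: "g \<in> borel_measurable M" using g by (rule bdd_borel_measurable)
  have orbit: "AE x in M. \<forall>m. f ((T ^^ m) x) = g ((T ^^ m) x)"
    unfolding AE_all_countable using AE_Tn[OF ae] by blast
  have 1: "Lp_norm M p (ww_sup T n f) = Lp_norm M p (ww_sup T n g)" for n
  proof (rule Lp_norm_cong_AE)
    show "AE x in M. ww_sup T n f x = ww_sup T n g x"
      using orbit by eventually_elim (simp add: ww_sup_def)
  qed measurable
  have 2: "Lp_norm M p (ww_sup T n (cube_product T K h f)) = Lp_norm M p (ww_sup T n (cube_product T K h g))" for n K h
  proof (rule Lp_norm_cong_AE)
    show "AE x in M. ww_sup T n (cube_product T K h f) x = ww_sup T n (cube_product T K h g) x"
      using orbit
    proof eventually_elim
      case (elim x)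
      have "f ((T ^^ m) ((T ^^ m') x)) = g ((T ^^ m) ((T ^^ m') x))" for m m'
        using elim by (metis comp_apply funpow_add)
      then show ?case by (simp add: ww_sup_def cube_product_def)
    qed
  qed measurable
  show ?thesis
    using f bdd_borel_L_infinity[OF g] unfolding ww_function_def 1 2 by blast
qed

end

section \<open>The product as a Wiener-Wintner system\<close>

context kolmogorov_product
begin

lemma bdd_nonneg_snd: "f \<in> bdd_nonneg N \<Longrightarrow> (\<lambda>z. f (snd z)) \<in> bdd_nonneg P"
  by (auto simp: bdd_nonneg_def)

lemma Lp_norm_min2_snd:
  assumes "1 \<le> p" "f \<in> bdd_nonneg N"
  shows "Lp_norm P (min 2 p) (\<lambda>z. f (snd z)) = Lp_norm N (min 2 p) f"
proof -
  obtain q where q: "min 2 p = ereal q" using Lp_norm_min2[OF assms(1)] by metis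
  show ?thesis
    unfolding Lp_norm_def q using integral_snd_comp[of "\<lambda>y. norm (f y) powr q"] assms(2)
    by (simp add: bdd_nonneg_measurable)
qed

lemma ww_sup_snd: "ww_sup R n (\<lambda>z. G (snd z)) z = ww_sup S n G (snd z)"
  by (simp add: ww_sup_def funpow_map_prod)

text \<open>The part from Y is known in L^p, the perturbation in L^2; the norm with exponent
  \<open>min 2 p\<close> is dominated by either.\<close>

lemma Lp_norm_ww_sup_add_le:
  assumes p: "1 \<le> p" and G: "G \<in> bdd_borel N" and D: "D \<in> bdd_borel P"
  shows "Lp_norm P (min 2 p) (ww_sup R n (\<lambda>z. G (snd z) + D z))
    \<le> 2 * (Lp_norm N p (ww_sup S n G) + sqrt (\<integral>z. (ww_sup R n D z)\<^sup>2 \<partial>P))"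
proof -
  let ?g = "\<lambda>z. ww_sup S n G (snd z)" and ?d = "ww_sup R n D"
  have Gb: "(\<lambda>z. G (snd z)) \<in> bdd_borel P" by (rule bdd_borel_comp[OF G]) simp
  have g: "?g \<in> bdd_nonneg P" by (rule bdd_nonneg_snd[OF N.ww_sup_bdd_nonneg[OF G]])
  have d: "?d \<in> bdd_nonneg P" by (rule R.ww_sup_bdd_nonneg[OF D])
  have "Lp_norm P (min 2 p) (ww_sup R n (\<lambda>z. G (snd z) + D z)) \<le> Lp_norm P (min 2 p) (\<lambda>z. ?g z + ?d z)"
    using ww_sup_add_le[of R n "\<lambda>z. G (snd z)" D]
    by (intro PR.Lp_norm_min2_mono p R.ww_sup_bdd_nonneg bdd_borel_add Gb D bdd_nonneg_add g d) (simp add: ww_sup_snd)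
  also have "\<dots> \<le> 2 * (Lp_norm P (min 2 p) ?g + Lp_norm P (min 2 p) ?d)"
    by (rule PR.Lp_norm_min2_add_le[OF p g d])
  also have "Lp_norm P (min 2 p) ?g \<le> Lp_norm N p (ww_sup S n G)"
    unfolding Lp_norm_min2_snd[OF p N.ww_sup_bdd_nonneg[OF G]] by (rule N.Lp_norm_min2_le[OF p N.ww_sup_bdd_nonneg[OF G]])
  also have "Lp_norm P (min 2 p) ?d \<le> sqrt (\<integral>z. (?d z)\<^sup>2 \<partial>P)"
    by (rule PR.Lp_norm_min2_le_sqrt[OF p d])
  finally show ?thesis by simp
qed

definition cube_diff :: "nat \<Rightarrow> (nat \<Rightarrow> nat) \<Rightarrow> ('b \<Rightarrow> complex) \<Rightarrow> ('a \<times> 'b \<Rightarrow> complex) \<Rightarrow> 'a \<times> 'b \<Rightarrow> complex" where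
  "cube_diff K h g \<Phi> z = cube_product R K h (\<lambda>z. g (snd z) + \<Phi> z) z - cube_product S K h g (snd z)"

lemma cube_diff_bdd_borel:
  assumes "g \<in> bdd_borel N" "\<Phi> \<in> bdd_borel P" shows "cube_diff K h g \<Phi> \<in> bdd_borel P"
proof -
  have "(\<lambda>z. g (snd z) + \<Phi> z) \<in> bdd_borel P" by (intro bdd_borel_add assms bdd_borel_comp[OF assms(1)]) simp
  then show ?thesis
    unfolding cube_diff_def[abs_def]
    by (intro bdd_borel_diff R.cube_product_bdd_borel bdd_borel_comp[OF N.cube_product_bdd_borel[OF assms(1)]] measurable_snd)
qed

lemma norm_cube_product_le:
  assumes "\<And>x. norm (f x) \<le> B" shows "norm (cube_product Q K h f x) \<le> B ^ card (cube K)"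
proof -
  have "norm (cube_product Q K h f x) \<le> (\<Prod>\<eta>\<in>cube K. B)"
    unfolding cube_product_def prod_norm[symmetric] by (rule prod_mono) (simp add: norm_cnj_pow assms)
  then show ?thesis by simp
qed

lemma norm_cube_diff_le:
  assumes "\<And>y. norm (g y) \<le> B" "\<And>z. norm (\<Phi> z) \<le> B" "B \<ge> 1"
  shows "norm (cube_diff K h g \<Phi> z) \<le> 2 * (2 * B) ^ card (cube K)"
proof -
  have "norm (g (snd z) + \<Phi> z) \<le> 2 * B" for z
    using norm_triangle_ineq[of "g (snd z)" "\<Phi> z"] assms(1)[of "snd z"] assms(2)[of z] by simp
  then have "norm (cube_product R K h (\<lambda>z. g (snd z) + \<Phi> z) z) \<le> (2 * B) ^ card (cube K)"
    by (rule norm_cube_product_le)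
  moreover have "norm (cube_product S K h g (snd z)) \<le> (2 * B) ^ card (cube K)"
  proof -
    have "B ^ card (cube K) \<le> (2 * B) ^ card (cube K)" using assms(3) by (intro power_mono) auto
    then show ?thesis by (rule order_trans[OF norm_cube_product_le[of g B S K h "snd z", OF assms(1)]])
  qed
  ultimately show ?thesis
    unfolding cube_diff_def using norm_triangle_ineq4[of "cube_product R K h (\<lambda>z. g (snd z) + \<Phi> z) z" "cube_product S K h g (snd z)"]
    by simp
qed

lemma W_cnj_pow: "W i j V \<Longrightarrow> W i j (\<lambda>z. (cnj ^^ n) (V z))"
  by (induction n) (auto intro: W_cnj)

text \<open>For separated h, \<open>prod_perturbation\<close> with the times \<open>dot K h\<close>
  writes the difference as a sum over the vertices of functions of type \<open>W\<close>, all with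
  the gap L and thus subject to \<open>ww_sup_W_square_le\<close>. One factor
  \<open>card (cube K)\<close> stems from Cauchy-Schwarz for this sum, the other from the number of
  its terms.\<close>

lemma ww_sup_cube_diff_square_le:
  assumes g: "g \<in> bdd_borel N" "\<And>y. norm (g y) \<le> B" and \<Phi>: "W i (i + int L) \<Phi>" "\<And>z. norm (\<Phi> z) \<le> B"
    and B: "B \<ge> 1" and sep: "separated K L h" and n: "n \<ge> 1"
  shows "(\<integral>z. (ww_sup R n (cube_diff K h g \<Phi>) z)\<^sup>2 \<partial>P)
    \<le> (real (card (cube K)))\<^sup>2 * (6 * (real L + 1) * ((2 * B) ^ card (cube K))\<^sup>2) / sqrt (real n)"
proof -
  let ?I = "cube K"
  let ?e = "\<lambda>\<eta>. \<Sum>j=1..K. \<eta> j"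
  define u where "u \<eta> y = (cnj ^^ ?e \<eta>) (g ((S ^^ dot K h \<eta>) y))" for \<eta> y
  define v where "v \<eta> z = (cnj ^^ ?e \<eta>) (\<Phi> ((R ^^ dot K h \<eta>) z))" for \<eta> z
  have "\<exists>V. (\<forall>\<eta>\<in>?I. W (i + int (dot K h \<eta>)) (i + int (dot K h \<eta>) + int L) (V \<eta>) \<and> (\<forall>z. norm (V \<eta> z) \<le> (2 * B) ^ card ?I))
    \<and> (\<forall>z. (\<Prod>\<eta>\<in>?I. u \<eta> (snd z) + v \<eta> z) = (\<Prod>\<eta>\<in>?I. u \<eta> (snd z)) + (\<Sum>\<eta>\<in>?I. V \<eta> z))"
  proof (rule prod_perturbation[where \<tau>="dot K h"])
    show "finite ?I" by (rule finite_cube)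
    show "dot K h \<eta> + L \<le> dot K h \<eta>' \<or> dot K h \<eta>' + L \<le> dot K h \<eta>" if "\<eta> \<in> ?I" "\<eta>' \<in> ?I" "\<eta> \<noteq> \<eta>'" for \<eta> \<eta>'
      using sep that unfolding separated_def by blast
    show "u \<eta> \<in> bdd_borel N" for \<eta> unfolding u_def[abs_def] by (intro bdd_borel_cnj_pow N.bdd_borel_Tn g)
    show "norm (u \<eta> y) \<le> B" for \<eta> y by (simp add: u_def norm_cnj_pow g)
    show "W (i + int (dot K h \<eta>)) (i + int (dot K h \<eta>) + int L) (v \<eta>)" for \<eta>
    proof -
      have "i + int (dot K h \<eta>) + int L = i + int L + int (dot K h \<eta>)" by simp
      then show ?thesis unfolding v_def[abs_def] by (simp only:) (rule W_cnj_pow[OF W_R[OF \<Phi>(1)]])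
    qed
    show "norm (v \<eta> z) \<le> B" for \<eta> z by (simp add: v_def norm_cnj_pow \<Phi>)
  qed (rule B)
  then obtain V where V: "\<And>\<eta>. \<eta> \<in> ?I \<Longrightarrow> W (i + int (dot K h \<eta>)) (i + int (dot K h \<eta>) + int L) (V \<eta>)"
    "\<And>\<eta> z. \<eta> \<in> ?I \<Longrightarrow> norm (V \<eta> z) \<le> (2 * B) ^ card ?I"
    "\<And>z. (\<Prod>\<eta>\<in>?I. u \<eta> (snd z) + v \<eta> z) = (\<Prod>\<eta>\<in>?I. u \<eta> (snd z)) + (\<Sum>\<eta>\<in>?I. V \<eta> z)"
    by blast
  have eq: "cube_diff K h g \<Phi> = (\<lambda>z. \<Sum>\<eta>\<in>?I. V \<eta> z)"
  proof
    fix z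
    have "cube_product R K h (\<lambda>z. g (snd z) + \<Phi> z) z = (\<Prod>\<eta>\<in>?I. u \<eta> (snd z) + v \<eta> z)"
      by (simp add: cube_product_def u_def v_def cnj_pow_add funpow_map_prod)
    moreover have "cube_product S K h g (snd z) = (\<Prod>\<eta>\<in>?I. u \<eta> (snd z))"
      by (simp add: cube_product_def u_def)
    ultimately show "cube_diff K h g \<Phi> z = (\<Sum>\<eta>\<in>?I. V \<eta> z)" by (simp add: cube_diff_def V(3))
  qed
  let ?w = "\<lambda>\<eta> z. ww_sup R n (V \<eta>) z"
  let ?c = "6 * (real L + 1) * ((2 * B) ^ card ?I)\<^sup>2 / sqrt (real n)"
  have wb: "?w \<eta> \<in> bdd_nonneg P" if "\<eta> \<in> ?I" for \<eta> by (rule R.ww_sup_bdd_nonneg[OF W_bdd_borel[OF V(1)[OF that]]])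
  have sq: "integrable P (\<lambda>z. (f z)\<^sup>2)" if "f \<in> bdd_nonneg P" for f
  proof -
    have "(\<lambda>z. (f z)\<^sup>2) = (\<lambda>z. f z powr 2)" using bdd_nonneg_nonneg[OF that] by (simp add: fun_eq_iff)
    then show ?thesis using PR.bdd_nonneg_powr_integrable[OF that, of 2] by simp
  qed
  have "(\<integral>z. (ww_sup R n (cube_diff K h g \<Phi>) z)\<^sup>2 \<partial>P) \<le> (\<integral>z. real (card ?I) * (\<Sum>\<eta>\<in>?I. (?w \<eta> z)\<^sup>2) \<partial>P)"
  proof (rule integral_mono)
    show "integrable P (\<lambda>z. (ww_sup R n (cube_diff K h g \<Phi>) z)\<^sup>2)"
      by (intro sq R.ww_sup_bdd_nonneg cube_diff_bdd_borel g W_bdd_borel[OF \<Phi>(1)])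
    show "integrable P (\<lambda>z. real (card ?I) * (\<Sum>\<eta>\<in>?I. (?w \<eta> z)\<^sup>2))"
      by (intro integrable_mult_right Bochner_Integration.integrable_sum sq wb)
    fix z
    have "(ww_sup R n (cube_diff K h g \<Phi>) z)\<^sup>2 \<le> (\<Sum>\<eta>\<in>?I. ?w \<eta> z)\<^sup>2"
      unfolding eq by (intro power_mono ww_sup_sum_le finite_cube ww_sup_nonneg)
    also have "\<dots> \<le> real (card ?I) * (\<Sum>\<eta>\<in>?I. (?w \<eta> z)\<^sup>2)"
      using sum_squared_le_sum_of_squares[of "\<lambda>\<eta>. ?w \<eta> z" ?I] by (simp add: mult.commute)
    finally show "(ww_sup R n (cube_diff K h g \<Phi>) z)\<^sup>2 \<le> real (card ?I) * (\<Sum>\<eta>\<in>?I. (?w \<eta> z)\<^sup>2)" .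
  qed
  also have "\<dots> = real (card ?I) * (\<Sum>\<eta>\<in>?I. \<integral>z. (?w \<eta> z)\<^sup>2 \<partial>P)"
    by (simp add: Bochner_Integration.integral_sum sq wb)
  also have "\<dots> \<le> real (card ?I) * (\<Sum>\<eta>\<in>?I. ?c)"
    by (intro mult_left_mono sum_mono ww_sup_W_square_le[OF V(1,2) n]) auto
  also have "\<dots> = (real (card ?I))\<^sup>2 * (6 * (real L + 1) * ((2 * B) ^ card ?I)\<^sup>2) / sqrt (real n)"
    by (simp add: power2_eq_square)
  finally show ?thesis .
qed

end

lemma powr_minus_mono_exponent:
  fixes n :: nat and a b :: real
  assumes "n \<ge> 1" "b \<le> a" shows "real n powr (- a) \<le> real n powr (- b)"
  using assms by (intro powr_mono) auto

lemma sqrt_divide_sqrt_nat: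
  fixes n :: nat
  assumes "n \<ge> 1" "0 \<le> c"
  shows "sqrt (c / sqrt (real n)) = sqrt c * real n powr (- 1 / 4)"
proof -
  have "sqrt (sqrt (real n)) = (real n powr (1 / 2)) powr (1 / 2)"
    by (simp only: powr_half_sqrt[OF of_nat_0_le_iff] powr_half_sqrt[OF real_sqrt_ge_zero[OF of_nat_0_le_iff]])
  also have "\<dots> = real n powr (1 / 4)" unfolding powr_powr by simp
  finally have "sqrt (c / sqrt (real n)) = sqrt c / real n powr (1 / 4)" by (simp only: real_sqrt_divide)
  then show ?thesis using powr_minus_divide[of "real n" "1 / 4"] by simp
qed

context kolmogorov_product
begin

text \<open>For k \<ge> 2 three contributions add up: g itself with the rate \<alpha>, the
  perturbation for separated h with the rate 1/6, and the nonseparated h, bounded trivially and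
  counted. For k = 1 the rate 1/4 of the perturbation is weakened to the common exponent.\<close>

theorem ww_function_add_W:
  assumes k: "k \<ge> 1" and \<alpha>: "\<alpha> > 0" and p: "1 \<le> p"
    and g: "g \<in> bdd_borel N" "ww_function k \<alpha> p N S g" and \<Phi>0: "W i j \<Phi>"
  shows "ww_function k (min (1/6) \<alpha>) (min 2 p) P R (\<lambda>z. g (snd z) + \<Phi> z)"
proof -
  \<comment> \<open>The gap between measurability and orthogonality; for j < i it is 0, and
    \<open>W_mono\<close> enlarges j to i.\<close>
  define L where "L = nat (j - i)"
  have \<Phi>: "W i (i + int L) \<Phi>" by (rule W_mono[OF \<Phi>0]) (auto simp: L_def)
  obtain B1 B2 where B12: "\<And>y. norm (g y) \<le> B1" "\<And>z. norm (\<Phi> z) \<le> B2"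
    using bdd_borel_bound[OF g(1)] bdd_borel_bound[OF W_bdd_borel[OF \<Phi>]] by metis
  define B where "B = max 1 (max B1 B2)"
  have B: "B \<ge> 1" "\<And>y. norm (g y) \<le> B" "\<And>z. norm (\<Phi> z) \<le> B"
    using B12 by (auto simp: B_def le_max_iff_disj)
  define \<beta> where "\<beta> = min (1/6) \<alpha>"
  have \<beta>: "\<beta> \<le> 1/6" "\<beta> \<le> \<alpha>" by (auto simp: \<beta>_def)
  let ?F = "\<lambda>z. g (snd z) + \<Phi> z"
  have Fb: "?F \<in> bdd_borel P" by (intro bdd_borel_add W_bdd_borel[OF \<Phi>] bdd_borel_comp[OF g(1)]) simp
  show ?thesis
  proof (cases "k = 1")
    case True
    obtain C where C: "C > 0" "\<And>n. n \<ge> 1 \<Longrightarrow> Lp_norm N p (ww_sup S n g) \<le> C * real n powr (- \<alpha>)"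
      using g(2) True unfolding ww_function_def by auto
    define E where "E = sqrt (6 * (real L + 1) * B\<^sup>2)"
    have E: "E \<ge> 0" by (simp add: E_def)
    have "Lp_norm P (min 2 p) (ww_sup R n ?F) \<le> (2 * (C + E)) * real n powr (- \<beta>)" if n: "n \<ge> 1" for n
    proof -
      have "Lp_norm P (min 2 p) (ww_sup R n ?F) \<le> 2 * (Lp_norm N p (ww_sup S n g) + sqrt (\<integral>z. (ww_sup R n \<Phi> z)\<^sup>2 \<partial>P))"
        by (rule Lp_norm_ww_sup_add_le[OF p g(1) W_bdd_borel[OF \<Phi>]])
      also have "Lp_norm N p (ww_sup S n g) \<le> C * real n powr (- \<beta>)"
        using C(2)[OF n] powr_minus_mono_exponent[OF n \<beta>(2)] C(1) by (meson mult_left_mono order_trans less_imp_le)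
      also have "sqrt (\<integral>z. (ww_sup R n \<Phi> z)\<^sup>2 \<partial>P) \<le> E * real n powr (- \<beta>)"
      proof -
        have "sqrt (\<integral>z. (ww_sup R n \<Phi> z)\<^sup>2 \<partial>P) \<le> sqrt (6 * (real L + 1) * B\<^sup>2 / sqrt (real n))"
          by (intro real_sqrt_le_mono ww_sup_W_square_le[OF \<Phi>] B n)
        also have "\<dots> = E * real n powr (- 1 / 4)" unfolding E_def by (rule sqrt_divide_sqrt_nat[OF n]) simp
        also have "\<dots> \<le> E * real n powr (- \<beta>)"
          using powr_minus_mono_exponent[OF n, of \<beta> "1 / 4"] \<beta> E by (intro mult_left_mono) auto
        finally show ?thesis .
      qed
      finally show ?thesis by (simp add: algebra_simps)
    qed
    then show ?thesis
      using True bdd_borel_L_infinity[OF Fb] C(1) E unfolding ww_function_def \<beta>_def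
      by (auto intro!: exI[of _ "2 * (C + E)"])
  next
    case False
    define K where "K = k - 1"
    define r where "r n = nat \<lfloor>sqrt (real n)\<rfloor>" for n
    let ?H = "\<lambda>n. {1..K} \<rightarrow>\<^sub>E {1..r n}"
    let ?G = "\<lambda>n h. Lp_norm N p (ww_sup S n (cube_product S K h g)) powr (2/3)"
    obtain C where C: "C > 0" "\<And>n. n \<ge> 1 \<Longrightarrow> (1 / real (r n) ^ K) * (\<Sum>h\<in>?H n. ?G n h) \<le> C / real n powr \<alpha>"
      using g(2) False unfolding ww_function_def K_def r_def Let_def by auto
    define m where "m = card (cube K)"
    \<comment> \<open>\<open>E\<close> is the power 2/3 of the root of the constant in
      \<open>ww_sup_cube_diff_square_le\<close>, \<open>E'\<close> that of the trivial bound for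
      nonseparated h. In \<open>X\<close>, the factor 4 m^2 L belongs to the density of the
      latter.\<close>
    define E where "E = (sqrt ((real m)\<^sup>2 * (6 * (real L + 1) * ((2 * B) ^ m)\<^sup>2))) powr (2/3)"
    define E' where "E' = (2 * (2 * B) ^ m) powr (2/3)"
    define X where "X = 2 * (C + E + E' * (4 * real m ^ 2 * real L))"
    have E: "E \<ge> 0" "E' \<ge> 0" by (simp_all add: E_def E'_def)
    have X: "X > 0" unfolding X_def using C E by (simp add: add_pos_nonneg)
    have main: "(1 / real (r n) ^ K) * (\<Sum>h\<in>?H n. Lp_norm P (min 2 p) (ww_sup R n (cube_product R K h ?F)) powr (2/3)) \<le> X / real n powr \<beta>"
      if n: "n \<ge> 1" for n
    proof -
      have sn: "sqrt (real n) \<ge> 1" using n by simp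
      have r1: "r n \<ge> 1" unfolding r_def using sn by (simp add: le_nat_iff)
      \<comment> \<open>Rounding down at most halves a number that is at least 1; this converts 1 /
        \<open>r n\<close> into n^(-1/2).\<close>
      have r2: "sqrt (real n) \<le> 2 * real (r n)"
      proof -
        have "real (r n) = real_of_int \<lfloor>sqrt (real n)\<rfloor>" unfolding r_def using sn by simp
        then have "sqrt (real n) < real (r n) + 1" by linarith
        then show ?thesis using r1 by linarith
      qed
      have finH: "finite (?H n)" by (rule finite_PiE) auto
      let ?bad = "\<lambda>h. if separated K L h then 0 else E'"
      have term_le: "Lp_norm P (min 2 p) (ww_sup R n (cube_product R K h ?F)) powr (2/3)
         \<le> 2 * (?G n h + (E * real n powr (- 1/6) + ?bad h))" for h
      proof -
        let ?D = "cube_diff K h g \<Phi>"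
        let ?s = "sqrt (\<integral>z. (ww_sup R n ?D z)\<^sup>2 \<partial>P)"
        have Db: "?D \<in> bdd_borel P" by (rule cube_diff_bdd_borel[OF g(1) W_bdd_borel[OF \<Phi>]])
        have Gb: "cube_product S K h g \<in> bdd_borel N" by (rule N.cube_product_bdd_borel[OF g(1)])
        have s0: "?s \<ge> 0" by simp
        have A0: "Lp_norm N p (ww_sup S n (cube_product S K h g)) \<ge> 0"
          using N.Lp_norm_nonneg_min2[OF p N.ww_sup_bdd_nonneg[OF Gb]] N.Lp_norm_min2_le[OF p N.ww_sup_bdd_nonneg[OF Gb]] order_trans by blast
        have eq: "cube_product R K h ?F = (\<lambda>z. cube_product S K h g (snd z) + ?D z)"
          by (simp add: cube_diff_def fun_eq_iff)
        have "Lp_norm P (min 2 p) (ww_sup R n (cube_product R K h ?F))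
            \<le> 2 * (Lp_norm N p (ww_sup S n (cube_product S K h g)) + ?s)"
          unfolding eq by (rule Lp_norm_ww_sup_add_le[OF p Gb Db])
        moreover have "0 \<le> Lp_norm P (min 2 p) (ww_sup R n (cube_product R K h ?F))"
          by (intro PR.Lp_norm_nonneg_min2 p R.ww_sup_bdd_nonneg R.cube_product_bdd_borel Fb)
        ultimately have "Lp_norm P (min 2 p) (ww_sup R n (cube_product R K h ?F)) powr (2/3)
            \<le> (2 * (Lp_norm N p (ww_sup S n (cube_product S K h g)) + ?s)) powr (2/3)"
          by (intro powr_mono2) auto
        also have "\<dots> = 2 powr (2/3) * (Lp_norm N p (ww_sup S n (cube_product S K h g)) + ?s) powr (2/3)"
          by (rule powr_mult)
        also have "\<dots> \<le> 2 * (?G n h + ?s powr (2/3))"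
        proof (rule mult_mono)
          have "(2::real) powr (2/3) \<le> 2 powr 1" by (intro powr_mono) auto
          then show "(2::real) powr (2/3) \<le> 2" by simp
          show "(Lp_norm N p (ww_sup S n (cube_product S K h g)) + ?s) powr (2/3) \<le> ?G n h + ?s powr (2/3)"
            by (intro powr_add_le_add_powr A0 s0) auto
        qed auto
        also have "?s powr (2/3) \<le> E * real n powr (- 1/6) + ?bad h"
        proof (cases "separated K L h")
          case True
          have "?s \<le> sqrt ((real m)\<^sup>2 * (6 * (real L + 1) * ((2 * B) ^ m)\<^sup>2) / sqrt (real n))"
            unfolding m_def by (intro real_sqrt_le_mono ww_sup_cube_diff_square_le[OF g(1) B(2) \<Phi> B(3,1)] True n)
          also have "\<dots> = sqrt ((real m)\<^sup>2 * (6 * (real L + 1) * ((2 * B) ^ m)\<^sup>2)) * real n powr (- 1 / 4)"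
            by (rule sqrt_divide_sqrt_nat[OF n]) simp
          finally have "?s powr (2/3) \<le> (sqrt ((real m)\<^sup>2 * (6 * (real L + 1) * ((2 * B) ^ m)\<^sup>2)) * real n powr (- 1 / 4)) powr (2/3)"
            by (intro powr_mono2 s0) auto
          also have "\<dots> = E * (real n powr (- 1 / 4)) powr (2/3)" unfolding E_def by (rule powr_mult)
          also have "(real n powr (- 1 / 4)) powr (2/3) = real n powr (- 1/6)" by (simp add: powr_powr)
          finally show ?thesis using True by simp
        next
          case F: False
          have D: "norm (?D z) \<le> 2 * (2 * B) ^ m" for z
            unfolding m_def by (rule norm_cube_diff_le[OF B(2,3,1)])
          have D0: "0 \<le> 2 * (2 * B) ^ m" using B(1) by simp
          have "(\<integral>z. (ww_sup R n ?D z)\<^sup>2 \<partial>P) \<le> (\<integral>z. (2 * (2 * B) ^ m)\<^sup>2 \<partial>P)"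
            by (intro integral_mono' power_mono ww_sup_le_bound D D0 ww_sup_nonneg) auto
          then have "?s \<le> sqrt ((2 * (2 * B) ^ m)\<^sup>2)" by (intro real_sqrt_le_mono) (simp add: PR.prob_space)
          then have "?s \<le> 2 * (2 * B) ^ m" unfolding real_sqrt_abs using D0 by linarith
          then have "?s powr (2/3) \<le> E'" unfolding E'_def by (intro powr_mono2 s0) auto
          then show ?thesis using F E by (simp add: add_increasing)
        qed
        finally show ?thesis by simp
      qed
      have cH: "card (?H n) = r n ^ K" by (simp add: card_PiE)
      have badsum: "(\<Sum>h\<in>?H n. ?bad h) = real (card {h \<in> ?H n. \<not> separated K L h}) * E'"
        using finH by (simp add: sum.If_cases Int_def)
      have K1: "K \<ge> 1" using k False by (simp add: K_def)
      \<comment> \<open>The number of nonseparated h lacks exactly one power of \<open>r n\<close>,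
        which is split off here.\<close>
      have rK: "real (r n) ^ K = real (r n) * real (r n) ^ (K - 1)"
        using K1 by (metis Suc_diff_le diff_Suc_1 le_add_diff_inverse plus_1_eq_Suc power_Suc)
      have badcount: "(1 / real (r n) ^ K) * real (card {h \<in> ?H n. \<not> separated K L h}) \<le> (4 * real m ^ 2 * real L) * real n powr (- 1/6)"
      proof -
        have "real (card {h \<in> ?H n. \<not> separated K L h}) \<le> real (m\<^sup>2 * (2 * L * r n ^ (K - 1)))"
          unfolding m_def by (intro of_nat_mono card_not_separated_le)
        then have "(1 / real (r n) ^ K) * real (card {h \<in> ?H n. \<not> separated K L h})
          \<le> (1 / real (r n) ^ K) * (real m ^ 2 * (2 * real L * real (r n) ^ (K - 1)))"
          by (intro mult_left_mono) auto
        also have "\<dots> = (2 * real m ^ 2 * real L) * (1 / real (r n))"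
          unfolding rK using r1 by simp
        also have "\<dots> \<le> (2 * real m ^ 2 * real L) * (2 * real n powr (- 1/6))"
        proof (rule mult_left_mono)
          have "1 / real (r n) \<le> 2 / sqrt (real n)"
          proof -
            have "0 < sqrt (real n)" "0 < 2 * real (r n)" using sn r1 by linarith+
            then have "0 < 2 * real (r n) * sqrt (real n)" by (rule mult_pos_pos[rotated])
            then have "2 / (2 * real (r n)) \<le> 2 / sqrt (real n)"
              by (intro divide_left_mono[OF r2]) auto
            then show ?thesis by simp
          qed
          also have "\<dots> = 2 * real n powr (- (1/2))"
            unfolding powr_minus_divide powr_half_sqrt[OF of_nat_0_le_iff] by (simp only: times_divide_eq_right mult_1_right)
          \<comment> \<open>The density decays like n^(-1/2), but the separated terms limit the rate
            to 1/6 anyway.\<close>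
          also have "\<dots> \<le> 2 * real n powr (- (1/6))"
            by (intro mult_left_mono powr_minus_mono_exponent n) auto
          finally show "1 / real (r n) \<le> 2 * real n powr (- 1/6)" by simp
        qed simp
        finally show ?thesis by simp
      qed
      let ?R = "real (r n) ^ K"
      have R0: "?R > 0" using r1 by simp
      have "(1 / ?R) * (\<Sum>h\<in>?H n. Lp_norm P (min 2 p) (ww_sup R n (cube_product R K h ?F)) powr (2/3))
         \<le> (1 / ?R) * (\<Sum>h\<in>?H n. 2 * (?G n h + (E * real n powr (- 1/6) + ?bad h)))"
        by (intro mult_left_mono sum_mono term_le) simp
      also have "\<dots> = 2 * ((1 / ?R) * (\<Sum>h\<in>?H n. ?G n h) + E * real n powr (- 1/6)
          + (1 / ?R) * real (card {h \<in> ?H n. \<not> separated K L h}) * E')"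
      proof -
        have "(\<Sum>h\<in>?H n. 2 * (?G n h + (E * real n powr (- 1/6) + ?bad h)))
          = 2 * ((\<Sum>h\<in>?H n. ?G n h) + (?R * (E * real n powr (- 1/6)) + (\<Sum>h\<in>?H n. ?bad h)))"
          unfolding sum_distrib_left[symmetric] sum.distrib sum_constant cH by simp
        moreover have "(1 / Q) * (2 * (s + (Q * x + c * E'))) = 2 * ((1 / Q) * s + x + (1 / Q) * c * E')"
          if "Q > 0" for Q s x c :: real
          using that by (simp add: field_simps)
        note this[OF R0]
        ultimately show ?thesis unfolding badsum by (simp only:)
      qed
      also have "\<dots> \<le> 2 * (C / real n powr \<alpha> + E * real n powr (- 1/6) + (4 * real m ^ 2 * real L) * real n powr (- 1/6) * E')"
        by (intro mult_left_mono add_mono C(2) n order_refl mult_right_mono badcount E) auto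
      also have "\<dots> \<le> 2 * (C * real n powr (- \<beta>) + E * real n powr (- \<beta>) + (4 * real m ^ 2 * real L) * real n powr (- \<beta>) * E')"
      proof -
        have 1: "C / real n powr \<alpha> \<le> C * real n powr (- \<beta>)"
          using powr_minus_mono_exponent[OF n \<beta>(2)] C(1) by (simp add: powr_minus divide_inverse)
        have 2: "real n powr (- 1/6) \<le> real n powr (- \<beta>)"
          using powr_minus_mono_exponent[OF n \<beta>(1)] by simp
        show ?thesis
          by (intro mult_left_mono add_mono 1 mult_right_mono 2 E) auto
      qed
      also have "\<dots> = X * real n powr (- \<beta>)" by (simp add: X_def algebra_simps)
      also have "\<dots> = X / real n powr \<beta>" by (simp add: powr_minus divide_inverse)
      finally show ?thesis .
    qed
    then show ?thesis
      using False bdd_borel_L_infinity[OF Fb] X unfolding ww_function_def \<beta>_def K_def r_def Let_def by auto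
  qed
qed

lemma Lp_norm_two_sq:
  fixes f :: "'c \<Rightarrow> complex"
  shows "Lp_norm Q 2 f = sqrt (\<integral>x. (norm (f x))\<^sup>2 \<partial>Q)"
proof -
  have "(2::ereal) \<noteq> \<infinity>" "real_of_ereal 2 = 2" by auto
  then have "Lp_norm Q 2 f = (\<integral>x. norm (f x) powr 2 \<partial>Q) powr (1 / 2)" unfolding Lp_norm_def by presburger
  then show ?thesis by (simp add: powr_half_sqrt)
qed

text \<open>The fibre mean of G is approximated by a Wiener-Wintner function g on Y, the centred
  part by V of type \<open>W\<close>. As g + V has fibre mean g, it is orthogonal to the lifted
  factor. The two squared errors, each below e^2 / 4, are doubled and stay below e^2.\<close>

theorem ww_system_prod:
  assumes k: "k \<ge> 1" and \<alpha>: "\<alpha> > 0" and p: "1 \<le> p" and ww: "ww_system k \<alpha> p N S"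
  shows "ww_system k (min (1/6) \<alpha>) (min 2 p) P R"
proof -
  obtain Z D where erg: "ergodic_system N S" and Z: "hkz_factor N S k Z"
    and D: "\<And>f. f \<in> D \<Longrightarrow> ww_function k \<alpha> p N S f" and dense: "L_two_dense_in N D (L_two_perp N Z)"
    using ww unfolding ww_system_def by blast
  have sub: "subalgebra N Z" using Z by (simp add: hkz_factor_def)
  \<comment> \<open>The largest candidate for the dense set, so that only the approximation has to
    be shown.\<close>
  define D' where "D' = {F \<in> L_two_perp P (ZP Z). ww_function k (min (1/6) \<alpha>) (min 2 p) P R F}"
  have "\<exists>F\<in>D'. Lp_norm P 2 (\<lambda>z. F z - G z) < e" if G: "G \<in> L_two_perp P (ZP Z)" and e: "e > 0" for G e
  proof -
    have GL: "G \<in> L_two P" and Gc: "AE z in P. complex_cond_exp P (ZP Z) G z = 0"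
      using G by (auto simp: L_two_perp_def)
    have Gm: "G \<in> borel_measurable P" "integrable P (\<lambda>z. (norm (G z))\<^sup>2)" using GL by (auto simp: L_two_def)
    have a: "fibre_mean G \<in> L_two N" unfolding L_two_def using Gm fibre_mean_square_le(1)[OF Gm] by simp
    have "AE y in N. complex_cond_exp N Z (fibre_mean G) y = 0"
      using complex_cond_exp_ZP_zero_iff[OF sub PR.L_two_integrable[OF GL]] Gc by simp
    then have "fibre_mean G \<in> L_two_perp N Z" using a by (simp add: L_two_perp_def)
    then obtain f where f: "f \<in> D" "Lp_norm N 2 (\<lambda>y. f y - fibre_mean G y) < e / 2"
      using dense e unfolding L_two_dense_in_def by (meson half_gt_zero)
    have fperp: "f \<in> L_two_perp N Z" using dense f(1) unfolding L_two_dense_in_def by blast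
    have fww: "ww_function k \<alpha> p N S f" by (rule D[OF f(1)])
    then have "f \<in> L_infinity N" by (simp add: ww_function_def)
    then obtain g where g: "g \<in> bdd_borel N" "AE y in N. f y = g y" by (rule L_infinity_truncate)
    have fm: "f \<in> borel_measurable N" using fperp by (simp add: L_two_perp_def L_two_def)
    have gm: "g \<in> borel_measurable N" using g(1) by (rule bdd_borel_measurable)
    note [measurable] = fm gm Gm(1)
    have gww: "ww_function k \<alpha> p N S g" by (rule N.ww_function_cong_AE[OF fww g])
    have gperp: "AE y in N. complex_cond_exp N Z g y = 0"
      using complex_cond_exp_zero_cong[OF sfs_N[OF sub] fm gm g(2)] fperp by (simp add: L_two_perp_def)
    have gdist: "(\<integral>y. (norm (g y - fibre_mean G y))\<^sup>2 \<partial>N) < e\<^sup>2 / 4"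
    proof -
      have "(\<integral>y. (norm (g y - fibre_mean G y))\<^sup>2 \<partial>N) = (\<integral>y. (norm (f y - fibre_mean G y))\<^sup>2 \<partial>N)"
        by (rule integral_cong_AE) (use g(2) in \<open>auto elim: eventually_mono\<close>)
      moreover have "sqrt (\<integral>y. (norm (f y - fibre_mean G y))\<^sup>2 \<partial>N) < e / 2" using f(2) unfolding Lp_norm_two_sq .
      then have "(sqrt (\<integral>y. (norm (f y - fibre_mean G y))\<^sup>2 \<partial>N))\<^sup>2 < (e / 2)\<^sup>2"
        by (intro power_strict_mono) auto
      ultimately show ?thesis by (simp add: power_divide)
    qed
    have "e\<^sup>2 / 4 > 0" using e by simp
    then obtain i j V where V: "W i j V" "(\<integral>z. (norm (centered G z - V z))\<^sup>2 \<partial>P) < e\<^sup>2 / 4"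
      using centered_L_two_approx[OF GL] by blast
    let ?F = "\<lambda>z. g (snd z) + V z"
    have gb: "(\<lambda>z. g (snd z)) \<in> bdd_borel P" by (rule bdd_borel_comp[OF g(1)]) simp
    have Vb: "V \<in> bdd_borel P" by (rule W_bdd_borel[OF V(1)])
    have Fb: "?F \<in> bdd_borel P" by (intro bdd_borel_add gb Vb)
    have avgF: "fibre_mean ?F y = g y" if "y \<in> space N" for y
      using fibre_mean_add[OF gb Vb that] fibre_mean_W[OF V(1) that] fibre_mean_snd_fun[of g y] by simp
    have "AE y in N. complex_cond_exp N Z (fibre_mean ?F) y = 0"
      using complex_cond_exp_zero_cong[OF sfs_N[OF sub] bdd_borel_measurable[OF fibre_mean_bdd_borel[OF Fb]] gm] gperp avgF by simp
    then have "AE z in P. complex_cond_exp P (ZP Z) ?F z = 0"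
      using complex_cond_exp_ZP_zero_iff[OF sub PR.bdd_borel_integrable[OF Fb]] by simp
    then have "?F \<in> L_two_perp P (ZP Z)" using PR.bdd_borel_L_two[OF Fb] by (simp add: L_two_perp_def)
    then have "?F \<in> D'"
      unfolding D'_def mem_Collect_eq
      using ww_function_add_W[OF k \<alpha> p g(1) gww V(1)] by (rule conjI)
    moreover have "Lp_norm P 2 (\<lambda>z. ?F z - G z) < e"
    proof -
      have d1: "(\<lambda>z. g (snd z) - fibre_mean G (snd z)) \<in> L_two P"
      proof -
        have d: "(\<lambda>y. g y - fibre_mean G y) \<in> L_two N" by (rule L_two_diff[OF N.bdd_borel_L_two[OF g(1)] a])
        have "integrable P (\<lambda>z. (norm (g (snd z) - fibre_mean G (snd z)))\<^sup>2)"
          using integrable_distr_eq[of snd P N "\<lambda>y. (norm (g y - fibre_mean G y))\<^sup>2"] d by (simp add: distr_snd L_two_def)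
        then show ?thesis by (simp add: L_two_def)
      qed
      have aP: "(\<lambda>z. fibre_mean G (snd z)) \<in> L_two P"
        using L_two_diff[OF PR.bdd_borel_L_two[OF gb] d1] by simp
      have d2: "(\<lambda>z. V z - centered G z) \<in> L_two P"
        using L_two_diff[OF PR.bdd_borel_L_two[OF Vb] L_two_diff[OF GL aP]] by (simp add: centered_def)
      have "(\<integral>z. (norm (?F z - G z))\<^sup>2 \<partial>P) = (\<integral>z. (norm ((g (snd z) - fibre_mean G (snd z)) + (V z - centered G z)))\<^sup>2 \<partial>P)"
        by (simp add: centered_def algebra_simps)
      also have "\<dots> \<le> 2 * (\<integral>z. (norm (g (snd z) - fibre_mean G (snd z)))\<^sup>2 \<partial>P) + 2 * (\<integral>z. (norm (V z - centered G z))\<^sup>2 \<partial>P)"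
        by (rule L_two_square_add_le[OF d1 d2])
      also have "(\<integral>z. (norm (g (snd z) - fibre_mean G (snd z)))\<^sup>2 \<partial>P) = (\<integral>y. (norm (g y - fibre_mean G y))\<^sup>2 \<partial>N)"
        using integral_snd_comp[of "\<lambda>y. (norm (g y - fibre_mean G y))\<^sup>2"] by simp
      also have "2 * \<dots> + 2 * (\<integral>z. (norm (V z - centered G z))\<^sup>2 \<partial>P) < e\<^sup>2"
        using gdist V(2) by (simp add: norm_minus_commute)
      finally have "sqrt (\<integral>z. (norm (?F z - G z))\<^sup>2 \<partial>P) < sqrt (e\<^sup>2)" by (rule real_sqrt_less_mono)
      then show ?thesis unfolding Lp_norm_two_sq using e by simp
    qed
    ultimately show ?thesis by (rule bexI[of "\<lambda>F. Lp_norm P 2 (\<lambda>z. F z - G z) < e" ?F D', rotated])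
  qed
  then have "L_two_dense_in P D' (L_two_perp P (ZP Z))"
    unfolding L_two_dense_in_def D'_def by blast
  then show ?thesis
    unfolding ww_system_def using ergodic_prod[OF erg] hkz_factor_ZP[OF k Z]
    by (intro conjI exI[of _ "ZP Z"] exI[of _ D']) (auto simp: D'_def)
qed

end

theorem theorem7p1:
  fixes M :: "'a measure" and T :: "'a \<Rightarrow> 'a"
    and N :: "'b measure" and S :: "'b \<Rightarrow> 'b"
    and k :: nat and \<alpha> :: real and p :: ereal
  assumes "k \<ge> 1" and "\<alpha> > 0" and "1 \<le> p"
    and "kolmogorov_system M T"
    and "ww_system k \<alpha> p N S"
  shows "ww_system k (min (1/6) \<alpha>) (min 2 p) (M \<Otimes>\<^sub>M N) (map_prod T S)"
proof -
  obtain FF U where "kolmogorov_filtration M T FF U" using kolmogorov_system_imp_kolmogorov_filtration[OF assms(4)] by blast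
  moreover have "measure_preserving N S" using assms(5) by (simp add: measure_preserving_def ww_system_def ergodic_system_def)
  ultimately interpret kolmogorov_product M T FF U N S by (intro kolmogorov_product.intro)
  show ?thesis by (rule ww_system_prod[OF assms(1,2,3,5)])
qed

end
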